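(* Let $\sigma$ be a symmetric Kubo-Ando mean. For a non-commutative $C^*$-algebra $\mathcal A$, the following conditions are equivalent: (i) $\sigma$ is the geometric mean; (ii) there is no Kubo-Ando mean $\tau$ different from $\sigma$ of the form $$A\tau B=\varphi^{-1}(\varphi(A)\sigma \varphi(B)),\quad A,B\in \mathcal A^{++}$$ with some continuous strictly monotone function $\varphi:]0,\infty[\to ]0,\infty[$.
   Context: All $C^*$-algebras are unital; any $C^*$-algebra $\mathcal A$ is viewed as a norm-closed unital *-subalgebra of some $B(H)$ ($H$ a complex Hilbert space), and $\mathcal A^{++}$ denotes its positive definite cone (the set of all positive invertible elements of $\mathcal A$). A Kubo-Ando mean $\sigma$ is a binary operation on positive operators satisfying monotonicity in both variables, the transformer inequality $C(A\sigma B)C\leq (CAC)\sigma(CBC)$, downward strong continuity, and $I\sigma I=I$; it is determined by its representing operator monotone function $f:]0,\infty[\to]0,\infty[$ with $f(1)=1$ via $A\sigma B=A^{1/2}f(A^{-1/2}BA^{-1/2})A^{1/2}$ for invertible positive $A$, so it makes sense on $\mathcal A^{++}$. $\sigma$ is symmetric if $A\sigma B=B\sigma A$ (equivalently $tf(1/t)=f(t)$). The geometric mean has representing function $t\mapsto\sqrt t$, i.e. $A\sharp B=A^{1/2}(A^{-1/2}BA^{-1/2})^{1/2}A^{1/2}$. Images of operators under real functions are meant in the sense of continuous functional calculus. *)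

theory Defs
  imports "HOL-Analysis.Analysis" "HOL-Computational_Algebra.Polynomial"
begin

class cstar_algebra = real_normed_algebra_1 + banach +
  fixes cscale :: "complex \<Rightarrow> 'a \<Rightarrow> 'a"
    and cstar :: "'a \<Rightarrow> 'a"
  assumes cscale_add_right: "cscale c (x + y) = cscale c x + cscale c y"
    and cscale_add_left: "cscale (c + d) x = cscale c x + cscale d x"
    and cscale_cscale: "cscale c (cscale d x) = cscale (c * d) x"
    and cscale_of_real: "cscale (complex_of_real r) x = scaleR r x"
    and cscale_mult_left: "cscale c (x * y) = cscale c x * y"
    and cscale_mult_right: "cscale c (x * y) = x * cscale c y"
    and norm_cscale: "norm (cscale c x) = cmod c * norm x"
    and cstar_cstar: "cstar (cstar x) = x"
    and cstar_add: "cstar (x + y) = cstar x + cstar y"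
    and cstar_cscale: "cstar (cscale c x) = cscale (cnj c) (cstar x)"
    and cstar_mult: "cstar (x * y) = cstar y * cstar x"
    and cstar_identity: "norm (cstar x * x) = (norm x)\<^sup>2"

definition cs_invertible :: "'a::ring_1 \<Rightarrow> bool" where
  "cs_invertible x \<longleftrightarrow> (\<exists>y. x * y = 1 \<and> y * x = 1)"

definition cspectrum :: "'a::cstar_algebra \<Rightarrow> complex set" where
  "cspectrum a = {c. \<not> cs_invertible (a - cscale c 1)}"

text \<open>Real part of the spectrum (the whole spectrum for self-adjoint elements).\<close>
definition rspectrum :: "'a::cstar_algebra \<Rightarrow> real set" where
  "rspectrum a = {t. complex_of_real t \<in> cspectrum a}"

definition selfadjoint :: "'a::cstar_algebra \<Rightarrow> bool" where
  "selfadjoint a \<longleftrightarrow> cstar a = a"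

definition cs_positive :: "'a::cstar_algebra \<Rightarrow> bool" where
  "cs_positive a \<longleftrightarrow> selfadjoint a \<and> cspectrum a \<subseteq> complex_of_real ` {0..}"

definition pos_def_cone :: "'a::cstar_algebra set" where
  "pos_def_cone = {a. cs_positive a \<and> cs_invertible a}"

definition poly_eval :: "real poly \<Rightarrow> 'a::real_algebra_1 \<Rightarrow> 'a" where
  "poly_eval p a = (\<Sum>i\<le>degree p. scaleR (coeff p i) (a ^ i))"

definition cfc :: "(real \<Rightarrow> real) \<Rightarrow> 'a::cstar_algebra \<Rightarrow> 'a" where
  "cfc f a = (THE b. \<forall>p :: nat \<Rightarrow> real poly.
      uniform_limit (rspectrum a) (\<lambda>n t. poly (p n) t) f sequentially
        \<longrightarrow> (\<lambda>n. poly_eval (p n) a) \<longlonglongrightarrow> b)"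

definition ka_mean :: "(real \<Rightarrow> real) \<Rightarrow> 'a::cstar_algebra \<Rightarrow> 'a \<Rightarrow> 'a" where
  "ka_mean f a b =
     (let s = cfc sqrt a; si = cfc (\<lambda>t. inverse (sqrt t)) a in s * cfc f (si * b * si) * s)"

text \<open>n x n complex matrices are functions nat => nat => complex, only entries with
indices < n matter.\<close>

definition mat_hermitian :: "nat \<Rightarrow> (nat \<Rightarrow> nat \<Rightarrow> complex) \<Rightarrow> bool" where
  "mat_hermitian n A \<longleftrightarrow> (\<forall>i<n. \<forall>j<n. A j i = cnj (A i j))"

definition quad_form :: "nat \<Rightarrow> (nat \<Rightarrow> nat \<Rightarrow> complex) \<Rightarrow> (nat \<Rightarrow> complex) \<Rightarrow> complex" where
  "quad_form n A v = (\<Sum>i<n. \<Sum>j<n. cnj (v i) * A i j * v j)"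

definition mat_psd :: "nat \<Rightarrow> (nat \<Rightarrow> nat \<Rightarrow> complex) \<Rightarrow> bool" where
  "mat_psd n A \<longleftrightarrow> mat_hermitian n A \<and> (\<forall>v. Re (quad_form n A v) \<ge> 0)"

definition mat_pd :: "nat \<Rightarrow> (nat \<Rightarrow> nat \<Rightarrow> complex) \<Rightarrow> bool" where
  "mat_pd n A \<longleftrightarrow> mat_hermitian n A \<and>
     (\<forall>v. (\<exists>i<n. v i \<noteq> 0) \<longrightarrow> Re (quad_form n A v) > 0)"

definition mat_le :: "nat \<Rightarrow> (nat \<Rightarrow> nat \<Rightarrow> complex) \<Rightarrow> (nat \<Rightarrow> nat \<Rightarrow> complex) \<Rightarrow> bool" where
  "mat_le n A B \<longleftrightarrow> mat_psd n (\<lambda>i j. B i j - A i j)"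

definition mat_unitary :: "nat \<Rightarrow> (nat \<Rightarrow> nat \<Rightarrow> complex) \<Rightarrow> bool" where
  "mat_unitary n U \<longleftrightarrow> (\<forall>i<n. \<forall>j<n. (\<Sum>k<n. cnj (U k i) * U k j) = (if i = j then 1 else 0))"

definition mat_fun :: "nat \<Rightarrow> (real \<Rightarrow> real) \<Rightarrow> (nat \<Rightarrow> nat \<Rightarrow> complex) \<Rightarrow> (nat \<Rightarrow> nat \<Rightarrow> complex)" where
  "mat_fun n f A = (THE B. \<exists>U d. mat_unitary n U \<and>
      (\<forall>i<n. \<forall>j<n. A i j = (\<Sum>k<n. U i k * complex_of_real (d k) * cnj (U j k))) \<and>
      (\<forall>i j. B i j = (if i < n \<and> j < n
          then (\<Sum>k<n. U i k * complex_of_real (f (d k)) * cnj (U j k)) else 0)))"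

definition operator_monotone_pos :: "(real \<Rightarrow> real) \<Rightarrow> bool" where
  "operator_monotone_pos f \<longleftrightarrow>
     (\<forall>n A B. mat_pd n A \<and> mat_pd n B \<and> mat_le n A B \<longrightarrow> mat_le n (mat_fun n f A) (mat_fun n f B))"

text \<open>Representing functions of Kubo-Ando means: operator monotone f : ]0,oo[ -> ]0,oo[
with f(1) = 1.  Kubo-Ando means correspond bijectively to these.\<close>
definition ka_rep :: "(real \<Rightarrow> real) \<Rightarrow> bool" where
  "ka_rep f \<longleftrightarrow> operator_monotone_pos f \<and> (\<forall>t>0. f t > 0) \<and> f 1 = 1"

definition ka_symmetric :: "(real \<Rightarrow> real) \<Rightarrow> bool" where
  "ka_symmetric f \<longleftrightarrow> (\<forall>t>0. t * f (1 / t) = f t)"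

end

theory Submission
  imports Defs "Jordan_Normal_Form.Spectral_Radius"
begin

text \<open>
  If \<open>f\<close> is not the square root, then \<open>\<phi> t = 1 / t\<close> produces the adjoint mean, represented by
  \<open>1 / f (1 / t)\<close>, which by symmetry is \<open>t / f t\<close> and hence differs from \<open>f\<close>.

  Conversely, let \<open>\<phi>\<inverse> (\<phi> a # \<phi> b)\<close> be a Kubo-Ando mean. On scalars this says that a quasi-arithmetic
  mean with generator \<open>\<psi> = ln \<phi>\<close> is homogeneous, so \<open>\<psi> (s t) = A s * \<psi> t + B s\<close> with \<open>A\<close>
  multiplicative. If \<open>A = 1\<close>, the mean is the geometric one. Otherwise \<open>A s = 2\<close> for some \<open>s\<close>, that is,
  \<open>\<phi> (s t) = c (\<phi> t)\<^sup>2\<close>, and homogeneity of the operator mean turns \<open>G = \<phi> a # \<phi> b\<close> into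
  \<open>G\<^sup>2 = (\<phi> a)\<^sup>2 # (\<phi> b)\<^sup>2\<close>. With \<open>P = (\<phi> a)\<inverse>\<close> the Riccati equations \<open>G P G = \<phi> b\<close> and
  \<open>G\<^sup>2 P\<^sup>2 G\<^sup>2 = (\<phi> b)\<^sup>2\<close> give \<open>G P\<^sup>2 G = P G\<^sup>2 P\<close> for all \<open>G\<close>, \<open>P\<close> close to scalars. Comparing
  \<open>P = 1 + h\<close> with \<open>P = 1 - h\<close> yields \<open>[z, [z, x]] = 0\<close> for all self-adjoint \<open>z\<close>, \<open>x\<close>, which forces
  the algebra to be commutative.
\<close>

section \<open>Elements of a C*-algebra and the norm as spectral radius\<close>

text \<open>The algebra is abstract, so \<open>cfc\<close> is a definite description over all
  approximating polynomial sequences. It denotes something because the norm of a real polynomial in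
  a self-adjoint element is the modulus of one of its values on the spectrum; this rests on the
  spectral radius being the norm, obtained here without holomorphic functions. The value 2 for
  \<open>A s\<close> makes the resulting identity between means polynomial: the Riccati equations
  then involve only products of \<open>G\<close> and \<open>P\<close>. The range of
  \<open>\<phi>\<close> may be a proper subset of the positive reals, so its inverse acts only on
  elements with spectrum in that range; staying near a scalar inside this open set secures that. The
  final comparison is exact: the part of the identity odd in \<open>h\<close> is the double
  commutator alone, so there are no error terms to estimate. For the adjoint mean,
  \<open>1 / f (1 / t)\<close> must be shown operator monotone, which rests on inversion reversing
  the order of matrices and hence on diagonalization. Continuity of \<open>f\<close>, needed for
  \<open>cfc\<close>, comes from \<open>f\<close> being increasing and, by symmetry,
  \<open>f t / t\<close> being decreasing.\<close>

lemma cscale_one [simp]: "cscale 1 (x::'a::cstar_algebra) = x"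
  using cscale_of_real[of 1 x] by simp

lemma cscale_zero_left [simp]: "cscale 0 (x::'a::cstar_algebra) = 0"
  using cscale_of_real[of 0 x] by simp

lemma cscale_minus_left: "cscale (- c) (x::'a::cstar_algebra) = - cscale c x"
  using cscale_add_left[of c "-c" x] by (simp add: minus_unique)

lemma cscale_diff_left: "cscale (c - d) (x::'a::cstar_algebra) = cscale c x - cscale d x"
  using cscale_add_left[of c "-d" x] by (simp add: cscale_minus_left)

lemma cscale_zero_right [simp]: "cscale c (0::'a::cstar_algebra) = 0"
  using cscale_add_right[of c 0 0] by simp

lemma cscale_minus_right: "cscale c (- x::'a::cstar_algebra) = - cscale c x"
  using cscale_add_right[of c x "-x"] by (simp add: minus_unique)

lemma cscale_diff_right: "cscale c (x - y::'a::cstar_algebra) = cscale c x - cscale c y"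
  using cscale_add_right[of c x "-y"] by (simp add: cscale_minus_right)

lemma cscale_power: "(cscale c (x::'a::cstar_algebra)) ^ n = cscale (c ^ n) (x ^ n)"
proof (induction n)
  case (Suc n)
  have "cscale c x * cscale (c ^ n) (x ^ n) = cscale (c * c ^ n) (x * x ^ n)"
    by (metis cscale_cscale cscale_mult_left cscale_mult_right)
  then show ?case using Suc by simp
qed simp

lemma cstar_zero [simp]: "cstar (0::'a::cstar_algebra) = 0"
  using cstar_add[of 0 0] by simp

lemma cstar_minus: "cstar (- x::'a::cstar_algebra) = - cstar x"
  using cstar_add[of x "-x"] by (simp add: minus_unique)

lemma cstar_diff: "cstar (x - y::'a::cstar_algebra) = cstar x - cstar y"
  using cstar_add[of x "-y"] by (simp add: cstar_minus)

lemma cstar_one [simp]: "cstar (1::'a::cstar_algebra) = 1"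
  by (metis cstar_cstar cstar_mult mult_1_left mult_1_right)

lemma cstar_scaleR: "cstar (r *\<^sub>R x::'a::cstar_algebra) = r *\<^sub>R cstar x"
  by (metis complex_cnj_complex_of_real cscale_of_real cstar_cscale)

lemma cstar_power: "cstar ((x::'a::cstar_algebra) ^ n) = cstar x ^ n"
  by (induction n) (simp_all add: cstar_mult power_commutes)

lemma norm_cstar [simp]: "norm (cstar (x::'a::cstar_algebra)) = norm x"
proof -
  have le: "norm y \<le> norm (cstar y)" for y :: 'a
  proof (cases "y = 0")
    case False
    have "(norm y)\<^sup>2 \<le> norm (cstar y) * norm y"
      by (metis cstar_identity norm_mult_ineq)
    with False show ?thesis by (simp add: power2_eq_square)
  qed simp
  from le[of x] le[of "cstar x"] show ?thesis by (simp add: cstar_cstar)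
qed

lemma bounded_linear_cstar: "bounded_linear (cstar :: 'a::cstar_algebra \<Rightarrow> 'a)"
  by (rule bounded_linear_intro[of _ 1]) (simp_all add: cstar_add cstar_scaleR)

lemmas tendsto_cstar = bounded_linear.tendsto[OF bounded_linear_cstar]

lemma selfadjointI: "cstar a = a \<Longrightarrow> selfadjoint a"
  and selfadjointD: "selfadjoint a \<Longrightarrow> cstar a = a"
  by (auto simp: selfadjoint_def)

lemma selfadjoint_add: "selfadjoint a \<Longrightarrow> selfadjoint b \<Longrightarrow> selfadjoint (a + b)"
  and selfadjoint_minus: "selfadjoint a \<Longrightarrow> selfadjoint (- a)"
  and selfadjoint_diff: "selfadjoint a \<Longrightarrow> selfadjoint b \<Longrightarrow> selfadjoint (a - b)"
  and selfadjoint_scaleR: "selfadjoint a \<Longrightarrow> selfadjoint (r *\<^sub>R a)"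
  and selfadjoint_one: "selfadjoint 1"
  and selfadjoint_zero: "selfadjoint 0"
  and selfadjoint_power: "selfadjoint a \<Longrightarrow> selfadjoint (a ^ n)"
  and selfadjoint_conj: "selfadjoint a \<Longrightarrow> selfadjoint b \<Longrightarrow> selfadjoint (b * a * b)"
  by (simp_all add: selfadjoint_def cstar_add cstar_minus cstar_diff cstar_scaleR cstar_power
      cstar_mult mult.assoc)

lemmas selfadjoint_intros = selfadjoint_add selfadjoint_minus selfadjoint_diff
  selfadjoint_scaleR selfadjoint_one selfadjoint_zero selfadjoint_power selfadjoint_conj

lemma tendsto_selfadjoint:
  fixes X :: "nat \<Rightarrow> 'a::cstar_algebra"
  assumes "X \<longlonglongrightarrow> L" "\<And>n. selfadjoint (X n)"
  shows "selfadjoint L"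
proof -
  have "(\<lambda>n. cstar (X n)) \<longlonglongrightarrow> cstar L" by (rule tendsto_cstar[OF assms(1)])
  then have "X \<longlonglongrightarrow> cstar L" using assms(2) by (simp add: selfadjoint_def)
  then show ?thesis using assms(1) LIMSEQ_unique selfadjointI by blast
qed

section \<open>Inverses, the spectrum and the resolvent\<close>

definition cs_inv :: "'a::ring_1 \<Rightarrow> 'a" where
  "cs_inv x = (SOME y. x * y = 1 \<and> y * x = 1)"

lemma cs_inv: "cs_invertible x \<Longrightarrow> x * cs_inv x = 1" "cs_invertible x \<Longrightarrow> cs_inv x * x = 1"
  unfolding cs_invertible_def cs_inv_def by (metis (mono_tags, lifting) someI_ex)+

lemma left_right_inverse_unique:
  fixes x :: "'a::ring_1"
  assumes "x * y = 1" "z * x = 1"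
  shows "y = z"
  by (metis assms mult.assoc mult_1_left mult_1_right)

lemma cs_inv_eqI: "x * y = 1 \<Longrightarrow> y * x = 1 \<Longrightarrow> cs_inv x = y"
  using cs_inv left_right_inverse_unique cs_invertible_def by blast

lemma cs_invertibleI: "x * y = 1 \<Longrightarrow> y * x = 1 \<Longrightarrow> cs_invertible x"
  unfolding cs_invertible_def by blast

lemma cs_invertible_mult:
  fixes x y :: "'a::ring_1"
  assumes "cs_invertible x" "cs_invertible y" shows "cs_invertible (x * y)"
proof (rule cs_invertibleI[of _ "cs_inv y * cs_inv x"])
  show "x * y * (cs_inv y * cs_inv x) = 1"
    by (metis assms cs_inv(1) mult.assoc mult_1_right)
  show "cs_inv y * cs_inv x * (x * y) = 1"
    by (metis assms cs_inv(2) mult.assoc mult_1_left)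
qed

lemma cs_invertible_cscale:
  fixes x :: "'a::cstar_algebra"
  assumes "c \<noteq> 0" shows "cs_invertible (cscale c x) \<longleftrightarrow> cs_invertible x"
proof -
  have *: "cs_invertible (cscale d y)" if "cs_invertible y" "d \<noteq> 0" for y :: 'a and d
    by (rule cs_invertibleI[of _ "cscale (1/d) (cs_inv y)"])
       (simp_all add: that cs_inv cscale_mult_left[symmetric] cscale_mult_right[symmetric] cscale_cscale)
  show ?thesis using *[of x c] *[of "cscale c x" "1/c"] assms by (auto simp: cscale_cscale)
qed

text \<open>Neumann series: the sum \<open>S\<close> of the powers of \<open>x\<close> satisfies
  \<open>S = 1 + x * S = 1 + S * x\<close>.\<close>

lemma cs_invertible_one_minus:
  fixes x :: "'a::{real_normed_algebra_1,banach}"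
  assumes "norm x < 1"
  shows "cs_invertible (1 - x)"
proof -
  have summ: "summable (\<lambda>n. x ^ n)"
  proof (rule summable_comparison_test)
    show "\<exists>N. \<forall>n\<ge>N. norm (x ^ n) \<le> norm x ^ n" by (simp add: norm_power_ineq)
    show "summable (\<lambda>n. norm x ^ n)" using assms by (simp add: summable_geometric)
  qed
  define S where "S = suminf (\<lambda>n. x ^ n)"
  have "S = 1 + suminf (\<lambda>n. x ^ Suc n)"
    using suminf_split_head[OF summ] by (simp add: S_def)
  moreover have "suminf (\<lambda>n. x ^ Suc n) = x * S"
    unfolding S_def power_Suc by (rule suminf_mult[OF summ])
  moreover have "suminf (\<lambda>n. x ^ Suc n) = S * x"
    unfolding S_def power_Suc2 by (rule suminf_mult2[OF summ, symmetric])
  ultimately have "(1 - x) * S = 1" "S * (1 - x) = 1" by (simp_all add: algebra_simps)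
  then show ?thesis by (rule cs_invertibleI)
qed

lemma cscale_one_mult: "cscale c 1 * x = cscale c (x::'a::cstar_algebra)"
  by (metis cscale_mult_left mult_1_left)

lemma mult_cscale_one: "x * cscale c 1 = cscale c (x::'a::cstar_algebra)"
  by (metis cscale_mult_right mult_1_right)

lemma cspectrum_norm_le:
  fixes a :: "'a::cstar_algebra"
  assumes "c \<in> cspectrum a" shows "cmod c \<le> norm a"
proof (rule ccontr)
  assume "\<not> cmod c \<le> norm a"
  then have c: "c \<noteq> 0" "norm (cscale (1/c) a) < 1"
    by (auto simp: norm_cscale norm_divide divide_simps)
  have "a - cscale c 1 = cscale (- c) (1 - cscale (1/c) a)"
    using c by (simp add: cscale_diff_right cscale_minus_left cscale_cscale)
  with cs_invertible_one_minus[OF c(2)] c(1) have "cs_invertible (a - cscale c 1)"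
    by (simp add: cs_invertible_cscale)
  with assms show False by (simp add: cspectrum_def)
qed

lemma cspectrum_add_scalar:
  "c + d \<in> cspectrum (a + cscale d 1) \<longleftrightarrow> c \<in> cspectrum (a::'a::cstar_algebra)"
  by (simp add: cspectrum_def cscale_add_left)

text \<open>Adding \<open>i t\<close> shifts the spectrum by \<open>i t\<close>, while the
  C*-identity lets the squared norm grow only by \<open>t^2\<close>. The left side of
  \<open>key\<close> contains the term \<open>2 t Im c\<close>, which is unbounded in
  \<open>t\<close> unless \<open>Im c = 0\<close>.\<close>

lemma selfadjoint_cspectrum_real:
  fixes a :: "'a::cstar_algebra"
  assumes sa: "selfadjoint a" and c: "c \<in> cspectrum a"
  shows "Im c = 0"
proof -
  have key: "(Im c + t)\<^sup>2 \<le> (norm a)\<^sup>2 + t\<^sup>2" for t :: real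
  proof -
    let ?d = "\<i> * complex_of_real t"
    let ?b = "a + cscale ?d 1"
    have "c + ?d \<in> cspectrum ?b" using c by (simp add: cspectrum_add_scalar)
    then have "cmod (c + ?d) \<le> norm ?b" by (rule cspectrum_norm_le)
    then have 1: "(cmod (c + ?d))\<^sup>2 \<le> (norm ?b)\<^sup>2" by simp
    have "cstar ?b = a - cscale ?d 1"
      using selfadjointD[OF sa] by (simp add: cstar_add cstar_cscale cscale_minus_left)
    then have "cstar ?b * ?b = a * a - cscale ?d 1 * cscale ?d 1"
      by (simp only: left_diff_distrib distrib_left cscale_one_mult mult_cscale_one)
         (simp add: cscale_diff_right)
    also have "\<dots> = a * a + cscale (?d * cnj ?d) 1"
      by (simp only: cscale_one_mult cscale_cscale) (simp flip: cscale_minus_left)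
    also have "?d * cnj ?d = complex_of_real (t\<^sup>2)"
      by (simp add: complex_eq_iff power2_eq_square)
    finally have "norm (cstar ?b * ?b) \<le> norm (a * a) + norm (t\<^sup>2 *\<^sub>R (1::'a))"
      unfolding cscale_of_real by (metis norm_triangle_ineq)
    also have "\<dots> \<le> (norm a)\<^sup>2 + t\<^sup>2"
      using norm_mult_ineq[of a a] by (simp add: power2_eq_square)
    finally have 2: "(norm ?b)\<^sup>2 \<le> (norm a)\<^sup>2 + t\<^sup>2" by (simp add: cstar_identity)
    have "(Im c + t)\<^sup>2 \<le> (cmod (c + ?d))\<^sup>2" by (simp add: cmod_power2)
    with 1 2 show ?thesis by linarith
  qed
  show ?thesis
  proof (rule ccontr)
    assume n: "Im c \<noteq> 0"
    \<comment> \<open>This \<open>t\<close> makes the cross term equal to twice the squared norm,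
      more than the right side allows.\<close>
    from key[of "(norm a)\<^sup>2 / Im c"] n
    have "(Im c)\<^sup>2 + (norm a)\<^sup>2 \<le> 0" by (simp add: power2_sum)
    with n show False
      by (metis add_nonneg_eq_0_iff order_antisym sum_power2_ge_zero zero_le_power2 zero_eq_power2)
  qed
qed

text \<open>Resolvent identity, from \<open>u^-1 - v^-1 = u^-1 (v - u) v^-1\<close>.\<close>

lemma cs_inv_one_minus_diff:
  fixes x :: "'a::cstar_algebra"
  assumes "cs_invertible (1 - cscale c x)" "cs_invertible (1 - cscale d x)"
  shows "cs_inv (1 - cscale c x) - cs_inv (1 - cscale d x)
    = cs_inv (1 - cscale c x) * cscale (c - d) x * cs_inv (1 - cscale d x)"
proof -
  let ?u = "1 - cscale c x" and ?v = "1 - cscale d x"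
  have "cscale (c - d) x = ?v - ?u" by (simp add: cscale_diff_left)
  moreover have "cs_inv ?u * (?v - ?u) * cs_inv ?v = cs_inv ?u * (?v * cs_inv ?v) - cs_inv ?u * ?u * cs_inv ?v"
    by (simp add: algebra_simps)
  ultimately show ?thesis using cs_inv(1)[OF assms(2)] cs_inv(2)[OF assms(1)] by simp
qed

text \<open>The resolvent identity bounds \<open>R c - R d\<close> through the unknown norm of
  \<open>R c\<close>. Once \<open>cmod (c - d) * M\<close> is at most 1/2 this can be absorbed,
  giving \<open>norm (R c) \<le> 2 * norm (R d)\<close> and a bound linear in
  \<open>cmod (c - d)\<close>.\<close>

lemma continuous_on_resolvent:
  fixes x :: "'a::cstar_algebra"
  assumes "\<And>c. c \<in> S \<Longrightarrow> cs_invertible (1 - cscale c x)"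
  shows "continuous_on S (\<lambda>c. cs_inv (1 - cscale c x))"
  unfolding continuous_on_def
proof
  fix d assume d: "d \<in> S"
  define R where "R = (\<lambda>c. cs_inv (1 - cscale c x))"
  define M where "M = norm x * norm (R d)"
  have M: "M \<ge> 0" by (simp add: M_def)
  have bound: "norm (R c - R d) \<le> 2 * norm (R d) * (cmod (c - d) * M)"
    if "c \<in> S" "cmod (c - d) * M \<le> 1/2" for c
  proof -
    have "norm (R c - R d) \<le> norm (R c) * norm (cscale (c - d) x) * norm (R d)"
      unfolding R_def cs_inv_one_minus_diff[OF assms[OF that(1)] assms[OF d]]
      by (meson mult_right_mono norm_ge_zero norm_mult_ineq order_trans)
    then have 1: "norm (R c - R d) \<le> norm (R c) * (cmod (c - d) * M)"
      by (simp add: norm_cscale M_def mult_ac)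
    also have "\<dots> \<le> norm (R c) * (1/2)" using that(2) by (intro mult_left_mono) auto
    finally have "norm (R c) \<le> 2 * norm (R d)"
      using norm_triangle_ineq2[of "R c" "R d"] by simp
    with 1 show ?thesis
      by (smt (verit) M mult_nonneg_nonneg mult_right_mono norm_ge_zero)
  qed
  have lim: "((\<lambda>c. cmod (c - d) * M) \<longlongrightarrow> 0) (at d within S)"
    by (auto intro!: tendsto_eq_intros)
  have ev: "eventually (\<lambda>c. cmod (c - d) * M < 1/2) (at d within S)"
    by (rule order_tendstoD(2)[OF lim]) simp
  have evS: "eventually (\<lambda>c. c \<in> S) (at d within S)" by (simp add: eventually_at_filter)
  have "((\<lambda>c. norm (R c - R d)) \<longlongrightarrow> 0) (at d within S)"
  proof (rule tendsto_sandwich[of "\<lambda>_. 0"])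
    show "\<forall>\<^sub>F c in at d within S. norm (R c - R d) \<le> 2 * norm (R d) * (cmod (c - d) * M)"
      using ev evS by eventually_elim (use bound in auto)
    show "((\<lambda>c. 2 * norm (R d) * (cmod (c - d) * M)) \<longlongrightarrow> 0) (at d within S)"
      using tendsto_mult_left[OF lim, of "2 * norm (R d)"] by simp
  qed auto
  then show "((\<lambda>c. cs_inv (1 - cscale c x)) \<longlongrightarrow> cs_inv (1 - cscale d x)) (at d within S)"
    unfolding R_def by (rule Lim_null[THEN iffD2, OF tendsto_norm_zero_cancel])
qed

text \<open>Partial fractions for the commuting factors \<open>1 - y\<close> and
  \<open>1 + y\<close>. Iterated, this averages a resolvent over roots of unity.\<close>

lemma cs_inv_one_minus_square:
  fixes y :: "'a::real_algebra_1"
  assumes "cs_invertible (1 - y)" "cs_invertible (1 + y)"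
  shows "cs_invertible (1 - y\<^sup>2)"
    and "cs_inv (1 - y\<^sup>2) = (1/2) *\<^sub>R (cs_inv (1 - y) + cs_inv (1 + y))"
proof -
  let ?u = "cs_inv (1 - y)" and ?v = "cs_inv (1 + y)"
  note i = cs_inv[OF assms(1)] cs_inv[OF assms(2)]
  have half: "(1/2) *\<^sub>R (2::'a) = 1" by (metis one_add_one scaleR_half_double)
  have f: "1 - y\<^sup>2 = (1 + y) * (1 - y)" "1 - y\<^sup>2 = (1 - y) * (1 + y)"
    by (simp_all add: algebra_simps power2_eq_square)
  have "(1 - y\<^sup>2) * ?u = 1 + y" using f(1) i(1) by (metis mult.assoc mult_1_right)
  moreover have "(1 - y\<^sup>2) * ?v = 1 - y" using f(2) i(3) by (metis mult.assoc mult_1_right)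
  ultimately have r: "(1 - y\<^sup>2) * ((1/2) *\<^sub>R (?u + ?v)) = 1"
    using half by (simp add: distrib_left flip: scaleR_add_right)
  have "?u * (1 - y\<^sup>2) = 1 + y" using f(2) i(2) by (metis mult.assoc mult_1_left)
  moreover have "?v * (1 - y\<^sup>2) = 1 - y" using f(1) i(4) by (metis mult.assoc mult_1_left)
  ultimately have l: "((1/2) *\<^sub>R (?u + ?v)) * (1 - y\<^sup>2) = 1"
    using half by (simp add: distrib_right flip: scaleR_add_right)
  show "cs_invertible (1 - y\<^sup>2)" by (rule cs_invertibleI[OF r l])
  show "cs_inv (1 - y\<^sup>2) = (1/2) *\<^sub>R (?u + ?v)" by (rule cs_inv_eqI[OF r l])
qed

text \<open>The inverse of \<open>1 - (c x)^(2^m)\<close> is the mean of the inverses of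
  \<open>1 - w c x\<close> over the \<open>2^m\<close>-th roots of unity \<open>w\<close>. A bound
  comparing the resolvent on the circles of radius \<open>r\<close> and 1 therefore survives with
  the same \<open>\<epsilon>\<close> for every \<open>m\<close>.\<close>

lemma resolvent_root_of_unity_average:
  fixes x :: "'a::cstar_algebra"
  assumes inv: "\<And>c. cmod c \<le> 1 \<Longrightarrow> cs_invertible (1 - cscale c x)"
    and r: "0 \<le> r" "r \<le> 1"
    and close: "\<And>u. cmod u = 1 \<Longrightarrow>
      norm (cs_inv (1 - cscale u x) - cs_inv (1 - cscale (of_real r * u) x)) \<le> \<epsilon>"
  shows "(\<forall>c. cmod c \<le> 1 \<longrightarrow> cs_invertible (1 - (cscale c x) ^ (2 ^ m))) \<and>
    (\<forall>u. cmod u = 1 \<longrightarrow> norm (cs_inv (1 - (cscale u x) ^ (2 ^ m))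
       - cs_inv (1 - (cscale (of_real r * u) x) ^ (2 ^ m))) \<le> \<epsilon>)"
proof (induction m)
  case 0
  then show ?case using inv close by simp
next
  case (Suc m)
  define N :: nat where "N = 2 ^ m"
  have N: "N > 0" "2 ^ Suc m = N * 2" by (simp_all add: N_def)
  \<comment> \<open>Multiplying \<open>c\<close> by this \<open>N\<close>-th root of -1 turns
    \<open>1 + (c x)^N\<close> into \<open>1 - (z c x)^N\<close>, so both partial fractions fall
    under the induction hypothesis.\<close>
  define z where "z = cis (pi / N)"
  have "z ^ N = cis (real N * (pi / N))" unfolding z_def by (rule Complex.DeMoivre)
  also have "real N * (pi / N) = pi" using N(1) by simp
  finally have z: "cmod z = 1" "z ^ N = -1" by (auto simp: z_def)
  define T where "T = (\<lambda>c. cs_inv (1 - (cscale c x) ^ N))"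
  have IH1: "cs_invertible (1 - (cscale c x) ^ N)" if "cmod c \<le> 1" for c
    using Suc that by (simp add: N_def)
  have IH2: "norm (T u - T (of_real r * u)) \<le> \<epsilon>" if "cmod u = 1" for u
    using Suc that by (simp add: N_def T_def)
  have plus: "1 + (cscale c x) ^ N = 1 - (cscale (z * c) x) ^ N" for c
    using z(2) by (simp add: cscale_power power_mult_distrib cscale_minus_left)
  have le: "cmod (z * c) \<le> 1" if "cmod c \<le> 1" for c
    using that z by (simp add: norm_mult)
  have inv2: "cs_invertible (1 - (cscale c x) ^ (N * 2))"
    and T2: "cs_inv (1 - (cscale c x) ^ (N * 2)) = (1/2) *\<^sub>R (T c + T (z * c))"
    if "cmod c \<le> 1" for c
    using cs_inv_one_minus_square[of "(cscale c x) ^ N"] IH1[OF that] IH1[OF le[OF that]]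
    unfolding plus T_def power_mult by auto
  have "norm (cs_inv (1 - (cscale u x) ^ (N * 2))
       - cs_inv (1 - (cscale (of_real r * u) x) ^ (N * 2))) \<le> \<epsilon>" if u: "cmod u = 1" for u
  proof -
    have "cmod (of_real r * u) \<le> 1" using u r by (simp add: norm_mult)
    then have "cs_inv (1 - (cscale u x) ^ (N * 2)) - cs_inv (1 - (cscale (of_real r * u) x) ^ (N * 2))
      = (1/2) *\<^sub>R ((T u - T (of_real r * u)) + (T (z * u) - T (of_real r * (z * u))))"
      using u by (simp add: T2 algebra_simps)
    also have "norm \<dots> \<le> (1/2) * (\<epsilon> + \<epsilon>)"
    proof -
      have "cmod (z * u) = 1" using u z by (simp add: norm_mult)
      then have "norm ((T u - T (of_real r * u)) + (T (z * u) - T (of_real r * (z * u)))) \<le> \<epsilon> + \<epsilon>"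
        using IH2[OF u] IH2[of "z * u"] by (meson add_mono norm_triangle_mono)
      then show ?thesis by simp
    qed
    finally show ?thesis by simp
  qed
  then show ?case using inv2 unfolding N(2) by blast
qed

text \<open>Rickart's elementary argument: were the whole resolvent defined on the closed unit disc, its
  uniform continuity and averaging over \<open>2^m\<close>-th roots of unity would force
  \<open>(1 - x^(2^m))\<inverse>\<close> close to \<open>1\<close>.\<close>

lemma ex_not_invertible_in_unit_disc:
  fixes x :: "'a::cstar_algebra"
  assumes pow: "\<And>m. norm (x ^ (2 ^ m)) = 1"
  shows "\<exists>c. cmod c \<le> 1 \<and> \<not> cs_invertible (1 - cscale c x)"
proof (rule ccontr)
  assume "\<not> ?thesis"
  then have inv: "\<And>c. cmod c \<le> 1 \<Longrightarrow> cs_invertible (1 - cscale c x)" by blast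
  have "continuous_on (cball 0 1) (\<lambda>c. cs_inv (1 - cscale c x))"
    using inv by (intro continuous_on_resolvent) simp
  then have "uniformly_continuous_on (cball 0 1) (\<lambda>c. cs_inv (1 - cscale c x))"
    by (rule compact_uniformly_continuous) simp
  then have "(1/6::real) > 0 \<longrightarrow> (\<exists>d>0. \<forall>c\<in>cball 0 1. \<forall>e\<in>cball 0 1. dist e c < d \<longrightarrow>
      dist (cs_inv (1 - cscale e x)) (cs_inv (1 - cscale c x)) < 1/6)"
    unfolding uniformly_continuous_on_def by (rule spec)
  then obtain d where d: "d > 0" and uc0: "\<forall>c\<in>cball 0 1. \<forall>e\<in>cball 0 1. dist e c < d \<longrightarrow>
      dist (cs_inv (1 - cscale e x)) (cs_inv (1 - cscale c x)) < 1/6"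
    by auto
  have uc: "norm (cs_inv (1 - cscale e x) - cs_inv (1 - cscale c x)) < 1/6"
    if "cmod c \<le> 1" "cmod e \<le> 1" "cmod (e - c) < d" for c e
    using uc0[rule_format, of c e] that by (simp add: dist_norm)
  define r where "r = max 0 (1 - d/2)"
  have r: "0 \<le> r" "r < 1" "1 - r < d" using d by (auto simp: r_def)
  have close: "norm (cs_inv (1 - cscale u x) - cs_inv (1 - cscale (of_real r * u) x)) \<le> 1/6"
    if u: "cmod u = 1" for u
  proof -
    have "u - of_real r * u = of_real (1 - r) * u" by (simp add: algebra_simps)
    then have "cmod (u - of_real r * u) < d" using u r by (simp add: norm_mult del: of_real_diff)
    then show ?thesis using uc[of "of_real r * u" u] u r by (simp add: norm_mult)
  qed
  note avg = resolvent_root_of_unity_average[OF inv r(1) less_imp_le[OF r(2)] close]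
  have "(\<lambda>m. r ^ m) \<longlonglongrightarrow> 0" using r by (simp add: LIMSEQ_power_zero)
  then have "\<forall>\<^sub>F m in sequentially. r ^ m < 1/7" by (rule order_tendstoD) simp
  then obtain m where m: "r ^ m < 1/7" by (auto simp: eventually_sequentially)
  define N :: nat where "N = 2 ^ m"
  have rN: "r ^ N < 1/7"
    using m r power_decreasing[of m N r] by (auto simp: N_def self_le_ge2_pow less_imp_le)
  define y where "y = (cscale (of_real r) x) ^ N"
  define S where "S = cs_inv (1 - y)"
  define T where "T = cs_inv (1 - x ^ N)"
  have invS: "cs_invertible (1 - y)" and invT: "cs_invertible (1 - x ^ N)"
    and TS: "norm (T - S) \<le> 1/6"
    using avg[THEN conjunct1, rule_format, of "of_real r" m] avg[THEN conjunct1, rule_format, of 1 m]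
      avg[THEN conjunct2, rule_format, of 1 m] r
    by (auto simp: y_def N_def S_def T_def)
  have y: "norm y < 1/7"
    using rN r pow[of m] by (simp add: y_def cscale_power norm_cscale N_def norm_power)
  have "S - 1 = y * S" using cs_inv(1)[OF invS] by (simp add: S_def algebra_simps)
  then have "norm (S - 1) \<le> norm y * (1 + norm (S - 1))"
    by (smt (verit, best) mult_left_mono norm_ge_zero norm_mult_ineq norm_one norm_triangle_sub)
  also have "\<dots> \<le> (1/7) * (1 + norm (S - 1))" using y by (intro mult_right_mono) auto
  finally have "norm (S - 1) \<le> 1/6" by simp
  with TS have T1: "norm (T - 1) \<le> 1/3" using norm_triangle_ineq[of "T - S" "S - 1"] by simp
  \<comment> \<open>Since \<open>(1 - x ^ N) * T = 1\<close>, closeness of \<open>T\<close> to 1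
    makes \<open>x ^ N\<close> small relative to \<open>1 - x ^ N\<close>, whose norm is at most
    2.\<close>
  have "1 - x ^ N = 1 + (1 - x ^ N) * (1 - T)"
    using cs_inv(1)[OF invT] by (simp add: T_def algebra_simps)
  then have "x ^ N = - ((1 - x ^ N) * (1 - T))" by (simp add: algebra_simps)
  then have "norm (x ^ N) \<le> norm (1 - x ^ N) * norm (1 - T)"
    by (metis norm_minus_cancel norm_mult_ineq)
  also have "\<dots> \<le> 2 * (1/3)"
    using T1 pow[of m] norm_triangle_ineq4[of 1 "x ^ N"]
    by (intro mult_mono) (auto simp: norm_minus_commute N_def)
  finally show False using pow[of m] by (simp add: N_def)
qed

text \<open>The C*-identity squares the norm at each doubling of the exponent. For norm 1 this is
  the hypothesis of \<open>ex_not_invertible_in_unit_disc\<close>.\<close>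

lemma selfadjoint_norm_power_two:
  fixes a :: "'a::cstar_algebra"
  assumes "selfadjoint a" shows "norm (a ^ (2 ^ m)) = norm a ^ (2 ^ m)"
proof (induction m)
  case (Suc m)
  have "norm (a ^ 2 ^ Suc m) = norm (cstar (a ^ 2 ^ m) * a ^ 2 ^ m)"
    using selfadjointD[OF selfadjoint_power[OF assms]]
    by (simp add: mult_2 power_add)
  also have "\<dots> = norm a ^ 2 ^ Suc m"
    unfolding cstar_identity Suc by (simp add: power_mult[symmetric] mult.commute)
  finally show ?case .
qed simp

lemma rspectrum_abs_le:
  "t \<in> rspectrum (a::'a::cstar_algebra) \<Longrightarrow> \<bar>t\<bar> \<le> norm a"
  using cspectrum_norm_le[of "of_real t" a] by (simp add: rspectrum_def)

lemma rspectrum_iff: "t \<in> rspectrum (a::'a::cstar_algebra) \<longleftrightarrow> \<not> cs_invertible (a - t *\<^sub>R 1)"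
  by (simp add: rspectrum_def cspectrum_def cscale_of_real)

text \<open>Spectral radius equals norm. After normalizing, a singular \<open>1 - c x\<close> with
  \<open>cmod c \<le> 1\<close> puts \<open>norm a / c\<close> into the spectrum; this number has
  modulus at least \<open>norm a\<close> and is real because \<open>a\<close> is
  self-adjoint.\<close>

lemma selfadjoint_norm_in_spectrum:
  fixes a :: "'a::cstar_algebra"
  assumes sa: "selfadjoint a"
  shows "\<exists>t\<in>rspectrum a. \<bar>t\<bar> = norm a"
proof (cases "a = 0")
  case True
  have "\<not> cs_invertible (0::'a)" by (auto simp: cs_invertible_def)
  then show ?thesis using True by (auto simp: rspectrum_iff intro!: bexI[of _ 0])
next
  case False
  define x where "x = (1 / norm a) *\<^sub>R a"
  have sax: "selfadjoint x" using sa by (simp add: x_def selfadjoint_scaleR)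
  have nx: "norm x = 1" using False by (simp add: x_def)
  obtain c where c: "cmod c \<le> 1" "\<not> cs_invertible (1 - cscale c x)"
    using ex_not_invertible_in_unit_disc[of x] selfadjoint_norm_power_two[OF sax] nx by auto
  have c0: "c \<noteq> 0" using c(2) cs_invertibleI[of 1 1] by auto
  define d where "d = of_real (norm a) / c"
  have d0: "d \<noteq> 0" using c0 False by (simp add: d_def)
  have "a - cscale d 1 = cscale (- d) (1 - cscale c x)"
  proof -
    have "cscale (- d) (cscale c x) = cscale (- d * c) (cscale (of_real (1 / norm a)) a)"
      by (simp only: cscale_cscale x_def cscale_of_real)
    also have "\<dots> = - a" using c0 False
      by (simp add: cscale_cscale cscale_minus_left d_def)
    finally show ?thesis by (simp add: cscale_diff_right cscale_minus_left)
  qed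
  with c(2) d0 have dspec: "d \<in> cspectrum a" by (simp add: cspectrum_def cs_invertible_cscale)
  then have "d = of_real (Re d)"
    using selfadjoint_cspectrum_real[OF sa] by (simp add: complex_eq_iff)
  then have "Re d \<in> rspectrum a" "cmod d = \<bar>Re d\<bar>"
    using dspec by (metis rspectrum_def mem_Collect_eq, metis norm_of_real)
  moreover have "cmod d \<ge> norm a"
    using c c0 by (simp add: d_def norm_divide divide_simps mult_left_le)
  ultimately show ?thesis using rspectrum_abs_le by force
qed

section \<open>Continuous functional calculus\<close>

lemma poly_eval_altdef:
  assumes "degree p \<le> n"
  shows "poly_eval p a = (\<Sum>i\<le>n. coeff p i *\<^sub>R a ^ i)"
  unfolding poly_eval_def using assms
  by (intro sum.mono_neutral_left) (auto simp: coeff_eq_0)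

lemma poly_eval_zero [simp]: "poly_eval 0 a = 0"
  by (simp add: poly_eval_def)

lemma poly_eval_pCons:
  "poly_eval (pCons c p) a = c *\<^sub>R 1 + a * poly_eval p (a::'a::real_algebra_1)"
proof -
  have "poly_eval (pCons c p) a = (\<Sum>i\<le>Suc (degree p). coeff (pCons c p) i *\<^sub>R a ^ i)"
    by (rule poly_eval_altdef) (simp add: degree_pCons_le)
  also have "\<dots> = c *\<^sub>R 1 + (\<Sum>i\<le>degree p. coeff p i *\<^sub>R a ^ Suc i)"
    by (simp add: sum.atMost_Suc_shift del: sum.atMost_Suc)
  also have "(\<Sum>i\<le>degree p. coeff p i *\<^sub>R a ^ Suc i) = a * poly_eval p a"
    by (simp add: poly_eval_def sum_distrib_left)
  finally show ?thesis .
qed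

lemma poly_eval_add: "poly_eval (p + q) a = poly_eval p a + poly_eval q (a::'a::real_algebra_1)"
  by (induction p q rule: poly_induct2) (simp_all add: poly_eval_pCons algebra_simps)

lemma poly_eval_smult: "poly_eval (Polynomial.smult c p) a = c *\<^sub>R poly_eval p (a::'a::real_algebra_1)"
  by (induction p) (simp_all add: poly_eval_pCons algebra_simps)

lemma poly_eval_diff: "poly_eval (p - q) a = poly_eval p a - poly_eval q (a::'a::real_algebra_1)"
  using poly_eval_add[of p "Polynomial.smult (-1) q" a] poly_eval_smult[of "-1" q a] by simp
lemma poly_eval_mult: "poly_eval (p * q) a = poly_eval p a * poly_eval q (a::'a::real_algebra_1)"
  by (induction p) (simp_all add: poly_eval_pCons poly_eval_add poly_eval_smult algebra_simps)

lemma poly_eval_const [simp]: "poly_eval [:c:] a = c *\<^sub>R (1::'a::real_algebra_1)"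
  by (simp add: poly_eval_pCons)

lemma poly_eval_commute: "poly_eval p a * a = a * poly_eval p (a::'a::real_algebra_1)"
  by (induction p) (simp_all add: poly_eval_pCons distrib_left distrib_right mult.assoc)

lemma poly_eval_selfadjoint: "selfadjoint a \<Longrightarrow> selfadjoint (poly_eval p a)"
proof (induction p)
  case (pCons c p)
  then show ?case
    by (simp add: poly_eval_pCons selfadjoint_def cstar_add cstar_scaleR cstar_mult poly_eval_commute)
qed (simp add: selfadjoint_zero)

section \<open>Spectral mapping for real polynomials\<close>

lemma selfadjoint_quadratic_invertible:
  fixes a :: "'a::cstar_algebra"
  assumes "selfadjoint a" "Im z \<noteq> 0"
  shows "cs_invertible (poly_eval [:(cmod z)\<^sup>2, - 2 * Re z, 1:] a)"
proof -
  have "cs_invertible (a - cscale w 1)" if "Im w \<noteq> 0" for w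
    using selfadjoint_cspectrum_real[OF assms(1), of w] that by (auto simp: cspectrum_def)
  then have "cs_invertible ((a - cscale z 1) * (a - cscale (cnj z) 1))"
    using assms(2) by (intro cs_invertible_mult) auto
  also have "(a - cscale z 1) * (a - cscale (cnj z) 1)
    = a * a - (cscale z a + cscale (cnj z) a) + cscale (z * cnj z) 1"
    by (simp add: left_diff_distrib right_diff_distrib cscale_one_mult mult_cscale_one
        cscale_diff_right cscale_cscale mult.commute[of z "cnj z"])
  also have "cscale z a + cscale (cnj z) a = (2 * Re z) *\<^sub>R a"
    by (metis complex_add_cnj cscale_add_left cscale_of_real)
  also have "cscale (z * cnj z) 1 = (cmod z)\<^sup>2 *\<^sub>R (1::'a)"
    by (metis complex_norm_square cscale_of_real)
  finally show ?thesis by (simp add: poly_eval_pCons algebra_simps)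
qed

lemma poly_map_of_real_mult:
  "poly (map_poly complex_of_real (p * q)) z
    = poly (map_poly complex_of_real p) z * poly (map_poly complex_of_real q) z"
  by (induction p)
     (simp_all add: Polynomial.map_poly_pCons of_real_hom.map_poly_hom_add of_real_hom.map_poly_hom_smult algebra_simps)

text \<open>The remainder modulo this quadratic is linear with real coefficients and vanishes at the
  nonreal \<open>z\<close>, which forces it to be zero.\<close>

lemma real_poly_dvd_quadratic:
  fixes q :: "real poly"
  assumes root: "poly (map_poly complex_of_real q) z = 0" and im: "Im z \<noteq> 0"
  shows "[:(cmod z)\<^sup>2, - 2 * Re z, 1:] dvd q"
proof -
  let ?d = "[:(cmod z)\<^sup>2, - 2 * Re z, 1:]"
  have "poly (map_poly complex_of_real ?d) z = of_real ((cmod z)\<^sup>2) - z * of_real (2 * Re z) + z * z"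
    by (simp add: map_poly_pCons algebra_simps)
  also have "\<dots> = z * cnj z - z * (z + cnj z) + z * z"
    by (simp only: complex_norm_square complex_add_cnj)
  finally have dz: "poly (map_poly complex_of_real ?d) z = 0" by (simp add: algebra_simps)
  have deg: "degree (q mod ?d) < 2"
    using degree_mod_less[of ?d q] by auto
  have "q mod ?d = [:coeff (q mod ?d) 0, coeff (q mod ?d) 1:]"
    by (rule poly_eqI) (use deg in \<open>auto simp: coeff_pCons intro!: coeff_eq_0 split: nat.split\<close>)
  then obtain \<alpha> \<beta> where m: "q mod ?d = [:\<beta>, \<alpha>:]" by blast
  have "map_poly complex_of_real q = map_poly complex_of_real (?d * (q div ?d) + q mod ?d)"
    by (simp only: mult_div_mod_eq)
  then have "poly (map_poly complex_of_real q) z = poly (map_poly complex_of_real ?d) z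
      * poly (map_poly complex_of_real (q div ?d)) z + poly (map_poly complex_of_real (q mod ?d)) z"
    by (simp only: of_real_hom.map_poly_hom_add poly_add poly_map_of_real_mult)
  then have "poly (map_poly complex_of_real (q mod ?d)) z = 0"
    unfolding root dz by simp
  then have "of_real \<beta> + z * of_real \<alpha> = 0" by (simp only: m Polynomial.map_poly_pCons of_real_0) simp
  then have "\<alpha> = 0" "\<beta> = 0" using im by (auto simp: complex_eq_iff)
  then have "q mod ?d = 0" unfolding m by simp
  then show ?thesis by (rule dvd_eq_mod_eq_0[THEN iffD2])
qed

text \<open>\<open>poly_eval\<close> takes real coefficients, so a complex root is split off either
  as a real linear factor or, paired with its conjugate, as a quadratic. The quadratic evaluates to
  \<open>(a - z) (a - cnj z)\<close>, invertible because the spectrum is real.\<close>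

lemma poly_eval_invertible:
  fixes a :: "'a::cstar_algebra"
  assumes sa: "selfadjoint a"
  shows "q \<noteq> 0 \<Longrightarrow> \<forall>t\<in>rspectrum a. poly q t \<noteq> 0 \<Longrightarrow> cs_invertible (poly_eval q a)"
proof (induction "degree q" arbitrary: q rule: less_induct)
  case less
  let ?Q = "map_poly complex_of_real q"
  show ?case
  proof (cases "degree q = 0")
    case True
    then obtain c where c: "q = [:c:]" by (elim degree_eq_zeroE)
    with less have "c \<noteq> 0" by auto
    then show ?thesis by (auto simp: c intro!: cs_invertibleI[of _ "(1/c) *\<^sub>R 1"])
  next
    case False
    then have "degree ?Q \<noteq> 0" by simp
    then obtain z where z: "poly ?Q z = 0"
      using fundamental_theorem_of_algebra[of ?Q] constant_degree[of ?Q] by auto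
    obtain d where d: "d dvd q" "degree d > 0" "cs_invertible (poly_eval d a)"
    proof (cases "Im z = 0")
      case True
      then have "z = of_real (Re z)" by (simp add: complex_eq_iff)
      then have "complex_of_real (poly q (Re z)) = 0" using z
        by (metis of_real_hom.poly_map_poly)
      then have r: "poly q (Re z) = 0" by simp
      then have "Re z \<notin> rspectrum a" using less by auto
      then have "cs_invertible (poly_eval [:- Re z, 1:] a)"
        by (simp add: rspectrum_iff poly_eval_pCons)
      with that[of "[:- Re z, 1:]"] r show ?thesis by (simp add: poly_eq_0_iff_dvd)
    next
      case False
      show ?thesis
        by (rule that[OF real_poly_dvd_quadratic[OF z False] _
              selfadjoint_quadratic_invertible[OF sa False]]) simp
    qed
    from d(1) obtain e where e: "q = d * e" by auto
    have e0: "e \<noteq> 0" "d \<noteq> 0" using e less by auto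
    then have "degree e < degree q" using d e by (simp add: degree_mult_eq)
    moreover have "\<forall>t\<in>rspectrum a. poly e t \<noteq> 0" using less e by auto
    ultimately have "cs_invertible (poly_eval e a)" using less e0 by blast
    then show ?thesis using d e by (simp add: poly_eval_mult cs_invertible_mult)
  qed
qed

text \<open>A spectral value \<open>t\<close> of \<open>p(a)\<close> with modulus equal to the norm
  must have the form \<open>poly p s\<close>: otherwise \<open>p - t\<close> has no zero on the
  spectrum and \<open>p(a) - t\<close> is invertible. The functional calculus rests on this
  isometry.\<close>

lemma poly_eval_norm:
  fixes a :: "'a::cstar_algebra"
  assumes sa: "selfadjoint a"
  shows "\<exists>s\<in>rspectrum a. norm (poly_eval p a) = \<bar>poly p s\<bar>"
proof -
  obtain t where t: "t \<in> rspectrum (poly_eval p a)" "\<bar>t\<bar> = norm (poly_eval p a)"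
    using selfadjoint_norm_in_spectrum[OF poly_eval_selfadjoint[OF sa]] by blast
  obtain u where u: "u \<in> rspectrum a"
    using selfadjoint_norm_in_spectrum[OF sa] by blast
  have ni: "\<not> cs_invertible (poly_eval (p - [:t:]) a)"
    using t by (simp add: rspectrum_iff poly_eval_diff)
  have "\<exists>s\<in>rspectrum a. poly (p - [:t:]) s = 0"
  \<comment> \<open>\<open>poly_eval_invertible\<close> excludes the zero polynomial. If
    \<open>p\<close> is the constant \<open>t\<close>, any spectral value works, and
    \<open>u\<close> is one.\<close>
  proof (cases "p - [:t:] = 0")
    case True
    then show ?thesis using u by (metis poly_0)
  next
    case False
    then show ?thesis using poly_eval_invertible[OF sa False] ni by blast
  qed
  then obtain s where "s \<in> rspectrum a" "poly p s = t" by auto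
  then show ?thesis using t(2) by metis
qed

lemma cs_invertible_perturb:
  fixes u w :: "'a::{real_normed_algebra_1,banach}"
  assumes u: "cs_invertible u" and small: "norm (u - w) * norm (cs_inv u) < 1"
  shows "cs_invertible w"
proof -
  have "norm (cs_inv u * (u - w)) < 1"
    using small norm_mult_ineq[of "cs_inv u" "u - w"] by (simp add: mult.commute)
  then have "cs_invertible (u * (1 - cs_inv u * (u - w)))"
    by (intro cs_invertible_mult u cs_invertible_one_minus)
  also have "u * (1 - cs_inv u * (u - w)) = u - (u * cs_inv u) * (u - w)"
    by (simp add: right_diff_distrib mult.assoc)
  finally show ?thesis using cs_inv(1)[OF u] by simp
qed

lemma compact_rspectrum: "compact (rspectrum (a::'a::cstar_algebra))"
proof -
  have "open (- rspectrum a)"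
  proof (rule openI)
    fix t assume "t \<in> - rspectrum a"
    then have inv: "cs_invertible (a - t *\<^sub>R 1)" by (simp add: rspectrum_iff)
    define M where "M = norm (cs_inv (a - t *\<^sub>R 1)) + 1"
    have M: "M > 0" by (simp add: M_def add_nonneg_pos)
    have "ball t (1 / M) \<subseteq> - rspectrum a"
    proof
      fix s assume "s \<in> ball t (1 / M)"
      then have s: "\<bar>s - t\<bar> * M < 1" using M by (simp add: dist_real_def field_simps abs_minus_commute)
      have "norm ((a - t *\<^sub>R 1) - (a - s *\<^sub>R 1)) = \<bar>s - t\<bar>"
        by (simp flip: scaleR_left_diff_distrib)
      then have "norm ((a - t *\<^sub>R 1) - (a - s *\<^sub>R 1)) * norm (cs_inv (a - t *\<^sub>R 1)) < 1"
        using s by (simp add: M_def distrib_left)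
      then have "cs_invertible (a - s *\<^sub>R 1)" by (rule cs_invertible_perturb[OF inv])
      then show "s \<in> - rspectrum a" by (simp add: rspectrum_iff)
    qed
    then show "\<exists>T>0. ball t T \<subseteq> - rspectrum a" using M by (intro exI[of _ "1/M"]) auto
  qed
  moreover have "bounded (rspectrum a)"
    using rspectrum_abs_le by (auto simp: bounded_iff)
  ultimately show ?thesis by (simp add: compact_eq_bounded_closed closed_def)
qed

section \<open>Well-definedness and rules of the continuous functional calculus\<close>

lemma Weierstrass_poly:
  fixes f :: "real \<Rightarrow> real"
  assumes "compact K" "continuous_on K f"
  shows "\<exists>p :: nat \<Rightarrow> real poly. uniform_limit K (\<lambda>n t. poly (p n) t) f sequentially"
proof -
  have "\<exists>p. \<forall>t\<in>K. \<bar>f t - poly p t\<bar> < e" if e: "e > 0" for e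
  proof -
    obtain g where g: "real_polynomial_function g" "\<And>x. x \<in> K \<Longrightarrow> \<bar>f x - g x\<bar> < e"
      using Stone_Weierstrass_real_polynomial_function[OF assms e] by blast
    from g(1) obtain b n where b: "g = (\<lambda>x. \<Sum>i\<le>n. b i * x^i)"
      by (auto simp: real_polynomial_function_iff_sum)
    have "poly (\<Sum>i\<le>n. monom (b i) i) x = g x" for x
      by (simp add: b poly_sum poly_monom)
    then show ?thesis using g(2) by metis
  qed
  then have "\<forall>n. \<exists>p. \<forall>t\<in>K. \<bar>f t - poly p t\<bar> < inverse (real (Suc n))" by simp
  then obtain p where p: "\<And>n t. t \<in> K \<Longrightarrow> \<bar>f t - poly (p n) t\<bar> < inverse (real (Suc n))"
    by metis
  have "uniform_limit K (\<lambda>n t. poly (p n) t) f sequentially"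
  proof (rule uniform_limitI)
    fix e :: real assume "e > 0"
    then have "\<forall>\<^sub>F n in sequentially. inverse (real (Suc n)) < e"
      using LIMSEQ_inverse_real_of_nat order_tendstoD(2) by blast
    then show "\<forall>\<^sub>F n in sequentially. \<forall>x\<in>K. dist (poly (p n) x) (f x) < e"
    proof eventually_elim
      case (elim n)
      then show ?case using p[of _ n] by (force simp: dist_real_def abs_minus_commute)
    qed
  qed
  then show ?thesis by blast
qed

text \<open>Makes the limit in the definition of \<open>cfc\<close> independent of the approximating
  sequence: \<open>poly_eval_norm\<close> converts uniform closeness on the spectrum into closeness
  in norm.\<close>

lemma poly_eval_diff_tendsto_0:
  fixes a :: "'a::cstar_algebra"
  assumes sa: "selfadjoint a"
    and p: "uniform_limit (rspectrum a) (\<lambda>n t. poly (p n) t) f sequentially"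
    and q: "uniform_limit (rspectrum a) (\<lambda>n t. poly (q n) t) f sequentially"
  shows "(\<lambda>n. poly_eval (p n) a - poly_eval (q n) a) \<longlonglongrightarrow> 0"
proof (rule tendstoI)
  fix e :: real assume e: "e > 0"
  have "uniform_limit (rspectrum a) (\<lambda>n t. poly (p n) t - poly (q n) t) (\<lambda>t. f t - f t) sequentially"
    by (rule uniform_limit_minus[OF p q])
  from uniform_limitD[OF this e]
  show "\<forall>\<^sub>F n in sequentially. dist (poly_eval (p n) a - poly_eval (q n) a) 0 < e"
  proof eventually_elim
    case (elim n)
    obtain s where "s \<in> rspectrum a" "norm (poly_eval (p n - q n) a) = \<bar>poly (p n - q n) s\<bar>"
      using poly_eval_norm[OF sa] by blast
    then show ?case using elim by (auto simp: poly_eval_diff dist_real_def)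
  qed
qed

lemma Cauchy_poly_eval:
  fixes a :: "'a::cstar_algebra"
  assumes sa: "selfadjoint a"
    and p: "uniform_limit (rspectrum a) (\<lambda>n t. poly (p n) t) f sequentially"
  shows "Cauchy (\<lambda>n. poly_eval (p n) a)"
proof (rule CauchyI)
  fix e :: real assume e: "e > 0"
  then obtain N where N: "\<And>n t. n \<ge> N \<Longrightarrow> t \<in> rspectrum a \<Longrightarrow> dist (poly (p n) t) (f t) < e / 2"
    using p unfolding uniform_limit_sequentially_iff by (meson half_gt_zero)
  show "\<exists>M. \<forall>m\<ge>M. \<forall>n\<ge>M. norm (poly_eval (p m) a - poly_eval (p n) a) < e"
  proof (intro exI[of _ N] allI impI)
    fix m n assume mn: "m \<ge> N" "n \<ge> N"
    obtain s where s: "s \<in> rspectrum a" "norm (poly_eval (p m - p n) a) = \<bar>poly (p m - p n) s\<bar>"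
      using poly_eval_norm[OF sa] by blast
    have "\<bar>poly (p m - p n) s\<bar> < e"
      using N[OF mn(1) s(1)] N[OF mn(2) s(1)] unfolding dist_real_def poly_diff by linarith
    then show "norm (poly_eval (p m) a - poly_eval (p n) a) < e"
      using s by (simp add: poly_eval_diff)
  qed
qed

text \<open>Completeness gives the limit, and the presence of one approximating sequence
  \<open>p\<close> makes it unique; together they resolve the definite description in
  \<open>cfc\<close>.\<close>

lemma cfc_limit:
  fixes a :: "'a::cstar_algebra"
  assumes sa: "selfadjoint a" and cont: "continuous_on (rspectrum a) f"
    and p: "uniform_limit (rspectrum a) (\<lambda>n t. poly (p n) t) f sequentially"
  shows "(\<lambda>n. poly_eval (p n) a) \<longlonglongrightarrow> cfc f a"
proof -
  obtain L where L: "(\<lambda>n. poly_eval (p n) a) \<longlonglongrightarrow> L"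
    using Cauchy_poly_eval[OF sa p] Cauchy_convergent_iff convergent_def by blast
  have "cfc f a = L"
    unfolding cfc_def
  proof (rule the_equality)
    show "\<forall>q. uniform_limit (rspectrum a) (\<lambda>n t. poly (q n) t) f sequentially
        \<longrightarrow> (\<lambda>n. poly_eval (q n) a) \<longlonglongrightarrow> L"
    proof (intro allI impI)
      fix q assume "uniform_limit (rspectrum a) (\<lambda>n t. poly (q n) t) f sequentially"
      from tendsto_add[OF poly_eval_diff_tendsto_0[OF sa this p] L]
      show "(\<lambda>n. poly_eval (q n) a) \<longlonglongrightarrow> L" by simp
    qed
    show "b = L" if "\<forall>q. uniform_limit (rspectrum a) (\<lambda>n t. poly (q n) t) f sequentially
        \<longrightarrow> (\<lambda>n. poly_eval (q n) a) \<longlonglongrightarrow> b" for b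
      using that p L LIMSEQ_unique by blast
  qed
  with L show ?thesis by simp
qed

lemma cfc_approx:
  fixes a :: "'a::cstar_algebra"
  assumes "selfadjoint a" "continuous_on (rspectrum a) f"
  obtains p where "uniform_limit (rspectrum a) (\<lambda>n t. poly (p n) t) f sequentially"
    "(\<lambda>n. poly_eval (p n) a) \<longlonglongrightarrow> cfc f a"
  using Weierstrass_poly[OF compact_rspectrum assms(2)] cfc_limit[OF assms] by blast

lemma cfc_cong:
  assumes "\<And>t. t \<in> rspectrum a \<Longrightarrow> f t = g t"
  shows "cfc f a = cfc g a"
proof -
  have "uniform_limit (rspectrum a) h f sequentially = uniform_limit (rspectrum a) h g sequentially"
    for h by (rule uniform_limit_cong') (use assms in auto)
  then show ?thesis unfolding cfc_def by simp
qed

lemma cfc_selfadjoint: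
  assumes "selfadjoint a" "continuous_on (rspectrum a) f"
  shows "selfadjoint (cfc f a)"
  using cfc_approx[OF assms] tendsto_selfadjoint poly_eval_selfadjoint[OF assms(1)] by metis

lemma cfc_poly: "selfadjoint a \<Longrightarrow> cfc (poly p) a = poly_eval p a"
proof -
  assume sa: "selfadjoint a"
  have "(\<lambda>n. poly_eval p a) \<longlonglongrightarrow> cfc (poly p) a"
    by (rule cfc_limit[OF sa]) (auto intro!: continuous_intros uniform_limit_const)
  then show ?thesis by (simp add: LIMSEQ_const_iff)
qed

lemma cfc_const: "selfadjoint a \<Longrightarrow> cfc (\<lambda>_. c) a = c *\<^sub>R 1"
  using cfc_poly[of a "[:c:]"] cfc_cong[of a "poly [:c:]" "\<lambda>_. c"] by simp

lemma cfc_id: "selfadjoint a \<Longrightarrow> cfc (\<lambda>t. t) a = a"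
  using cfc_poly[of a "[:0, 1:]"] cfc_cong[of a "poly [:0, 1:]" "\<lambda>t. t"] by (simp add: poly_eval_pCons)

lemma cfc_add:
  assumes sa: "selfadjoint a" and f: "continuous_on (rspectrum a) f"
    and g: "continuous_on (rspectrum a) g"
  shows "cfc (\<lambda>t. f t + g t) a = cfc f a + cfc g a"
proof -
  obtain p where p: "uniform_limit (rspectrum a) (\<lambda>n t. poly (p n) t) f sequentially"
    "(\<lambda>n. poly_eval (p n) a) \<longlonglongrightarrow> cfc f a" using cfc_approx[OF sa f] .
  obtain q where q: "uniform_limit (rspectrum a) (\<lambda>n t. poly (q n) t) g sequentially"
    "(\<lambda>n. poly_eval (q n) a) \<longlonglongrightarrow> cfc g a" using cfc_approx[OF sa g] .
  have "(\<lambda>n. poly_eval (p n + q n) a) \<longlonglongrightarrow> cfc (\<lambda>t. f t + g t) a"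
    using uniform_limit_add[OF p(1) q(1)]
    by (intro cfc_limit[OF sa] continuous_on_add f g) simp
  moreover have "(\<lambda>n. poly_eval (p n + q n) a) \<longlonglongrightarrow> cfc f a + cfc g a"
    unfolding poly_eval_add by (rule tendsto_add[OF p(2) q(2)])
  ultimately show ?thesis using LIMSEQ_unique by blast
qed

lemma cfc_mult:
  assumes sa: "selfadjoint a" and f: "continuous_on (rspectrum a) f"
    and g: "continuous_on (rspectrum a) g"
  shows "cfc (\<lambda>t. f t * g t) a = cfc f a * cfc g a"
proof -
  obtain p where p: "uniform_limit (rspectrum a) (\<lambda>n t. poly (p n) t) f sequentially"
    "(\<lambda>n. poly_eval (p n) a) \<longlonglongrightarrow> cfc f a" using cfc_approx[OF sa f] .
  obtain q where q: "uniform_limit (rspectrum a) (\<lambda>n t. poly (q n) t) g sequentially"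
    "(\<lambda>n. poly_eval (q n) a) \<longlonglongrightarrow> cfc g a" using cfc_approx[OF sa g] .
  have "bounded (f ` rspectrum a)" "bounded (g ` rspectrum a)"
    using compact_continuous_image[OF _ compact_rspectrum] f g compact_imp_bounded by blast+
  then have "(\<lambda>n. poly_eval (p n * q n) a) \<longlonglongrightarrow> cfc (\<lambda>t. f t * g t) a"
    using uniform_lim_mult[OF p(1) q(1)]
    by (intro cfc_limit[OF sa] continuous_on_mult f g) simp
  moreover have "(\<lambda>n. poly_eval (p n * q n) a) \<longlonglongrightarrow> cfc f a * cfc g a"
    unfolding poly_eval_mult by (rule tendsto_mult[OF p(2) q(2)])
  ultimately show ?thesis using LIMSEQ_unique by blast
qed

lemma cfc_scaleR:
  assumes "selfadjoint a" "continuous_on (rspectrum a) f"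
  shows "cfc (\<lambda>t. c * f t) a = c *\<^sub>R cfc f a"
  using cfc_mult[OF assms(1) continuous_on_const assms(2), of c] cfc_const[OF assms(1), of c] by simp

lemma cfc_commute:
  assumes "selfadjoint a" "continuous_on (rspectrum a) f" "continuous_on (rspectrum a) g"
  shows "cfc f a * cfc g a = cfc g a * cfc f a"
  using cfc_mult[OF assms] cfc_mult[OF assms(1) assms(3) assms(2)] by (simp add: mult.commute)

lemma cfc_norm_le:
  assumes sa: "selfadjoint a" and f: "continuous_on (rspectrum a) f"
    and M: "\<And>t. t \<in> rspectrum a \<Longrightarrow> \<bar>f t\<bar> \<le> M"
  shows "norm (cfc f a) \<le> M"
proof (rule field_le_epsilon)
  fix e :: real assume e: "e > 0"
  obtain p where p: "uniform_limit (rspectrum a) (\<lambda>n t. poly (p n) t) f sequentially"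
    "(\<lambda>n. poly_eval (p n) a) \<longlonglongrightarrow> cfc f a" using cfc_approx[OF sa f] .
  from uniform_limitD[OF p(1) e]
  have "\<forall>\<^sub>F n in sequentially. norm (poly_eval (p n) a) \<le> M + e"
  proof eventually_elim
    case (elim n)
    obtain s where s: "s \<in> rspectrum a" "norm (poly_eval (p n) a) = \<bar>poly (p n) s\<bar>"
      using poly_eval_norm[OF sa] by blast
    then show ?case using elim[rule_format, OF s(1)] M[OF s(1)] by (simp add: dist_real_def)
  qed
  then show "norm (cfc f a) \<le> M + e"
    using tendsto_upperbound[OF tendsto_norm[OF p(2)]] by simp
qed

lemma cfc_mult_inverse:
  assumes sa: "selfadjoint a" and f: "continuous_on (rspectrum a) f"
    and nz: "\<And>t. t \<in> rspectrum a \<Longrightarrow> f t \<noteq> 0"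
  shows "cfc f a * cfc (\<lambda>t. inverse (f t)) a = 1" "cfc (\<lambda>t. inverse (f t)) a * cfc f a = 1"
proof -
  have i: "continuous_on (rspectrum a) (\<lambda>t. inverse (f t))"
    by (intro continuous_on_inverse f) (use nz in auto)
  have "cfc (\<lambda>t. f t * inverse (f t)) a = cfc (\<lambda>_. 1) a"
    by (rule cfc_cong) (simp add: nz)
  then show "cfc f a * cfc (\<lambda>t. inverse (f t)) a = 1"
    using cfc_mult[OF sa f i] cfc_const[OF sa, of 1] by simp
  then show "cfc (\<lambda>t. inverse (f t)) a * cfc f a = 1"
    using cfc_commute[OF sa f i] by simp
qed

text \<open>For \<open>s\<close> outside the image, \<open>f - s\<close> has no zero on the
  spectrum, and its reciprocal yields an inverse of \<open>cfc f a - s\<close>.\<close>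

lemma rspectrum_cfc:
  assumes sa: "selfadjoint a" and f: "continuous_on (rspectrum a) f"
  shows "rspectrum (cfc f a) \<subseteq> f ` rspectrum a"
proof
  fix s assume s: "s \<in> rspectrum (cfc f a)"
  show "s \<in> f ` rspectrum a"
  proof (rule ccontr)
    assume n: "s \<notin> f ` rspectrum a"
    have c: "continuous_on (rspectrum a) (\<lambda>t. f t + (- s))" by (intro continuous_intros f)
    have "cfc (\<lambda>t. f t + (- s)) a = cfc f a - s *\<^sub>R 1"
      using cfc_add[OF sa f continuous_on_const, of "- s"] cfc_const[OF sa, of "- s"] by simp
    moreover have "cs_invertible (cfc (\<lambda>t. f t + (- s)) a)"
      by (rule cs_invertibleI; rule cfc_mult_inverse[OF sa c]) (use n in auto)
    ultimately show False using s by (simp add: rspectrum_iff)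
  qed
qed

lemma cfc_poly_comp:
  assumes sa: "selfadjoint a" and f: "continuous_on (rspectrum a) f"
  shows "poly_eval q (cfc f a) = cfc (\<lambda>t. poly q (f t)) a"
proof (induction q)
  case 0
  then show ?case using cfc_const[OF sa, of 0] by simp
next
  case (pCons c q)
  have 1: "continuous_on (rspectrum a) (\<lambda>t. poly q (f t))"
    by (intro continuous_intros f)
  have 2: "continuous_on (rspectrum a) (\<lambda>t. f t * poly q (f t))"
    by (intro continuous_intros f)
  show ?case
    using cfc_add[OF sa continuous_on_const 2, of c] cfc_mult[OF sa f 1] cfc_const[OF sa, of c] pCons
    by (simp add: poly_eval_pCons)
qed

text \<open>\<open>h\<close> is approximated on the image of the spectrum under \<open>f\<close>,
  which contains the spectrum of \<open>cfc f a\<close>, so one polynomial sequence serves both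
  sides.\<close>

lemma cfc_comp:
  assumes sa: "selfadjoint a" and f: "continuous_on (rspectrum a) f"
    and h: "continuous_on (f ` rspectrum a) h"
  shows "cfc h (cfc f a) = cfc (\<lambda>t. h (f t)) a"
proof -
  have sf: "selfadjoint (cfc f a)" by (rule cfc_selfadjoint[OF sa f])
  have K: "compact (f ` rspectrum a)" by (rule compact_continuous_image[OF f compact_rspectrum])
  obtain q :: "nat \<Rightarrow> real poly"
    where q: "uniform_limit (f ` rspectrum a) (\<lambda>n t. poly (q n) t) h sequentially"
    using Weierstrass_poly[OF K h] by blast
  have "(\<lambda>n. poly_eval (q n) (cfc f a)) \<longlonglongrightarrow> cfc h (cfc f a)"
    using rspectrum_cfc[OF sa f] q h
    by (intro cfc_limit[OF sf]) (auto intro: continuous_on_subset uniform_limit_on_subset)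
  moreover have "(\<lambda>n. poly_eval (q n) (cfc f a)) \<longlonglongrightarrow> cfc (\<lambda>t. h (f t)) a"
    unfolding cfc_poly_comp[OF sa f]
  proof (rule LIM_zero_cancel, rule tendsto_norm_zero_cancel, rule tendstoI)
    fix e :: real assume e: "e > 0"
    have hf: "continuous_on (rspectrum a) (\<lambda>t. h (f t))"
      using continuous_on_compose2[OF h f] by simp
    have "\<forall>\<^sub>F n in sequentially. \<forall>x\<in>f ` rspectrum a. dist (poly (q n) x) (h x) < e / 2"
      by (rule uniform_limitD[OF q]) (use e in simp)
    then show "\<forall>\<^sub>F n in sequentially.
      dist (norm (cfc (\<lambda>t. poly (q n) (f t)) a - cfc (\<lambda>t. h (f t)) a)) 0 < e"
    proof eventually_elim
      case (elim n)
      have c1: "continuous_on (rspectrum a) (\<lambda>t. poly (q n) (f t))"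
        by (intro continuous_intros f)
      have c2: "continuous_on (rspectrum a) (\<lambda>t. (-1) * h (f t))"
        by (intro continuous_intros hf)
      have "cfc (\<lambda>t. poly (q n) (f t)) a - cfc (\<lambda>t. h (f t)) a
        = cfc (\<lambda>t. poly (q n) (f t) + (-1) * h (f t)) a"
        unfolding cfc_add[OF sa c1 c2] cfc_scaleR[OF sa hf] by simp
      moreover have "norm (cfc (\<lambda>t. poly (q n) (f t) + (-1) * h (f t)) a) \<le> e / 2"
        using elim by (intro cfc_norm_le[OF sa continuous_on_add[OF c1 c2]])
          (force simp: dist_real_def)
      ultimately show ?case using e by simp
    qed
  qed
  ultimately show ?thesis using LIMSEQ_unique by blast
qed

section \<open>The positive definite cone and Kubo-Ando means\<close>

lemma rspectrum_dist_le:
  assumes "t \<in> rspectrum (c::'a::cstar_algebra)"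
  shows "\<bar>t - \<mu>\<bar> \<le> norm (c - \<mu> *\<^sub>R 1)"
proof (rule rspectrum_abs_le)
  have "c - \<mu> *\<^sub>R 1 - (t - \<mu>) *\<^sub>R 1 = c - t *\<^sub>R 1" by (simp add: scaleR_left_diff_distrib)
  then show "t - \<mu> \<in> rspectrum (c - \<mu> *\<^sub>R 1)" using assms by (simp only: rspectrum_iff not_False_eq_True)
qed

lemma rspectrum_scalar: "rspectrum (x *\<^sub>R 1 :: 'a::cstar_algebra) = {x}"
proof -
  have "\<not> cs_invertible (0::'a)" by (auto simp: cs_invertible_def)
  moreover have "t = x" if "t \<in> rspectrum (x *\<^sub>R 1 :: 'a)" for t
    using rspectrum_dist_le[OF that, of x] by simp
  ultimately show ?thesis by (auto simp: rspectrum_iff)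
qed

lemma cfc_scalar: "cfc f (x *\<^sub>R 1) = f x *\<^sub>R (1::'a::cstar_algebra)"
proof -
  have "cfc f (x *\<^sub>R 1) = cfc (\<lambda>_. f x) (x *\<^sub>R (1::'a))"
    by (rule cfc_cong) (simp add: rspectrum_scalar)
  then show ?thesis by (simp add: cfc_const selfadjoint_intros)
qed

lemma pos_def_cone_iff:
  "a \<in> pos_def_cone \<longleftrightarrow> selfadjoint a \<and> rspectrum a \<subseteq> {0<..}" for a :: "'a::cstar_algebra"
proof
  assume "a \<in> pos_def_cone"
  then have a: "selfadjoint a" "cspectrum a \<subseteq> complex_of_real ` {0..}" "cs_invertible a"
    by (auto simp: pos_def_cone_def cs_positive_def)
  have "t > 0" if "t \<in> rspectrum a" for t
  proof -
    have "complex_of_real t \<in> complex_of_real ` {0..}" using a(2) that by (auto simp: rspectrum_def)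
    then have "t \<ge> 0" by auto
    moreover have "t \<noteq> 0" using that a(3) by (auto simp: rspectrum_iff)
    ultimately show ?thesis by simp
  qed
  with a(1) show "selfadjoint a \<and> rspectrum a \<subseteq> {0<..}" by auto
next
  assume a: "selfadjoint a \<and> rspectrum a \<subseteq> {0<..}"
  have "c \<in> complex_of_real ` {0..}" if c: "c \<in> cspectrum a" for c
  proof -
    have "c = of_real (Re c)" using selfadjoint_cspectrum_real[OF _ c] a by (simp add: complex_eq_iff)
    moreover from this have "Re c \<in> rspectrum a" using c by (metis rspectrum_def mem_Collect_eq)
    then have "Re c > 0" using a by auto
    ultimately show ?thesis by (metis atLeast_iff image_eqI less_imp_le)
  qed
  moreover have "cs_invertible a"
  proof (rule ccontr)
    assume "\<not> cs_invertible a"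
    then have "0 \<in> rspectrum a" by (simp add: rspectrum_iff)
    then show False using a by auto
  qed
  ultimately show "a \<in> pos_def_cone" using a by (auto simp: pos_def_cone_def cs_positive_def)
qed

lemma pos_def_cone_selfadjoint: "a \<in> pos_def_cone \<Longrightarrow> selfadjoint a"
  and pos_def_cone_rspectrum: "a \<in> pos_def_cone \<Longrightarrow> rspectrum a \<subseteq> {0<..}"
  by (simp_all add: pos_def_cone_iff)

lemma pos_def_cone_invertible: "a \<in> pos_def_cone \<Longrightarrow> cs_invertible a"
  by (simp add: pos_def_cone_def)

text \<open>The inequality keeps the spectrum at distance less than \<open>M\<close> from
  \<open>M\<close>; conversely \<open>M = norm a\<close> works because the spectrum has a positive
  minimum. This norm test reduces sums of cone elements to the triangle inequality.\<close>

lemma pos_def_cone_norm_iff: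
  fixes a :: "'a::cstar_algebra"
  assumes "selfadjoint a"
  shows "a \<in> pos_def_cone \<longleftrightarrow> (\<exists>M. norm (a - M *\<^sub>R 1) < M)"
proof
  assume "\<exists>M. norm (a - M *\<^sub>R 1) < M"
  then obtain M where "norm (a - M *\<^sub>R 1) < M" ..
  then have "t > 0" if "t \<in> rspectrum a" for t
    using rspectrum_dist_le[OF that, of M] by linarith
  with assms show "a \<in> pos_def_cone" by (auto simp: pos_def_cone_iff)
next
  assume "a \<in> pos_def_cone"
  then have pos: "rspectrum a \<subseteq> {0<..}" by (rule pos_def_cone_rspectrum)
  have ne: "rspectrum a \<noteq> {}" using selfadjoint_norm_in_spectrum[OF assms] by blast
  obtain d where d: "d \<in> rspectrum a" "\<And>t. t \<in> rspectrum a \<Longrightarrow> d \<le> t"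
    using compact_attains_inf[OF compact_rspectrum ne] by blast
  have d0: "d > 0" using d pos by auto
  have c: "continuous_on (rspectrum a) (\<lambda>t. t)" by (intro continuous_intros)
  have "norm (cfc (\<lambda>t. t + (- norm a)) a) \<le> norm a - d"
    using d(2) rspectrum_abs_le[of _ a]
    by (intro cfc_norm_le[OF assms]) (force intro!: continuous_intros)+
  also have "cfc (\<lambda>t. t + (- norm a)) a = a - norm a *\<^sub>R 1"
    unfolding cfc_add[OF assms c continuous_on_const] by (simp add: cfc_id assms cfc_const)
  finally show "\<exists>M. norm (a - M *\<^sub>R 1) < M" using d0 by (intro exI[of _ "norm a"]) linarith
qed

lemma pos_def_cone_add:
  fixes a b :: "'a::cstar_algebra"
  assumes a: "a \<in> pos_def_cone" and b: "b \<in> pos_def_cone"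
  shows "a + b \<in> pos_def_cone"
proof -
  note sa = pos_def_cone_selfadjoint[OF a] pos_def_cone_selfadjoint[OF b]
  obtain M N where "norm (a - M *\<^sub>R 1) < M" "norm (b - N *\<^sub>R 1) < N"
    using a b pos_def_cone_norm_iff sa by blast
  moreover have "a + b - (M + N) *\<^sub>R 1 = (a - M *\<^sub>R 1) + (b - N *\<^sub>R 1)" by (simp add: algebra_simps)
  ultimately have "norm (a + b - (M + N) *\<^sub>R 1) < M + N"
    using norm_triangle_ineq[of "a - M *\<^sub>R 1" "b - N *\<^sub>R 1"] by (simp only:)
  then show ?thesis using pos_def_cone_norm_iff[OF selfadjoint_add[OF sa]] by blast
qed

lemma cfc_pos_def_cone:
  assumes a: "a \<in> pos_def_cone" and f: "continuous_on {0<..} f" and pos: "\<And>t. t > 0 \<Longrightarrow> f t > 0"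
  shows "cfc f a \<in> pos_def_cone"
proof -
  note sa = pos_def_cone_selfadjoint[OF a]
  have c: "continuous_on (rspectrum a) f"
    using continuous_on_subset[OF f pos_def_cone_rspectrum[OF a]] .
  show ?thesis using rspectrum_cfc[OF sa c] pos_def_cone_rspectrum[OF a] pos cfc_selfadjoint[OF sa c]
    by (auto simp: pos_def_cone_iff)
qed

lemma cfc_comp_pos:
  assumes a: "a \<in> pos_def_cone" and f: "continuous_on {0<..} f" and pos: "\<And>t. t > 0 \<Longrightarrow> f t > 0"
    and h: "continuous_on {0<..} h"
  shows "cfc h (cfc f a) = cfc (\<lambda>t. h (f t)) a"
proof (rule cfc_comp[OF pos_def_cone_selfadjoint[OF a]])
  show "continuous_on (rspectrum a) f"
    using continuous_on_subset[OF f pos_def_cone_rspectrum[OF a]] .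
  show "continuous_on (f ` rspectrum a) h"
    by (rule continuous_on_subset[OF h]) (use pos pos_def_cone_rspectrum[OF a] in auto)
qed

lemma cfc_mult_pos:
  assumes a: "a \<in> pos_def_cone" and "continuous_on {0<..} f" "continuous_on {0<..} g"
  shows "cfc f a * cfc g a = cfc (\<lambda>t. f t * g t) a"
  using assms continuous_on_subset[OF _ pos_def_cone_rspectrum[OF a]]
  by (intro cfc_mult[symmetric] pos_def_cone_selfadjoint) blast+

lemma cfc_cong_pos:
  assumes a: "a \<in> pos_def_cone" and "\<And>t. t > 0 \<Longrightarrow> f t = g t"
  shows "cfc f a = cfc g a"
  using pos_def_cone_rspectrum[OF a] assms(2) by (intro cfc_cong) auto

lemma cfc_inverse_mult:
  assumes a: "a \<in> pos_def_cone"
  shows "a * cfc inverse a = 1" "cfc inverse a * a = 1"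
  using cfc_mult_inverse[OF pos_def_cone_selfadjoint[OF a], of "\<lambda>t. t"] pos_def_cone_rspectrum[OF a]
    cfc_id[OF pos_def_cone_selfadjoint[OF a]] by (auto intro!: continuous_intros)

lemma cfc_inverse_eqI:
  assumes a: "a \<in> pos_def_cone" and "a * b = 1"
  shows "cfc inverse a = b"
  using left_right_inverse_unique[OF assms(2) cfc_inverse_mult(2)[OF a]] by simp

lemma cfc_inverse_pos: "a \<in> pos_def_cone \<Longrightarrow> cfc inverse a \<in> pos_def_cone"
  by (rule cfc_pos_def_cone) (auto intro!: continuous_intros)

lemma cfc_square: "a \<in> pos_def_cone \<Longrightarrow> cfc (\<lambda>t. t\<^sup>2) a = a * a"
  using cfc_mult_pos[of a "\<lambda>t. t" "\<lambda>t. t"]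
  by (simp add: cfc_id pos_def_cone_selfadjoint continuous_on_id power2_eq_square)

lemma pos_def_cone_square: "a \<in> pos_def_cone \<Longrightarrow> a * a \<in> pos_def_cone"
  unfolding cfc_square[symmetric] by (rule cfc_pos_def_cone) (auto intro!: continuous_intros)

lemma pos_def_cone_scaleR:
  assumes a: "a \<in> pos_def_cone" and r: "r > 0"
  shows "r *\<^sub>R a \<in> pos_def_cone"
proof -
  have "cfc (\<lambda>t. r * t) a = r *\<^sub>R a"
    using cfc_scaleR[OF pos_def_cone_selfadjoint[OF a], of "\<lambda>t. t" r]
    by (simp add: cfc_id pos_def_cone_selfadjoint[OF a] continuous_on_id)
  moreover have "cfc (\<lambda>t. r * t) a \<in> pos_def_cone"
    by (rule cfc_pos_def_cone[OF a]) (use r in \<open>auto intro!: continuous_intros\<close>)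
  ultimately show ?thesis by simp
qed

lemma cfc_of_scaleR:
  assumes a: "a \<in> pos_def_cone" and r: "r > 0" and h: "continuous_on {0<..} h"
  shows "cfc h (r *\<^sub>R a) = cfc (\<lambda>t. h (r * t)) a"
proof -
  have "cfc (\<lambda>t. r * t) a = r *\<^sub>R a"
    using cfc_scaleR[OF pos_def_cone_selfadjoint[OF a], of "\<lambda>t. t" r]
    by (simp add: cfc_id pos_def_cone_selfadjoint[OF a] continuous_on_id)
  moreover have "cfc h (cfc (\<lambda>t. r * t) a) = cfc (\<lambda>t. h (r * t)) a"
    by (rule cfc_comp_pos[OF a _ _ h]) (use r in \<open>auto intro!: continuous_intros\<close>)
  ultimately show ?thesis by simp
qed

text \<open>For \<open>t \<le> 0\<close> one has \<open>s b s - t = s (b - t s^-2) s\<close>, and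
  the middle factor lies in the cone, so it is invertible and \<open>t\<close> is not a spectral
  value.\<close>

lemma pos_def_cone_conj:
  fixes s b :: "'a::cstar_algebra"
  assumes s: "s \<in> pos_def_cone" and b: "b \<in> pos_def_cone"
  shows "s * b * s \<in> pos_def_cone"
proof -
  define u where "u = cfc inverse s"
  have us: "u * s = 1" "s * u = 1" using cfc_inverse_mult[OF s] by (simp_all add: u_def)
  have uu: "u * u \<in> pos_def_cone"
    unfolding u_def by (intro pos_def_cone_square cfc_inverse_pos s)
  have "t > 0" if t: "t \<in> rspectrum (s * b * s)" for t
  proof (rule ccontr)
    assume "\<not> t > 0"
    then consider "t = 0" | "- t > 0" by linarith
    then have "b + (- t) *\<^sub>R (u * u) \<in> pos_def_cone"
    proof cases
      case 2
      then show ?thesis by (intro pos_def_cone_add b pos_def_cone_scaleR[OF uu])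
    qed (simp add: b)
    then have "cs_invertible (s * (b + (- t) *\<^sub>R (u * u)) * s)"
      by (intro cs_invertible_mult pos_def_cone_invertible s)
    also have "s * (b + (- t) *\<^sub>R (u * u)) * s = s * b * s - t *\<^sub>R ((s * u) * (u * s))"
      by (simp add: distrib_left distrib_right right_diff_distrib left_diff_distrib mult.assoc)
    finally show False using t us by (simp add: rspectrum_iff)
  qed
  moreover have "selfadjoint (s * b * s)"
    by (intro selfadjoint_conj pos_def_cone_selfadjoint s b)
  ultimately show ?thesis by (auto simp: pos_def_cone_iff)
qed

section \<open>Square roots, Kubo-Ando means and the Riccati equation on the cone\<close>

context
  fixes a :: "'a::cstar_algebra"
  assumes a: "a \<in> pos_def_cone"
begin

abbreviation (input) "rt \<equiv> cfc sqrt a"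
abbreviation (input) "irt \<equiv> cfc (\<lambda>t. inverse (sqrt t)) a"

lemma continuous_on_inverse_sqrt: "continuous_on {0<..} (\<lambda>t. inverse (sqrt t))"
  by (intro continuous_intros) auto

lemma rt_pos: "rt \<in> pos_def_cone"
  by (rule cfc_pos_def_cone[OF a]) (auto intro!: continuous_intros)

lemma irt_pos: "irt \<in> pos_def_cone"
  by (rule cfc_pos_def_cone[OF a continuous_on_inverse_sqrt]) auto

lemma irt_mult_irt: "irt * irt = cfc inverse a"
proof -
  have "irt * irt = cfc (\<lambda>t. inverse (sqrt t) * inverse (sqrt t)) a"
    by (rule cfc_mult_pos[OF a continuous_on_inverse_sqrt continuous_on_inverse_sqrt])
  also have "\<dots> = cfc inverse a"
    by (rule cfc_cong_pos[OF a]) (simp flip: inverse_mult_distrib)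
  finally show ?thesis .
qed

lemma rt_mult_irt: "rt * irt = 1" "irt * rt = 1"
proof -
  have "continuous_on (rspectrum a) sqrt" by (intro continuous_intros)
  moreover have "sqrt t \<noteq> 0" if "t \<in> rspectrum a" for t
    using pos_def_cone_rspectrum[OF a] that by auto
  ultimately show "rt * irt = 1" "irt * rt = 1"
    using cfc_mult_inverse[OF pos_def_cone_selfadjoint[OF a]] by blast+
qed

lemma ka_mean_eq: "ka_mean f a b = rt * cfc f (irt * b * irt) * rt"
  by (simp add: ka_mean_def Let_def)

lemma irt_conj_pos: "b \<in> pos_def_cone \<Longrightarrow> irt * b * irt \<in> pos_def_cone"
  by (rule pos_def_cone_conj[OF irt_pos])

lemma ka_mean_cong:
  assumes "b \<in> pos_def_cone" "\<And>t. t > 0 \<Longrightarrow> f t = g t"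
  shows "ka_mean f a b = ka_mean g a b"
  unfolding ka_mean_eq using cfc_cong_pos[OF irt_conj_pos[OF assms(1)] assms(2)] by simp

lemma ka_mean_pos:
  assumes "b \<in> pos_def_cone" "continuous_on {0<..} f" "\<And>t. t > 0 \<Longrightarrow> f t > 0"
  shows "ka_mean f a b \<in> pos_def_cone"
  unfolding ka_mean_eq
  by (intro pos_def_cone_conj rt_pos cfc_pos_def_cone irt_conj_pos assms)

lemma ka_mean_scaleR:
  assumes b: "b \<in> pos_def_cone" and r: "r > 0"
  shows "ka_mean f (r *\<^sub>R a) (r *\<^sub>R b) = r *\<^sub>R ka_mean f a b"
proof -
  have 1: "cfc sqrt (r *\<^sub>R a) = sqrt r *\<^sub>R rt"
  proof -
    have "cfc sqrt (r *\<^sub>R a) = cfc (\<lambda>t. sqrt (r * t)) a"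
      by (rule cfc_of_scaleR[OF a r]) (intro continuous_intros)
    then show ?thesis
      using cfc_scaleR[OF pos_def_cone_selfadjoint[OF a], of sqrt "sqrt r"]
      by (simp add: real_sqrt_mult continuous_on_real_sqrt continuous_on_id)
  qed
  have 2: "cfc (\<lambda>t. inverse (sqrt t)) (r *\<^sub>R a) = inverse (sqrt r) *\<^sub>R irt"
  proof -
    have "cfc (\<lambda>t. inverse (sqrt t)) (r *\<^sub>R a) = cfc (\<lambda>t. inverse (sqrt (r * t))) a"
      by (rule cfc_of_scaleR[OF a r continuous_on_inverse_sqrt])
    then show ?thesis
      using cfc_scaleR[OF pos_def_cone_selfadjoint[OF a] continuous_on_subset[OF continuous_on_inverse_sqrt pos_def_cone_rspectrum[OF a]], of "inverse (sqrt r)"]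
      by (simp add: real_sqrt_mult)
  qed
  have 3: "inverse (sqrt r) * (inverse (sqrt r) * r) = 1" "sqrt r * sqrt r = r"
    using r by (simp_all add: field_simps)
  show ?thesis unfolding ka_mean_def Let_def 1 2 using 3
    by (simp add: mult.commute mult.left_commute)
qed

text \<open>Writing the inverse of \<open>a\<close> as \<open>irt * irt\<close> cancels the inner
  factors \<open>rt\<close>, and the two square roots left in the middle multiply to the conjugate
  of \<open>b\<close>.\<close>

lemma geometric_mean_riccati:
  assumes b: "b \<in> pos_def_cone"
  shows "ka_mean sqrt a b * cfc inverse a * ka_mean sqrt a b = b"
proof -
  define W where "W = irt * b * irt"
  have W: "W \<in> pos_def_cone" unfolding W_def by (rule irt_conj_pos[OF b])
  define R where "R = cfc sqrt W"
  have "cfc (\<lambda>t. sqrt t * sqrt t) W = cfc (\<lambda>t. t) W" by (rule cfc_cong_pos[OF W]) simp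
  then have RR: "R * R = W"
    unfolding R_def using cfc_mult_pos[OF W, of sqrt sqrt]
    by (simp add: cfc_id pos_def_cone_selfadjoint W continuous_on_real_sqrt continuous_on_id)
  have "ka_mean sqrt a b * cfc inverse a * ka_mean sqrt a b
      = rt * R * (rt * irt) * (irt * rt) * R * rt"
    unfolding ka_mean_eq irt_mult_irt[symmetric] R_def W_def by (simp add: mult.assoc)
  also have "\<dots> = rt * (R * R) * rt" by (simp add: rt_mult_irt mult.assoc)
  also have "\<dots> = (rt * irt) * b * (irt * rt)" by (simp add: RR W_def mult.assoc)
  finally show ?thesis by (simp add: rt_mult_irt)
qed

text \<open>Uniqueness in the Riccati equation: conjugated by \<open>irt\<close>, the second operand
  becomes \<open>T * T\<close>, whose root is \<open>T\<close> by positivity. This allows the mean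
  \<open>G\<close> to be prescribed and the second operand to be computed from it.\<close>

lemma geometric_mean_eqI:
  assumes G: "G \<in> pos_def_cone"
  shows "ka_mean sqrt a (G * cfc inverse a * G) = G"
proof -
  define T where "T = irt * G * irt"
  have T: "T \<in> pos_def_cone" unfolding T_def by (rule irt_conj_pos[OF G])
  have "irt * (G * cfc inverse a * G) * irt = T * T"
    unfolding T_def irt_mult_irt[symmetric] by (simp add: mult.assoc)
  also have "\<dots> = cfc (\<lambda>t. t\<^sup>2) T" by (simp add: cfc_square T)
  finally have "cfc sqrt (irt * (G * cfc inverse a * G) * irt) = cfc (\<lambda>t. sqrt (t\<^sup>2)) T"
    using cfc_comp_pos[OF T, of "\<lambda>t. t\<^sup>2" sqrt] by (simp add: continuous_intros continuous_on_real_sqrt)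
  also have "\<dots> = cfc (\<lambda>t. t) T" by (rule cfc_cong_pos[OF T]) simp
  also have "\<dots> = T" by (simp add: cfc_id pos_def_cone_selfadjoint T)
  finally have "ka_mean sqrt a (G * cfc inverse a * G) = (rt * irt) * G * (irt * rt)"
    unfolding ka_mean_eq T_def by (simp add: mult.assoc)
  then show ?thesis by (simp add: rt_mult_irt)
qed

end

text \<open>Inverting \<open>a\<close> interchanges its square root with its inverse square root and
  inverts the inner argument \<open>W\<close>. This is the mean generated by the reciprocal
  function.\<close>

lemma ka_mean_adjoint:
  assumes a: "a \<in> pos_def_cone" and b: "b \<in> pos_def_cone"
    and f: "continuous_on {0<..} f" and pos: "\<And>t. t > 0 \<Longrightarrow> f t > 0"
  shows "cfc inverse (ka_mean f (cfc inverse a) (cfc inverse b))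
    = ka_mean (\<lambda>t. inverse (f (inverse t))) a b"
proof -
  have inv: "continuous_on {0<..} (inverse :: real \<Rightarrow> real)" by (intro continuous_intros) auto
  have fi: "continuous_on {0<..} (\<lambda>t. f (inverse t))"
    by (rule continuous_on_compose2[OF f inv]) auto
  let ?s = "cfc sqrt a" and ?u = "cfc (\<lambda>t. inverse (sqrt t)) a"
  have s': "cfc sqrt (cfc inverse a) = ?u"
  proof -
    have "cfc sqrt (cfc inverse a) = cfc (\<lambda>t. sqrt (inverse t)) a"
      by (rule cfc_comp_pos[OF a inv]) (auto intro!: continuous_intros)
    then show ?thesis by (simp add: real_sqrt_inverse)
  qed
  have u': "cfc (\<lambda>t. inverse (sqrt t)) (cfc inverse a) = ?s"
  proof -
    have "cfc (\<lambda>t. inverse (sqrt t)) (cfc inverse a) = cfc (\<lambda>t. inverse (sqrt (inverse t))) a"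
      by (rule cfc_comp_pos[OF a inv _ continuous_on_inverse_sqrt[OF a]]) auto
    then show ?thesis by (simp add: real_sqrt_inverse)
  qed
  define W where "W = ?u * b * ?u"
  have W: "W \<in> pos_def_cone" unfolding W_def by (rule irt_conj_pos[OF a b])
  have "W * (?s * cfc inverse b * ?s) = ?u * b * (?u * ?s) * cfc inverse b * ?s"
    by (simp add: W_def mult.assoc)
  also have "\<dots> = ?u * (b * cfc inverse b) * ?s" by (simp add: rt_mult_irt[OF a] mult.assoc)
  also have "\<dots> = 1" by (simp add: cfc_inverse_mult[OF b] rt_mult_irt[OF a])
  finally have Wi: "?s * cfc inverse b * ?s = cfc inverse W"
    using cfc_inverse_eqI[OF W] by simp
  define F where "F = cfc (\<lambda>t. f (inverse t)) W"
  have F: "F \<in> pos_def_cone" unfolding F_def by (rule cfc_pos_def_cone[OF W fi]) (simp add: pos)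
  have "ka_mean f (cfc inverse a) (cfc inverse b) = ?u * cfc f (cfc inverse W) * ?u"
    unfolding ka_mean_def Let_def s' u' Wi ..
  also have "cfc f (cfc inverse W) = F"
    unfolding F_def by (rule cfc_comp_pos[OF W inv _ f]) auto
  finally have m: "ka_mean f (cfc inverse a) (cfc inverse b) = ?u * F * ?u" .
  have Fi: "cfc (\<lambda>t. inverse (f (inverse t))) W = cfc inverse F"
    unfolding F_def by (rule cfc_comp_pos[OF W fi _ inv, symmetric]) (simp add: pos)
  have "?u * F * ?u * (?s * cfc inverse F * ?s) = ?u * F * (?u * ?s) * cfc inverse F * ?s"
    by (simp add: mult.assoc)
  also have "\<dots> = ?u * (F * cfc inverse F) * ?s" by (simp add: rt_mult_irt[OF a] mult.assoc)
  also have "\<dots> = 1" by (simp add: cfc_inverse_mult[OF F] rt_mult_irt[OF a])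
  finally have "cfc inverse (?u * F * ?u) = ?s * cfc inverse F * ?s"
    by (intro cfc_inverse_eqI pos_def_cone_conj irt_pos a F)
  then show ?thesis unfolding m ka_mean_eq[OF a] Fi[symmetric] W_def .
qed

section \<open>Limits at scalar elements\<close>

lemma eventually_rspectrum_subset:
  fixes X :: "nat \<Rightarrow> 'a::cstar_algebra"
  assumes X: "X \<longlonglongrightarrow> \<mu> *\<^sub>R 1" and S: "open S" "\<mu> \<in> S"
  shows "\<forall>\<^sub>F n in sequentially. rspectrum (X n) \<subseteq> S"
proof -
  obtain d where d: "d > 0" "ball \<mu> d \<subseteq> S" using S openE by blast
  have "\<forall>\<^sub>F n in sequentially. norm (X n - \<mu> *\<^sub>R 1) < d"
    using tendstoD[OF X d(1)] by (simp add: dist_norm)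
  then show ?thesis
  proof eventually_elim
    case (elim n)
    then have "t \<in> ball \<mu> d" if "t \<in> rspectrum (X n)" for t
      using rspectrum_dist_le[OF that, of \<mu>] by (simp add: dist_real_def abs_minus_commute)
    then show ?case using d(2) by auto
  qed
qed

text \<open>Near a scalar the spectrum is confined to a small neighbourhood of one point, so
  \<open>cfc_norm_le\<close> applied to \<open>h - h \<mu>\<close> gives continuity of the calculus
  there.\<close>

lemma tendsto_cfc_scalar:
  fixes X :: "nat \<Rightarrow> 'a::cstar_algebra"
  assumes X: "X \<longlonglongrightarrow> \<mu> *\<^sub>R 1" and saX: "\<forall>\<^sub>F n in sequentially. selfadjoint (X n)"
    and S: "open S" "\<mu> \<in> S" and h: "continuous_on S h"
  shows "(\<lambda>n. cfc h (X n)) \<longlonglongrightarrow> h \<mu> *\<^sub>R 1"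
proof (rule tendstoI)
  fix e :: real assume e: "e > 0"
  define T where "T = S \<inter> h -` ball (h \<mu>) (e/2)"
  have T: "open T" "\<mu> \<in> T"
    using continuous_open_preimage[OF h S(1) open_ball, of "h \<mu>" "e/2"] S(2) e by (auto simp: T_def)
  from eventually_rspectrum_subset[OF X T] saX
  show "\<forall>\<^sub>F n in sequentially. dist (cfc h (X n)) (h \<mu> *\<^sub>R 1) < e"
  proof eventually_elim
    case (elim n)
    note sa = elim(2)
    have c: "continuous_on (rspectrum (X n)) h"
      by (rule continuous_on_subset[OF h]) (use elim T_def in auto)
    have "norm (cfc (\<lambda>t. h t + (- h \<mu>)) (X n)) \<le> e / 2"
    proof (intro cfc_norm_le[OF sa] continuous_intros c)
      fix t assume "t \<in> rspectrum (X n)"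
      then have "dist (h \<mu>) (h t) < e / 2" using elim by (auto simp: T_def)
      then show "\<bar>h t + - h \<mu>\<bar> \<le> e / 2" by (simp add: dist_real_def abs_minus_commute)
    qed
    also have "cfc (\<lambda>t. h t + (- h \<mu>)) (X n) = cfc h (X n) - h \<mu> *\<^sub>R 1"
      unfolding cfc_add[OF sa c continuous_on_const] by (simp add: cfc_const sa)
    finally show ?case using e by (simp add: dist_norm)
  qed
qed

section \<open>Homogeneous quasi-arithmetic means and double commutators\<close>

text \<open>A maximum principle: let \<open>p\<close> maximize \<open>H\<close>. Reflecting the
  nearer endpoint in \<open>p\<close> stays in the interval, so \<open>H p\<close> is half of
  another value of \<open>H\<close>, hence at most \<open>H p / 2\<close>.\<close>

lemma midpoint_affine_le_zero:
  fixes H :: "real \<Rightarrow> real"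
  assumes uv: "u \<le> v" and cont: "continuous_on {u..v} H" and zero: "H u = 0" "H v = 0"
    and mid: "\<And>x y. x \<in> {u..v} \<Longrightarrow> y \<in> {u..v} \<Longrightarrow> H ((x + y) / 2) = (H x + H y) / 2"
    and w: "w \<in> {u..v}"
  shows "H w \<le> 0"
proof -
  obtain p where p: "p \<in> {u..v}" "\<And>x. x \<in> {u..v} \<Longrightarrow> H x \<le> H p"
    using continuous_attains_sup[OF compact_Icc _ cont] uv by auto
  have "H p \<le> 0"
  proof (cases "2 * p \<le> u + v")
    case True
    then have "2 * p - u \<in> {u..v}" using p by auto
    then show ?thesis using mid[of u "2 * p - u"] p(2)[of "2 * p - u"] zero uv by auto
  next
    case False
    then have "2 * p - v \<in> {u..v}" using p by auto
    then show ?thesis using mid[of v "2 * p - v"] p(2)[of "2 * p - v"] zero uv by auto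
  qed
  then show ?thesis using p(2)[OF w] by linarith
qed

text \<open>\<open>H\<close> is \<open>v - u\<close> times the difference between the chord and
  \<open>F\<close>. It is midpoint affine and vanishes at both ends, so the maximum principle
  applies to \<open>H\<close> and to \<open>- H\<close>.\<close>

lemma midpoint_affine_interpolation:
  fixes F :: "real \<Rightarrow> real"
  assumes uwv: "u < w" "w < v" and cont: "continuous_on {u..v} F"
    and mid: "\<And>x y. x \<in> {u..v} \<Longrightarrow> y \<in> {u..v} \<Longrightarrow> F ((x + y) / 2) = (F x + F y) / 2"
  shows "F u * (v - w) + F w * (u - v) + F v * (w - u) = 0"
proof -
  define H where "H = (\<lambda>x. F u * (v - x) + F x * (u - v) + F v * (x - u))"
  have c: "continuous_on {u..v} H" unfolding H_def by (intro continuous_intros cont)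
  have m: "H ((x + y) / 2) = (H x + H y) / 2" if "x \<in> {u..v}" "y \<in> {u..v}" for x y
    unfolding H_def mid[OF that] by (simp add: field_simps)
  have z: "H u = 0" "H v = 0" by (simp_all add: H_def algebra_simps)
  have "H w \<le> 0"
    by (rule midpoint_affine_le_zero[OF _ c z m]) (use uwv in auto)
  moreover have "- H w \<le> 0"
  proof (rule midpoint_affine_le_zero[of u v "\<lambda>x. - H x"])
    show "- H ((x + y) / 2) = (- H x + - H y) / 2" if "x \<in> {u..v}" "y \<in> {u..v}" for x y
      using m[OF that] by simp
  qed (use uwv z in \<open>auto intro!: continuous_on_minus c\<close>)
  ultimately show ?thesis unfolding H_def by linarith
qed

text \<open>The expression is the determinant with rows \<open>(1, u, F u)\<close>,
  \<open>(1, w, F w)\<close>, \<open>(1, v, F v)\<close>. Permuting the points changes at most its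
  sign, so every order reduces to the interpolation case.\<close>

lemma midpoint_affine_collinear:
  fixes F :: "real \<Rightarrow> real"
  assumes I: "is_interval I" and cont: "continuous_on I F"
    and mid: "\<And>x y. x \<in> I \<Longrightarrow> y \<in> I \<Longrightarrow> F ((x + y) / 2) = (F x + F y) / 2"
    and uvw: "u \<in> I" "v \<in> I" "w \<in> I"
  shows "F u * (v - w) + F w * (u - v) + F v * (w - u) = 0"
proof -
  have sub: "{x..y} \<subseteq> I" if "x \<in> I" "y \<in> I" for x y
    by (auto intro: mem_is_interval_1_I[OF I that])
  have key: "F x * (y - z) + F z * (x - y) + F y * (z - x) = 0"
    if "x \<in> I" "y \<in> I" "x < z" "z < y" for x y z
    by (rule midpoint_affine_interpolation[OF that(3,4) continuous_on_subset[OF cont sub[OF that(1,2)]]])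
       (use mid sub[OF that(1,2)] in blast)
  consider "u = v" | "u = w" | "v = w" | "u < w" "w < v" | "v < w" "w < u" | "u < v" "v < w"
    | "w < v" "v < u" | "v < u" "u < w" | "w < u" "u < v" by linarith
  then show ?thesis
  proof cases
    case 4
    then show ?thesis using key[of u v w] uvw by simp
  next
    case 5
    then show ?thesis using key[of v u w] uvw by (simp add: algebra_simps)
  next
    case 6
    then show ?thesis using key[of u w v] uvw by (simp add: algebra_simps)
  next
    case 7
    then show ?thesis using key[of w u v] uvw by (simp add: algebra_simps)
  next
    case 8
    then show ?thesis using key[of v w u] uvw by (simp add: algebra_simps)
  next
    case 9
    then show ?thesis using key[of w v u] uvw by (simp add: algebra_simps)
  qed (simp_all add: algebra_simps)
qed

text \<open>Two functions averaged by the same mean are affinely related, because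
  \<open>\<xi>\<close> composed with the inverse \<open>\<theta>\<close> of \<open>\<psi>\<close> is
  midpoint affine on the interval covered by \<open>\<psi>\<close>. The points 1 and 2 merely fix
  the coefficients.\<close>

lemma quasi_arithmetic_mean_affine:
  fixes \<psi> \<xi> :: "real \<Rightarrow> real" and m :: "real \<Rightarrow> real \<Rightarrow> real"
  assumes \<psi>: "continuous_on {0<..} \<psi>" "inj_on \<psi> {0<..}" and \<xi>: "continuous_on {0<..} \<xi>"
    and m: "\<And>x y. x > 0 \<Longrightarrow> y > 0 \<Longrightarrow> m x y > 0"
    and m\<psi>: "\<And>x y. x > 0 \<Longrightarrow> y > 0 \<Longrightarrow> \<psi> (m x y) = (\<psi> x + \<psi> y) / 2"
    and m\<xi>: "\<And>x y. x > 0 \<Longrightarrow> y > 0 \<Longrightarrow> \<xi> (m x y) = (\<xi> x + \<xi> y) / 2"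
    and t: "t > 0"
  shows "\<xi> t = (\<xi> 2 - \<xi> 1) / (\<psi> 2 - \<psi> 1) * (\<psi> t - \<psi> 1) + \<xi> 1"
proof -
  obtain \<theta> where \<theta>: "homeomorphism {0<..} (\<psi> ` {0<..}) \<psi> \<theta>"
    using injective_into_1d_eq_homeomorphism[OF \<psi>(1)] \<psi>(2)
    by (auto simp: convex_imp_path_connected)
  define I where "I = \<psi> ` {0<..}"
  have "connected I" unfolding I_def by (rule connected_continuous_image[OF \<psi>(1)]) simp
  then have I: "is_interval I" by (simp add: is_interval_connected_1)
  have \<theta>I: "\<theta> u > 0" "\<psi> (\<theta> u) = u" if "u \<in> I" for u
    using \<theta> that by (auto simp: homeomorphism_def I_def)
  have \<theta>\<psi>: "\<theta> (\<psi> x) = x" if "x > 0" for x using \<theta> that by (auto simp: homeomorphism_def)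
  have cont: "continuous_on I (\<lambda>u. \<xi> (\<theta> u))"
    by (rule continuous_on_compose2[OF \<xi>]) (use \<theta> \<theta>I in \<open>auto simp: homeomorphism_def I_def\<close>)
  have mid: "\<xi> (\<theta> ((u + v) / 2)) = (\<xi> (\<theta> u) + \<xi> (\<theta> v)) / 2" if "u \<in> I" "v \<in> I" for u v
  proof -
    have "\<psi> (m (\<theta> u) (\<theta> v)) = (u + v) / 2" using m\<psi> \<theta>I that by simp
    then have "\<theta> ((u + v) / 2) = m (\<theta> u) (\<theta> v)" using \<theta>\<psi> m \<theta>I that by metis
    then show ?thesis using m\<xi> \<theta>I that by simp
  qed
  have "\<xi> (\<theta> (\<psi> 1)) * (\<psi> 2 - \<psi> t) + \<xi> (\<theta> (\<psi> t)) * (\<psi> 1 - \<psi> 2) + \<xi> (\<theta> (\<psi> 2)) * (\<psi> t - \<psi> 1) = 0"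
    by (rule midpoint_affine_collinear[OF I cont mid]) (use t in \<open>auto simp: I_def\<close>)
  then have e: "\<xi> 1 * (\<psi> 2 - \<psi> t) + \<xi> t * (\<psi> 1 - \<psi> 2) + \<xi> 2 * (\<psi> t - \<psi> 1) = 0"
    using \<theta>\<psi> t by simp
  have "\<psi> 2 \<noteq> \<psi> 1" using inj_onD[OF \<psi>(2), of 2 1] by auto
  then show ?thesis using e by (simp add: divide_simps) (simp add: algebra_simps)
qed

text \<open>By homogeneity \<open>\<psi>\<close> and each of its dilates generate the same mean, so
  \<open>quasi_arithmetic_mean_affine\<close> relates them; \<open>A s\<close> is the slope.\<close>

lemma homogeneous_quasi_arithmetic_mean:
  fixes \<psi> :: "real \<Rightarrow> real" and m :: "real \<Rightarrow> real \<Rightarrow> real"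
  assumes \<psi>: "continuous_on {0<..} \<psi>" "inj_on \<psi> {0<..}"
    and m: "\<And>x y. x > 0 \<Longrightarrow> y > 0 \<Longrightarrow> m x y > 0"
    and m\<psi>: "\<And>x y. x > 0 \<Longrightarrow> y > 0 \<Longrightarrow> \<psi> (m x y) = (\<psi> x + \<psi> y) / 2"
    and hom: "\<And>s x y. s > 0 \<Longrightarrow> x > 0 \<Longrightarrow> y > 0 \<Longrightarrow> m (s * x) (s * y) = s * m x y"
  shows "(\<forall>t>0. m 1 t = sqrt t) \<or> (\<exists>s>0. \<exists>B. \<forall>t>0. \<psi> (s * t) = 2 * \<psi> t + B)"
proof -
  define A where "A = (\<lambda>s. (\<psi> (s * 2) - \<psi> s) / (\<psi> 2 - \<psi> 1))"
  have d0: "\<psi> 2 - \<psi> 1 \<noteq> 0" using inj_onD[OF \<psi>(2), of 2 1] by auto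
  have cs: "continuous_on {0<..} (\<lambda>x. \<psi> (s * x))" if "s > 0" for s
    by (rule continuous_on_compose2[OF \<psi>(1)]) (use that in \<open>auto intro!: continuous_intros\<close>)
  have aff: "\<psi> (s * t) = A s * (\<psi> t - \<psi> 1) + \<psi> s" if "s > 0" "t > 0" for s t
  proof -
    have "\<psi> (s * t) = (\<psi> (s * 2) - \<psi> (s * 1)) / (\<psi> 2 - \<psi> 1) * (\<psi> t - \<psi> 1) + \<psi> (s * 1)"
      by (rule quasi_arithmetic_mean_affine[OF \<psi> cs[OF that(1)] m m\<psi> _ that(2)])
         (use that m\<psi> hom[symmetric] in simp_all)
    then show ?thesis by (simp add: A_def)
  qed
  have mult: "A (s * t) = A s * A t" if "s > 0" "t > 0" for s t
  proof -
    have "\<psi> (s * t * 2) - \<psi> (s * t) = A s * (\<psi> (t * 2) - \<psi> t)"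
      using aff[of s "t * 2"] aff[of s t] that by (simp add: algebra_simps)
    then show ?thesis using d0 by (simp add: A_def)
  qed
  have A1: "A 1 = 1" using d0 by (simp add: A_def)
  have A0: "A s \<noteq> 0" if "s > 0" for s
    using inj_onD[OF \<psi>(2), of "s * 2" s] d0 that by (auto simp: A_def)
  have Apos: "A s > 0" if "s > 0" for s
  proof -
    have "A s = A (sqrt s) * A (sqrt s)" using mult[of "sqrt s" "sqrt s"] that by simp
    then show ?thesis using A0[of "sqrt s"] that by (simp add: zero_less_mult_iff) linarith
  qed
  have Acont: "continuous_on {0<..} A"
    unfolding A_def
    by (intro continuous_intros \<psi>(1) continuous_on_compose2[OF \<psi>(1)]) (use d0 in auto)
  show ?thesis
  proof (cases "\<forall>s>0. A s = 1")
    case True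
    have "m 1 t = sqrt t" if "t > 0" for t
    proof -
      \<comment> \<open>With slope 1 the affine law at this product says that
        \<open>\<psi> (sqrt t)\<close> is the midpoint of \<open>\<psi> 1\<close> and
        \<open>\<psi> t\<close>.\<close>
      have "\<psi> (sqrt t * sqrt t) = (\<psi> (sqrt t) - \<psi> 1) + \<psi> (sqrt t)"
        using aff[of "sqrt t" "sqrt t"] True that by simp
      then have "\<psi> (sqrt t) = \<psi> (m 1 t)" using m\<psi>[of 1 t] that by simp
      then show ?thesis using \<psi>(2) m[of 1 t] that by (auto simp: inj_on_def)
    qed
    then show ?thesis by blast
  next
    case False
    then obtain s0 where s0: "s0 > 0" "A s0 \<noteq> 1" by blast
    \<comment> \<open>One of \<open>A s0\<close> and \<open>A (1 / s0)\<close> exceeds 1. Its powers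
      pass 2, and the value 2 itself is met because \<open>A\<close> is continuous with
      \<open>A 1 = 1\<close>.\<close>
    have "\<exists>s>0. A s > 1"
    proof (cases "A s0 > 1")
      case False
      have "A s0 * A (1 / s0) = 1" using mult[of s0 "1 / s0"] s0 A1 by simp
      moreover have "A s0 < 1" using False s0 by linarith
      ultimately have "A (1 / s0) > 1"
        using Apos[of s0] s0 by (metis mult_less_cancel_left_pos mult.right_neutral)
      then show ?thesis using s0 by (intro exI[of _ "1 / s0"]) simp
    qed (use s0 in blast)
    then obtain r where r: "r > 0" "A r > 1" by blast
    have pow: "A (r ^ n) = A r ^ n" for n
      by (induction n) (use r mult A1 in auto)
    obtain n where n: "A r ^ n > 2" using real_arch_pow[OF r(2)] by blast
    have "connected (A ` {0<..})" by (rule connected_continuous_image[OF Acont]) simp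
    then have "is_interval (A ` {0<..})" by (simp add: is_interval_connected_1)
    moreover have "A 1 \<in> A ` {0<..}" "A (r ^ n) \<in> A ` {0<..}" using r by auto
    ultimately have "2 \<in> A ` {0<..}"
      unfolding is_interval_1 using A1 n pow by (metis less_imp_le one_le_numeral)
    then obtain s where s: "s > 0" "A s = 2" by auto
    have "\<forall>t>0. \<psi> (s * t) = 2 * \<psi> t + (\<psi> s - 2 * \<psi> 1)"
      using aff[of s] s by (simp add: algebra_simps)
    then show ?thesis using s(1) by blast
  qed
qed

text \<open>For the derivation \<open>\<delta> = [z, _]\<close>, the Leibniz rule gives \<open>\<delta> (\<delta> (x\<^sup>2)) = 2 (\<delta> x)\<^sup>2\<close> once
  \<open>\<delta> (\<delta> x) = 0\<close>, and \<open>\<delta> x\<close> is skew-adjoint.\<close>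

lemma selfadjoint_double_commutator_commute:
  fixes z x :: "'a::cstar_algebra"
  assumes dc: "\<And>x. selfadjoint x \<Longrightarrow> z * z * x - 2 *\<^sub>R (z * x * z) + x * z * z = 0"
    and z: "selfadjoint z" and x: "selfadjoint x"
  shows "z * x = x * z"
proof -
  let ?d = "z * x - x * z"
  \<comment> \<open>The hypothesis at \<open>x\<close>, multiplied by \<open>x\<close> from the
    right or from the left, eliminates \<open>z * z * x * x\<close> and \<open>x * x * z * z\<close>
    from the hypothesis at \<open>x * x\<close>. What remains is twice the square of the
    commutator.\<close>
  have e: "z * z * x = 2 *\<^sub>R (z * x * z) - x * z * z" using dc[OF x] by (simp add: algebra_simps)
  have e2: "x * z * z = 2 *\<^sub>R (z * x * z) - z * z * x" using e by simp
  have "z * z * x * x = 2 *\<^sub>R (z * x * z * x) - x * z * z * x"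
    using arg_cong[OF e, of "\<lambda>w. w * x"] by (simp add: left_diff_distrib)
  moreover have "x * (x * z * z) = 2 *\<^sub>R (x * z * x * z) - x * z * z * x"
    using arg_cong[OF e2, of "\<lambda>w. x * w"] by (simp add: right_diff_distrib mult.assoc)
  moreover
  have "selfadjoint (x * x)" using selfadjoint_power[OF x, of 2] by (simp add: power2_eq_square)
  from dc[OF this] have "z * z * x * x - 2 *\<^sub>R (z * x * x * z) + x * (x * z * z) = 0"
    by (simp add: mult.assoc)
  ultimately have "2 *\<^sub>R (z * x * z * x) - x * z * z * x - 2 *\<^sub>R (z * x * x * z)
    + (2 *\<^sub>R (x * z * x * z) - x * z * z * x) = 0" by simp
  then have "2 *\<^sub>R (?d * ?d) = 0"
    by (simp add: left_diff_distrib right_diff_distrib scaleR_2 mult.assoc) (simp add: algebra_simps)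
  then have "?d * ?d = 0" by simp
  moreover have "cstar ?d = - ?d"
    using z x by (simp add: cstar_diff cstar_mult selfadjoint_def)
  ultimately have "norm (cstar ?d * ?d) = 0" by (simp only: mult_minus_left) simp
  then show ?thesis by (simp add: cstar_identity)
qed

lemma commutative_if_selfadjoint_commute:
  fixes x y :: "'a::cstar_algebra"
  assumes comm: "\<And>z x :: 'a. selfadjoint z \<Longrightarrow> selfadjoint x \<Longrightarrow> z * x = x * z"
  shows "x * y = y * x"
proof -
  have dec: "\<exists>h k. selfadjoint h \<and> selfadjoint k \<and> x = h + cscale \<i> k" for x :: 'a
  proof (intro exI conjI)
    let ?h = "(1/2) *\<^sub>R (x + cstar x)" and ?k = "cscale (- \<i> / 2) (x - cstar x)"
    show "selfadjoint ?h"
      by (simp add: selfadjoint_def cstar_scaleR cstar_add cstar_cstar add.commute)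
    show "selfadjoint ?k"
      by (simp add: selfadjoint_def cstar_cscale cstar_diff cstar_cstar cscale_diff_right cscale_minus_left)
    have "cscale \<i> ?k = (1/2) *\<^sub>R (x - cstar x)"
      using cscale_of_real[of "1/2" "x - cstar x"] by (simp add: cscale_cscale)
    then show "x = ?h + cscale \<i> ?k"
      by (simp flip: scaleR_add_right)
  qed
  obtain h k where x: "selfadjoint h" "selfadjoint k" "x = h + cscale \<i> k" using dec by blast
  obtain h' k' where y: "selfadjoint h'" "selfadjoint k'" "y = h' + cscale \<i> k'" using dec by blast
  note c = comm[OF x(1) y(1)] comm[OF x(1) y(2)] comm[OF x(2) y(1)] comm[OF x(2) y(2)]
  show ?thesis unfolding x y using c
    by (simp add: distrib_left distrib_right cscale_mult_left[symmetric] cscale_mult_right[symmetric] cscale_add_right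
        algebra_simps)
qed

section \<open>Means generated by the geometric mean\<close>

lemma ka_mean_scalar:
  assumes "x > 0"
  shows "ka_mean f (x *\<^sub>R 1) (y *\<^sub>R 1) = (x * f (y / x)) *\<^sub>R (1::'a::cstar_algebra)"
proof -
  have 1: "inverse (sqrt x) * y * inverse (sqrt x) = y / x" "sqrt x * f (y / x) * sqrt x = x * f (y / x)"
    using assms by (simp_all add: field_simps)
  have "ka_mean f (x *\<^sub>R 1) (y *\<^sub>R 1)
    = (sqrt x * f (inverse (sqrt x) * y * inverse (sqrt x)) * sqrt x) *\<^sub>R (1::'a)"
    unfolding ka_mean_def Let_def cfc_scalar
    by (simp add: cfc_scalar mult_ac)
  then show ?thesis unfolding 1 .
qed

lemma scalar_pos_def_cone: "x > 0 \<Longrightarrow> x *\<^sub>R 1 \<in> pos_def_cone"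
  by (simp add: pos_def_cone_iff selfadjoint_intros rspectrum_scalar)

text \<open>The case \<open>A s = 2\<close>, which will force commutativity. \<open>\<theta>\<close>
  inverts \<open>\<phi>\<close> only on the range, and openness of the range lets small
  perturbations of its scalars stay inside. The parameter \<open>itself\<close> just ties the type
  \<open>'a\<close> to the locale.\<close>

locale quasi_geometric =
  fixes g \<phi> \<theta> :: "real \<Rightarrow> real" and s c :: real and itself :: "'a::cstar_algebra itself"
  assumes \<phi>: "continuous_on {0<..} \<phi>" and \<phi>_pos: "\<And>t. t > 0 \<Longrightarrow> \<phi> t > 0"
    and open_range: "open (\<phi> ` {0<..})"
    and \<theta>: "continuous_on (\<phi> ` {0<..}) \<theta>"
    and \<theta>_pos: "\<And>u. u \<in> \<phi> ` {0<..} \<Longrightarrow> \<theta> u > 0"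
    and \<phi>\<theta>: "\<And>u. u \<in> \<phi> ` {0<..} \<Longrightarrow> \<phi> (\<theta> u) = u"
    and s: "s > 0" and c: "c > 0" and \<phi>_scale: "\<And>t. t > 0 \<Longrightarrow> \<phi> (s * t) = c * (\<phi> t)\<^sup>2"
    and quasi: "\<And>a b :: 'a. a \<in> pos_def_cone \<Longrightarrow> b \<in> pos_def_cone \<Longrightarrow>
      ka_mean g a b = cfc \<theta> (ka_mean sqrt (cfc \<phi> a) (cfc \<phi> b))"
begin

text \<open>Lifts elements with spectrum in the range back to the cone. The third claim is the
  point: dilating the preimage of \<open>Y\<close> by \<open>s\<close> squares \<open>Y\<close> up
  to the factor \<open>c\<close>.\<close>

lemma cfc_\<theta>:
  fixes Y :: 'a
  assumes sa: "selfadjoint Y" and Y: "rspectrum Y \<subseteq> \<phi> ` {0<..}"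
  shows "cfc \<theta> Y \<in> pos_def_cone" and "cfc \<phi> (cfc \<theta> Y) = Y"
    and "cfc \<phi> (s *\<^sub>R cfc \<theta> Y) = c *\<^sub>R (Y * Y)"
proof -
  have cont: "continuous_on (rspectrum Y) \<theta>" by (rule continuous_on_subset[OF \<theta> Y])
  show pd: "cfc \<theta> Y \<in> pos_def_cone"
    using rspectrum_cfc[OF sa cont] cfc_selfadjoint[OF sa cont] \<theta>_pos Y
    by (force simp: pos_def_cone_iff)
  have "cfc \<phi> (cfc \<theta> Y) = cfc (\<lambda>t. \<phi> (\<theta> t)) Y"
    by (rule cfc_comp[OF sa cont], rule continuous_on_subset[OF \<phi>]) (use \<theta>_pos Y in auto)
  also have "\<dots> = cfc (\<lambda>t. t) Y" by (rule cfc_cong) (use \<phi>\<theta> Y in auto)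
  finally show Y': "cfc \<phi> (cfc \<theta> Y) = Y" by (simp add: cfc_id sa)
  let ?a = "cfc \<theta> Y"
  have "cfc \<phi> (s *\<^sub>R ?a) = cfc (\<lambda>t. \<phi> (s * t)) ?a" by (rule cfc_of_scaleR[OF pd s \<phi>])
  also have "\<dots> = cfc (\<lambda>t. c * (\<phi> t * \<phi> t)) ?a"
    by (rule cfc_cong_pos[OF pd]) (simp add: \<phi>_scale power2_eq_square)
  also have "\<dots> = c *\<^sub>R cfc (\<lambda>t. \<phi> t * \<phi> t) ?a"
    using continuous_on_subset[OF \<phi> pos_def_cone_rspectrum[OF pd]]
    by (intro cfc_scaleR pos_def_cone_selfadjoint[OF pd] continuous_intros)
  also have "cfc (\<lambda>t. \<phi> t * \<phi> t) ?a = Y * Y" using cfc_mult_pos[OF pd \<phi> \<phi>] Y' by simp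
  finally show "cfc \<phi> (s *\<^sub>R ?a) = c *\<^sub>R (Y * Y)" .
qed

text \<open>The conclusion says that \<open>P * G\<close> is normal.\<close>

lemma normal_product:
  fixes G P Q :: 'a
  assumes G: "G \<in> pos_def_cone" "rspectrum G \<subseteq> \<phi> ` {0<..}"
    and P: "P \<in> pos_def_cone" and Q: "Q = cfc inverse P" "rspectrum Q \<subseteq> \<phi> ` {0<..}"
    and GPG: "rspectrum (G * P * G) \<subseteq> \<phi> ` {0<..}"
    and y: "rspectrum (ka_mean sqrt (c *\<^sub>R (Q * Q)) (c *\<^sub>R (G * P * G * (G * P * G)))) \<subseteq> \<phi> ` {0<..}"
  shows "G * P * P * G = P * G * G * P"
proof -
  have Qpd: "Q \<in> pos_def_cone" unfolding Q by (rule cfc_inverse_pos[OF P])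
  have QP: "Q * P = 1" unfolding Q by (rule cfc_inverse_mult[OF P])
  have Qi: "cfc inverse Q = P" by (rule cfc_inverse_eqI[OF Qpd QP])
  have Vpd: "G * P * G \<in> pos_def_cone" by (rule pos_def_cone_conj[OF G(1) P])
  \<comment> \<open>\<open>\<phi>\<close> maps these to \<open>Q\<close> and
    \<open>G * P * G\<close>, whose geometric mean is \<open>G\<close> by the converse of the
    Riccati equation.\<close>
  let ?a = "cfc \<theta> Q" and ?b = "cfc \<theta> (G * P * G)"
  let ?U = "c *\<^sub>R (Q * Q)" and ?V = "c *\<^sub>R (G * P * G * (G * P * G))"
  let ?y = "ka_mean sqrt ?U ?V"
  note a = cfc_\<theta>[OF pos_def_cone_selfadjoint[OF Qpd] Q(2)]
  note b = cfc_\<theta>[OF pos_def_cone_selfadjoint[OF Vpd] GPG]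
  have U: "?U \<in> pos_def_cone" by (intro pos_def_cone_scaleR pos_def_cone_square Qpd c)
  have V: "?V \<in> pos_def_cone" by (intro pos_def_cone_scaleR pos_def_cone_square Vpd c)
  have ypd: "?y \<in> pos_def_cone"
    by (rule ka_mean_pos[OF U V]) (auto intro!: continuous_intros)
  have "ka_mean sqrt Q (G * P * G) = G"
    using geometric_mean_eqI[OF Qpd G(1)] unfolding Qi .
  then have "ka_mean g ?a ?b = cfc \<theta> G" using quasi[OF a(1) b(1)] unfolding a(2) b(2) by simp
  \<comment> \<open>Homogeneity evaluates the mean of the dilated pair in two ways: as the dilate of
    \<open>cfc \<theta> G\<close>, and through the squares of \<open>Q\<close> and
    \<open>G * P * G\<close>.\<close>
  then have "s *\<^sub>R cfc \<theta> G = ka_mean g (s *\<^sub>R ?a) (s *\<^sub>R ?b)"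
    using ka_mean_scaleR[OF a(1) b(1) s] by simp
  also have "\<dots> = cfc \<theta> ?y"
    using quasi[OF pos_def_cone_scaleR[OF a(1) s] pos_def_cone_scaleR[OF b(1) s]]
    unfolding a(3) b(3) .
  finally have "cfc \<phi> (s *\<^sub>R cfc \<theta> G) = cfc \<phi> (cfc \<theta> ?y)" by simp
  then have yG: "?y = c *\<^sub>R (G * G)"
    unfolding cfc_\<theta>(2)[OF pos_def_cone_selfadjoint[OF ypd] y]
      cfc_\<theta>(3)[OF pos_def_cone_selfadjoint[OF G(1)] G(2)] by simp
  have "?U * ((1/c) *\<^sub>R (P * P)) = Q * (Q * P) * P" using c by (simp add: mult.assoc)
  then have "cfc inverse ?U = (1/c) *\<^sub>R (P * P)"
    by (intro cfc_inverse_eqI[OF U]) (simp add: QP)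
  \<comment> \<open>The Riccati equation for \<open>?y\<close> reads
    \<open>c G G P P G G = c (G P G) (G P G)\<close>; one factor \<open>G\<close> then cancels on
    each side.\<close>
  with geometric_mean_riccati[OF U V]
  have "c *\<^sub>R (G * G) * ((1/c) *\<^sub>R (P * P)) * (c *\<^sub>R (G * G)) = ?V" unfolding yG by simp
  then have "c *\<^sub>R (G * (G * P * P * G) * G) = c *\<^sub>R (G * (P * G * G * P) * G)"
    using c by (simp add: mult.assoc)
  then have e: "G * (G * P * P * G) * G = G * (P * G * G * P) * G" using c by simp
  let ?H = "cfc inverse G"
  have "x = ?H * (G * x * G) * ?H" for x
  proof -
    have "?H * (G * x * G) * ?H = (?H * G) * x * (G * ?H)" by (simp add: mult.assoc)
    then show ?thesis by (simp add: cfc_inverse_mult[OF G(1)])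
  qed
  then show ?thesis using e by metis
qed

text \<open>All spectral hypotheses of \<open>normal_product\<close> concern elements that tend to
  positive scalars in the open range, so they hold eventually.\<close>

lemma eventually_normal_product:
  fixes Z X :: 'a
  assumes Z: "selfadjoint Z" and X: "selfadjoint X"
    and \<kappa>: "\<kappa> \<in> \<phi> ` {0<..}" and \<epsilon>: "\<epsilon> \<longlonglongrightarrow> 0"
  shows "\<forall>\<^sub>F n in sequentially.
    (1 + \<epsilon> n *\<^sub>R Z) * (1 + \<epsilon> n *\<^sub>R X) * (1 + \<epsilon> n *\<^sub>R X) * (1 + \<epsilon> n *\<^sub>R Z)
    = (1 + \<epsilon> n *\<^sub>R X) * (1 + \<epsilon> n *\<^sub>R Z) * (1 + \<epsilon> n *\<^sub>R Z) * (1 + \<epsilon> n *\<^sub>R X)"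
proof -
  have \<kappa>0: "\<kappa> > 0" using \<kappa> \<phi>_pos by auto
  define G where "G = (\<lambda>n. \<kappa> *\<^sub>R (1 + \<epsilon> n *\<^sub>R Z))"
  \<comment> \<open>Centring \<open>P\<close> at the inverse of \<open>\<kappa>\<close> makes both
    \<open>Q\<close> and \<open>G * P * G\<close> tend to \<open>\<kappa>\<close>; the scalar
    factors cancel from the conclusion.\<close>
  define P where "P = (\<lambda>n. inverse \<kappa> *\<^sub>R (1 + \<epsilon> n *\<^sub>R X))"
  define Q where "Q = (\<lambda>n. cfc inverse (P n))"
  define V0 where "V0 = (\<lambda>n. G n * P n * G n)"
  define U where "U = (\<lambda>n. c *\<^sub>R (Q n * Q n))"
  define V where "V = (\<lambda>n. c *\<^sub>R (V0 n * V0 n))"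
  define y where "y = (\<lambda>n. ka_mean sqrt (U n) (V n))"
  define \<kappa>' where "\<kappa>' = c * (\<kappa> * \<kappa>)"
  have \<kappa>'0: "\<kappa>' > 0" using \<kappa>0 c by (simp add: \<kappa>'_def)
  obtain t where t: "t > 0" "\<kappa> = \<phi> t" using \<kappa> by auto
  \<comment> \<open>\<open>\<kappa>'\<close> is the limit of the mean \<open>y\<close>; the squaring
    law is what places it in the range.\<close>
  have "\<kappa>' = \<phi> (s * t)" using \<phi>_scale[OF t(1)] t by (simp add: \<kappa>'_def power2_eq_square)
  then have \<kappa>': "\<kappa>' \<in> \<phi> ` {0<..}" using s t by auto
  have pdI: "\<forall>\<^sub>F n in sequentially. Y n \<in> pos_def_cone"
    if "Y \<longlonglongrightarrow> \<mu> *\<^sub>R 1" "\<mu> > 0" "\<forall>\<^sub>F n in sequentially. selfadjoint (Y n)"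
    for Y :: "nat \<Rightarrow> 'a" and \<mu>
  proof -
    have "\<forall>\<^sub>F n in sequentially. rspectrum (Y n) \<subseteq> {0<..}"
      by (rule eventually_rspectrum_subset[OF that(1)]) (use that(2) in auto)
    then show ?thesis using that(3) by eventually_elim (simp add: pos_def_cone_iff)
  qed
  have pd_sa: "\<forall>\<^sub>F n in sequentially. selfadjoint (Y n)"
    if "\<forall>\<^sub>F n in sequentially. Y n \<in> pos_def_cone" for Y :: "nat \<Rightarrow> 'a"
    using that by eventually_elim (rule pos_def_cone_selfadjoint)
  have inv: "continuous_on {0<..} (inverse :: real \<Rightarrow> real)" by (intro continuous_intros) auto
  have "G \<longlonglongrightarrow> \<kappa> *\<^sub>R (1 + 0 *\<^sub>R Z)" unfolding G_def by (intro tendsto_intros \<epsilon>)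
  then have Glim: "G \<longlonglongrightarrow> \<kappa> *\<^sub>R 1" by simp
  have "P \<longlonglongrightarrow> inverse \<kappa> *\<^sub>R (1 + 0 *\<^sub>R X)" unfolding P_def by (intro tendsto_intros \<epsilon>)
  then have Plim: "P \<longlonglongrightarrow> inverse \<kappa> *\<^sub>R 1" by simp
  have saG: "selfadjoint (G n)" and saP: "selfadjoint (P n)" for n
    unfolding G_def P_def by (intro selfadjoint_intros Z X)+
  have Gpd: "\<forall>\<^sub>F n in sequentially. G n \<in> pos_def_cone"
    by (rule pdI[OF Glim \<kappa>0]) (simp add: saG)
  have Ppd: "\<forall>\<^sub>F n in sequentially. P n \<in> pos_def_cone"
    by (rule pdI[OF Plim]) (use \<kappa>0 in \<open>simp_all add: saP\<close>)
  have Qlim: "Q \<longlonglongrightarrow> \<kappa> *\<^sub>R 1"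
    using tendsto_cfc_scalar[OF Plim _ open_greaterThan _ inv] \<kappa>0 saP unfolding Q_def by simp
  have Qpd: "\<forall>\<^sub>F n in sequentially. Q n \<in> pos_def_cone"
    using Ppd unfolding Q_def by eventually_elim (rule cfc_inverse_pos)
  have "V0 \<longlonglongrightarrow> \<kappa> *\<^sub>R 1 * (inverse \<kappa> *\<^sub>R 1) * (\<kappa> *\<^sub>R 1)"
    unfolding V0_def by (intro tendsto_intros Glim Plim)
  then have V0lim: "V0 \<longlonglongrightarrow> \<kappa> *\<^sub>R 1" using \<kappa>0 by simp
  have V0pd: "\<forall>\<^sub>F n in sequentially. V0 n \<in> pos_def_cone"
    using Gpd Ppd unfolding V0_def by eventually_elim (rule pos_def_cone_conj)
  have "U \<longlonglongrightarrow> c *\<^sub>R (\<kappa> *\<^sub>R 1 * (\<kappa> *\<^sub>R 1))" unfolding U_def by (intro tendsto_intros Qlim)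
  then have Ulim: "U \<longlonglongrightarrow> \<kappa>' *\<^sub>R 1" by (simp add: \<kappa>'_def)
  have Upd: "\<forall>\<^sub>F n in sequentially. U n \<in> pos_def_cone"
    using Qpd unfolding U_def
    by eventually_elim (intro pos_def_cone_scaleR pos_def_cone_square c)
  have "V \<longlonglongrightarrow> c *\<^sub>R (\<kappa> *\<^sub>R 1 * (\<kappa> *\<^sub>R 1))" unfolding V_def by (intro tendsto_intros V0lim)
  then have Vlim: "V \<longlonglongrightarrow> \<kappa>' *\<^sub>R 1" by (simp add: \<kappa>'_def)
  have Vpd: "\<forall>\<^sub>F n in sequentially. V n \<in> pos_def_cone"
    using V0pd unfolding V_def
    by eventually_elim (intro pos_def_cone_scaleR pos_def_cone_square c)
  have ylim: "y \<longlonglongrightarrow> \<kappa>' *\<^sub>R 1"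
  proof -
    have csqrt: "continuous_on {0<..} sqrt" by (intro continuous_intros)
    have cisqrt: "continuous_on {0<..} (\<lambda>t. inverse (sqrt t))" by (intro continuous_intros) auto
    define S where "S = (\<lambda>n. cfc sqrt (U n))"
    define T where "T = (\<lambda>n. cfc (\<lambda>t. inverse (sqrt t)) (U n))"
    define W where "W = (\<lambda>n. T n * V n * T n)"
    have S: "S \<longlonglongrightarrow> sqrt \<kappa>' *\<^sub>R 1"
      unfolding S_def
      by (rule tendsto_cfc_scalar[OF Ulim pd_sa[OF Upd] open_greaterThan _ csqrt]) (simp add: \<kappa>'0)
    have T: "T \<longlonglongrightarrow> inverse (sqrt \<kappa>') *\<^sub>R 1"
      unfolding T_def
      by (rule tendsto_cfc_scalar[OF Ulim pd_sa[OF Upd] open_greaterThan _ cisqrt]) (simp add: \<kappa>'0)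
    have "W \<longlonglongrightarrow> inverse (sqrt \<kappa>') *\<^sub>R 1 * (\<kappa>' *\<^sub>R 1) * (inverse (sqrt \<kappa>') *\<^sub>R 1)"
      unfolding W_def by (intro tendsto_intros T Vlim)
    moreover have "inverse (sqrt \<kappa>') * (\<kappa>' * inverse (sqrt \<kappa>')) = 1"
      using \<kappa>'0 by (simp add: field_simps)
    ultimately have W: "W \<longlonglongrightarrow> 1 *\<^sub>R 1" by (simp add: mult_ac)
    have Wpd: "\<forall>\<^sub>F n in sequentially. W n \<in> pos_def_cone"
      using Upd Vpd unfolding W_def T_def by eventually_elim (rule irt_conj_pos)
    have R: "(\<lambda>n. cfc sqrt (W n)) \<longlonglongrightarrow> sqrt 1 *\<^sub>R 1"
      by (rule tendsto_cfc_scalar[OF W pd_sa[OF Wpd] open_greaterThan _ csqrt]) simp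
    have "(\<lambda>n. S n * cfc sqrt (W n) * S n) \<longlonglongrightarrow> sqrt \<kappa>' *\<^sub>R 1 * (sqrt 1 *\<^sub>R 1) * (sqrt \<kappa>' *\<^sub>R 1)"
      by (intro tendsto_intros S R)
    then show ?thesis
      using \<kappa>'0 unfolding y_def ka_mean_def Let_def W_def S_def T_def by simp
  qed
  note sp = eventually_rspectrum_subset[OF _ open_range]
  show ?thesis
    using Gpd Ppd sp[OF Glim \<kappa>] sp[OF Qlim \<kappa>] sp[OF V0lim \<kappa>] sp[OF ylim \<kappa>']
  proof eventually_elim
    case (elim n)
    have "G n * P n * P n * G n = P n * G n * G n * P n"
      by (rule normal_product[OF elim(1) elim(3) elim(2) refl])
         (use elim in \<open>simp_all add: Q_def V0_def U_def V_def y_def\<close>)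
    then show ?case using \<kappa>0 unfolding G_def P_def by simp
  qed
qed

text \<open>Subtracting the normality identities at \<open>X\<close> and \<open>- X\<close> keeps
  twice the part odd in \<open>h\<close>, which is exactly \<open>k k h - 2 k h k + h k k\<close>. A
  single \<open>n\<close> for which both identities hold suffices, since \<open>e\<close> enters
  only as the factor \<open>e * e * e\<close>.\<close>

lemma double_commutator_zero:
  fixes Z X :: 'a
  assumes Z: "selfadjoint Z" and X: "selfadjoint X"
  shows "Z * Z * X - 2 *\<^sub>R (Z * X * Z) + X * Z * Z = 0"
proof -
  define \<epsilon> where "\<epsilon> = (\<lambda>n. inverse (real (Suc n)))"
  have \<epsilon>: "\<epsilon> \<longlonglongrightarrow> 0" unfolding \<epsilon>_def by (rule LIMSEQ_inverse_real_of_nat)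
  have \<kappa>: "\<phi> 1 \<in> \<phi> ` {0<..}" by simp
  have "\<exists>n. (1 + \<epsilon> n *\<^sub>R Z) * (1 + \<epsilon> n *\<^sub>R X) * (1 + \<epsilon> n *\<^sub>R X) * (1 + \<epsilon> n *\<^sub>R Z)
      = (1 + \<epsilon> n *\<^sub>R X) * (1 + \<epsilon> n *\<^sub>R Z) * (1 + \<epsilon> n *\<^sub>R Z) * (1 + \<epsilon> n *\<^sub>R X) \<and>
    (1 + \<epsilon> n *\<^sub>R Z) * (1 + \<epsilon> n *\<^sub>R (- X)) * (1 + \<epsilon> n *\<^sub>R (- X)) * (1 + \<epsilon> n *\<^sub>R Z)
      = (1 + \<epsilon> n *\<^sub>R (- X)) * (1 + \<epsilon> n *\<^sub>R Z) * (1 + \<epsilon> n *\<^sub>R Z) * (1 + \<epsilon> n *\<^sub>R (- X))"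
    by (rule eventually_happens'[OF sequentially_bot])
       (rule eventually_conj[OF eventually_normal_product[OF Z X \<kappa> \<epsilon>]
           eventually_normal_product[OF Z selfadjoint_minus[OF X] \<kappa> \<epsilon>]])
  then obtain n where n: "(1 + \<epsilon> n *\<^sub>R Z) * (1 + \<epsilon> n *\<^sub>R X) * (1 + \<epsilon> n *\<^sub>R X) * (1 + \<epsilon> n *\<^sub>R Z)
      = (1 + \<epsilon> n *\<^sub>R X) * (1 + \<epsilon> n *\<^sub>R Z) * (1 + \<epsilon> n *\<^sub>R Z) * (1 + \<epsilon> n *\<^sub>R X)"
    "(1 + \<epsilon> n *\<^sub>R Z) * (1 + \<epsilon> n *\<^sub>R (- X)) * (1 + \<epsilon> n *\<^sub>R (- X)) * (1 + \<epsilon> n *\<^sub>R Z)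
      = (1 + \<epsilon> n *\<^sub>R (- X)) * (1 + \<epsilon> n *\<^sub>R Z) * (1 + \<epsilon> n *\<^sub>R Z) * (1 + \<epsilon> n *\<^sub>R (- X))"
    by blast
  define e where "e = \<epsilon> n"
  have e: "e \<noteq> 0" by (simp add: e_def \<epsilon>_def)
  define h where "h = e *\<^sub>R X"
  define k where "k = e *\<^sub>R Z"
  have p: "(1 + k) * (1 + h) * (1 + h) * (1 + k) = (1 + h) * (1 + k) * (1 + k) * (1 + h)"
    using n(1) by (simp add: h_def k_def e_def)
  have q: "(1 + k) * (1 - h) * (1 - h) * (1 + k) = (1 - h) * (1 + k) * (1 + k) * (1 - h)"
    using n(2) by (simp add: h_def k_def e_def)
  have "2 *\<^sub>R (k * k * h - 2 *\<^sub>R (k * h * k) + h * k * k) =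
    ((1 + h) * (1 + k) * (1 + k) * (1 + h) - (1 + k) * (1 + h) * (1 + h) * (1 + k))
    - ((1 - h) * (1 + k) * (1 + k) * (1 - h) - (1 + k) * (1 - h) * (1 - h) * (1 + k))"
    by (simp add: algebra_simps scaleR_2)
  also have "\<dots> = 0" unfolding p q by simp
  finally have "k * k * h - 2 *\<^sub>R (k * h * k) + h * k * k = 0" by simp
  then have "(e * e * e) *\<^sub>R (Z * Z * X - 2 *\<^sub>R (Z * X * Z) + X * Z * Z) = 0"
    by (simp add: h_def k_def algebra_simps)
  then show ?thesis using e by simp
qed

end

theorem quasi_geometric_mean_is_geometric:
  fixes g \<phi> :: "real \<Rightarrow> real"
  assumes noncomm: "\<exists>x y :: 'a::cstar_algebra. x * y \<noteq> y * x"
    and g: "\<And>t. t > 0 \<Longrightarrow> g t > 0"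
    and \<phi>: "continuous_on {0<..} \<phi>" "inj_on \<phi> {0<..}" "\<phi> ` {0<..} \<subseteq> {0<..}"
    and quasi: "\<And>a b :: 'a. a \<in> pos_def_cone \<Longrightarrow> b \<in> pos_def_cone \<Longrightarrow>
      ka_mean g a b = cfc (inv_into {0<..} \<phi>) (ka_mean sqrt (cfc \<phi> a) (cfc \<phi> b))"
    and t: "t > 0"
  shows "g t = sqrt t"
proof -
  let ?J = "\<phi> ` {0<..}" and ?\<theta> = "inv_into {0<..} \<phi>"
  have pos: "\<phi> x > 0" if "x > 0" for x using \<phi>(3) that by auto
  obtain \<theta>' where hom: "homeomorphism {0<..} ?J \<phi> \<theta>'"
    using injective_into_1d_eq_homeomorphism[OF \<phi>(1)] \<phi>(2) by (auto simp: convex_imp_path_connected)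
  have \<theta>'_eq: "?\<theta> u = \<theta>' u" if "u \<in> ?J" for u
    using hom that \<phi>(2) by (auto simp: homeomorphism_def inv_into_f_f)
  have \<theta>_cont: "continuous_on ?J ?\<theta>"
    using hom \<theta>'_eq by (simp add: homeomorphism_def cong: continuous_on_cong)
  have \<theta>J: "?\<theta> u > 0" "\<phi> (?\<theta> u) = u" if "u \<in> ?J" for u
    using inv_into_into[OF that] f_inv_into_f[OF that] by auto
  have J_open: "open ?J"
    by (rule injective_into_1d_imp_open_map_UNIV[OF open_greaterThan \<phi>(1,2) subset_refl])
  have "connected ?J" by (rule connected_continuous_image[OF \<phi>(1)]) simp
  then have J_int: "is_interval ?J" by (simp add: is_interval_connected_1)
  \<comment> \<open>\<open>inv_into\<close> inverts \<open>\<phi>\<close> only on the range. The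
    geometric mean of two values lies between them, hence in the interval \<open>?J\<close>.\<close>
  have geo: "sqrt (\<phi> x * \<phi> y) \<in> ?J" if "x > 0" "y > 0" for x y
  proof -
    have *: "sqrt (u * v) \<in> {u..v}" if "0 < u" "u \<le> v" for u v :: real
    proof -
      have "u \<le> sqrt (u * v)" using that by (intro real_le_rsqrt) (simp add: power2_eq_square)
      moreover have "sqrt (u * v) \<le> v"
        using that by (intro real_le_lsqrt) (simp_all add: power2_eq_square)
      ultimately show ?thesis by simp
    qed
    show ?thesis
    proof (cases "\<phi> x \<le> \<phi> y")
      case True
      then have "sqrt (\<phi> x * \<phi> y) \<in> {\<phi> x..\<phi> y}" by (rule *[OF pos[OF that(1)]])
      then show ?thesis
        using mem_is_interval_1_I[OF J_int imageI imageI, of x y] that by simp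
    next
      case False
      then have "sqrt (\<phi> y * \<phi> x) \<in> {\<phi> y..\<phi> x}" by (intro *[OF pos[OF that(2)]]) simp
      then show ?thesis
        using mem_is_interval_1_I[OF J_int imageI imageI, of y x] that by (simp add: mult.commute)
    qed
  qed
  \<comment> \<open>The numerical mean that \<open>g\<close> induces on scalar elements, homogeneous
    by its form. Taking \<open>ln\<close> of \<open>\<phi>\<close> turns geometric averaging into
    arithmetic averaging.\<close>
  define m where "m = (\<lambda>x y. x * g (y / x))"
  have \<phi>m: "\<phi> (m x y) = sqrt (\<phi> x * \<phi> y)" if x: "x > 0" and y: "y > 0" for x y
  proof -
    have "(x * g (y / x)) *\<^sub>R (1::'a) = ?\<theta> (\<phi> x * sqrt (\<phi> y / \<phi> x)) *\<^sub>R 1"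
      using quasi[OF scalar_pos_def_cone[OF x] scalar_pos_def_cone[OF y]]
      by (simp add: ka_mean_scalar x cfc_scalar pos)
    moreover have "\<phi> x * sqrt (\<phi> y / \<phi> x) = sqrt (\<phi> x * \<phi> y)"
    proof -
      have "sqrt (\<phi> x * \<phi> y) = sqrt (\<phi> x * \<phi> x * (\<phi> y / \<phi> x))" using pos[OF x] by simp
      then show ?thesis using pos[OF x] by (simp only: real_sqrt_mult) simp
    qed
    ultimately have "m x y = ?\<theta> (sqrt (\<phi> x * \<phi> y))" by (simp add: m_def)
    then show ?thesis using \<theta>J(2)[OF geo[OF x y]] by simp
  qed
  define \<psi> where "\<psi> = (\<lambda>x. ln (\<phi> x))"
  have \<psi>: "continuous_on {0<..} \<psi>" "inj_on \<psi> {0<..}"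
    unfolding \<psi>_def using \<phi> pos
    by (force intro!: continuous_on_ln, force simp: inj_on_def)
  have \<psi>m: "\<psi> (m x y) = (\<psi> x + \<psi> y) / 2" if "x > 0" "y > 0" for x y
  proof -
    have "ln (sqrt (\<phi> x * \<phi> y)) = ln (\<phi> x * \<phi> y) / 2"
      using pos[OF that(1)] pos[OF that(2)] by (intro ln_sqrt) simp
    also have "ln (\<phi> x * \<phi> y) = ln (\<phi> x) + ln (\<phi> y)"
      using pos[OF that(1)] pos[OF that(2)] by (rule ln_mult_pos)
    finally show ?thesis unfolding \<psi>_def \<phi>m[OF that] .
  qed
  have "(\<forall>t>0. m 1 t = sqrt t) \<or> (\<exists>s>0. \<exists>B. \<forall>t>0. \<psi> (s * t) = 2 * \<psi> t + B)"
    by (rule homogeneous_quasi_arithmetic_mean[OF \<psi> _ \<psi>m]) (auto simp: m_def g)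
  \<comment> \<open>Exponentiating the affine law gives the squaring law with
    \<open>c = exp B\<close>, so the locale applies and makes all self-adjoint elements
    commute.\<close>
  moreover have False if "s > 0" and B: "\<forall>t>0. \<psi> (s * t) = 2 * \<psi> t + B" for s B
  proof -
    have sc: "\<phi> (s * t) = exp B * (\<phi> t)\<^sup>2" if "t > 0" for t
    proof -
      have "\<phi> (s * t) = exp (\<psi> (s * t))" using pos[of "s * t"] that \<open>s > 0\<close> by (simp add: \<psi>_def)
      also have "\<dots> = exp B * (exp (\<psi> t))\<^sup>2" using B that by (simp add: exp_add exp_double)
      also have "exp (\<psi> t) = \<phi> t" using pos[of t] that by (simp add: \<psi>_def)
      finally show ?thesis .
    qed
    interpret quasi_geometric g \<phi> ?\<theta> s "exp B" "TYPE('a)"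
      by unfold_locales (use \<phi>(1) pos J_open \<theta>_cont \<theta>J \<open>s > 0\<close> sc quasi in auto)
    have "z * x = x * z" if "selfadjoint z" "selfadjoint x" for z x :: 'a
      by (rule selfadjoint_double_commutator_commute[OF double_commutator_zero[OF that(1)] that])
    then show False using noncomm commutative_if_selfadjoint_commute by metis
  qed
  ultimately have "m 1 t = sqrt t" using t by blast
  then show ?thesis by (simp add: m_def)
qed

section \<open>Functions of Hermitian matrices\<close>

type_synonym cmat = "nat \<Rightarrow> nat \<Rightarrow> complex"

definition mmul :: "nat \<Rightarrow> cmat \<Rightarrow> cmat \<Rightarrow> cmat" where
  "mmul n A B = (\<lambda>i j. \<Sum>k<n. A i k * B k j)"

definition madj :: "cmat \<Rightarrow> cmat" where
  "madj A = (\<lambda>i j. cnj (A j i))"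

definition mone :: "nat \<Rightarrow> cmat" where
  "mone n = (\<lambda>i j. if i = j \<and> i < n then 1 else 0)"

definition mdiag :: "nat \<Rightarrow> (nat \<Rightarrow> real) \<Rightarrow> cmat" where
  "mdiag n d = (\<lambda>i j. if i = j \<and> i < n then complex_of_real (d i) else 0)"

text \<open>Matrices of size \<open>n\<close> are padded with zeros outside the index range, so that matrix identities
  become equalities of functions.\<close>

definition in_mat :: "nat \<Rightarrow> cmat \<Rightarrow> bool" where
  "in_mat n A \<longleftrightarrow> (\<forall>i j. \<not> (i < n \<and> j < n) \<longrightarrow> A i j = 0)"

definition mtrunc :: "nat \<Rightarrow> cmat \<Rightarrow> cmat" where
  "mtrunc n A = (\<lambda>i j. if i < n \<and> j < n then A i j else 0)"

text \<open>Block-diagonal matrix with a corner of size 1, for the deflation step of the spectral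
  theorem.\<close>

definition mblock :: "complex \<Rightarrow> cmat \<Rightarrow> cmat" where
  "mblock a M = (\<lambda>i j. case i of 0 \<Rightarrow> (case j of 0 \<Rightarrow> a | Suc _ \<Rightarrow> 0)
     | Suc i' \<Rightarrow> (case j of 0 \<Rightarrow> 0 | Suc j' \<Rightarrow> M i' j'))"

lemma mmul_assoc: "mmul n (mmul n A B) C = mmul n A (mmul n B C)"
  unfolding mmul_def
  by (intro ext, simp add: sum_distrib_left sum_distrib_right mult.assoc, rule sum.swap)

lemma in_mat_mone: "in_mat n (mone n)" and in_mat_mdiag: "in_mat n (mdiag n d)"
  and in_mat_mtrunc: "in_mat n (mtrunc n A)"
  by (auto simp: in_mat_def mone_def mdiag_def mtrunc_def)

lemma in_mat_mmul: "in_mat n A \<Longrightarrow> in_mat n B \<Longrightarrow> in_mat n (mmul n A B)"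
  by (auto simp: in_mat_def mmul_def)

lemma in_mat_madj: "in_mat n A \<Longrightarrow> in_mat n (madj A)"
  by (auto simp: in_mat_def madj_def)

lemmas in_mat_intros = in_mat_mone in_mat_mdiag in_mat_mtrunc in_mat_mmul in_mat_madj

lemma mmul_mone: assumes "in_mat n A" shows "mmul n (mone n) A = A" "mmul n A (mone n) = A"
proof -
  have "mmul n (mone n) A i j = A i j" for i j
  proof -
    have "mmul n (mone n) A i j = (\<Sum>k<n. if k = i then A i j else 0)"
      unfolding mmul_def mone_def by (intro sum.cong) auto
    then show ?thesis using assms by (auto simp: in_mat_def)
  qed
  moreover have "mmul n A (mone n) i j = A i j" for i j
  proof -
    have "mmul n A (mone n) i j = (\<Sum>k<n. if k = j then A i j else 0)"
      unfolding mmul_def mone_def by (intro sum.cong) auto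
    then show ?thesis using assms by (auto simp: in_mat_def)
  qed
  ultimately show "mmul n (mone n) A = A" "mmul n A (mone n) = A" by (simp_all add: fun_eq_iff)
qed

lemma madj_mmul: "madj (mmul n A B) = mmul n (madj B) (madj A)"
  by (simp add: madj_def mmul_def mult.commute)

lemma madj_madj [simp]: "madj (madj A) = A"
  by (simp add: madj_def)

lemma mmul_mblock: "mmul (Suc n) (mblock a M) (mblock b N) = mblock (a * b) (mmul n M N)"
  unfolding mmul_def mblock_def
  by (intro ext) (simp add: sum.lessThan_Suc_shift del: sum.lessThan_Suc split: nat.split)

lemma madj_mblock: "madj (mblock a M) = mblock (cnj a) (madj M)"
  by (intro ext) (simp add: madj_def mblock_def split: nat.split)

lemma mone_mblock: "mone (Suc n) = mblock 1 (mone n)"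
  by (intro ext) (simp add: mone_def mblock_def split: nat.split)

lemma mdiag_mblock: "mdiag (Suc n) (case_nat r d) = mblock (complex_of_real r) (mdiag n d)"
  by (intro ext) (simp add: mdiag_def mblock_def split: nat.split)

lemma in_mat_mblock: "in_mat n M \<Longrightarrow> in_mat (Suc n) (mblock a M)"
  by (auto simp: in_mat_def mblock_def split: nat.split)

text \<open>Transferred from \<open>mat\<close>, where one-sided inverses of square matrices are
  two-sided. It turns orthonormal columns into orthonormal rows.\<close>

lemma mmul_right_inverse:
  assumes A: "in_mat n A" and B: "in_mat n B" and AB: "mmul n A B = mone n"
  shows "mmul n B A = mone n"
proof -
  let ?m = "\<lambda>A. mat n n (\<lambda>(i, j). A i j) :: complex mat"
  have prod: "?m A * ?m B = ?m (mmul n A B)" for A B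
    by (rule eq_matI) (auto simp: mmul_def scalar_prod_def atLeast0LessThan)
  have one: "?m (mone n) = 1\<^sub>m n" by (rule eq_matI) (auto simp: mone_def)
  have "?m B * ?m A = 1\<^sub>m n"
    by (rule mat_mult_left_right_inverse[of "?m A" n]) (use prod[of A B] AB one in auto)
  then have e: "?m (mmul n B A) = ?m (mone n)" using prod[of B A] one by simp
  have "mmul n B A i j = mone n i j" for i j
  proof (cases "i < n \<and> j < n")
    case True
    then show ?thesis using arg_cong[OF e, of "\<lambda>M. M $$ (i, j)"] by simp
  next
    case False
    then show ?thesis using in_mat_mmul[OF B A] in_mat_mone[of n] by (auto simp: in_mat_def)
  qed
  then show ?thesis by auto
qed

section \<open>The spectral theorem for Hermitian matrices\<close>

lemma ex_unit_eigenvector: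
  fixes A :: cmat
  assumes "n > 0"
  obtains v \<mu> where "(\<Sum>i<n. (cmod (v i))\<^sup>2) = 1"
    "\<And>i. i < n \<Longrightarrow> (\<Sum>j<n. A i j * v j) = \<mu> * v i"
proof -
  let ?M = "mat n n (\<lambda>(i, j). A i j) :: complex mat"
  obtain \<mu> where "eigenvalue ?M \<mu>"
    using spectrum_non_empty[of ?M n] assms by (auto simp: spectrum_def)
  then obtain u where u: "u \<in> carrier_vec n" "u \<noteq> 0\<^sub>v n" "?M *\<^sub>v u = \<mu> \<cdot>\<^sub>v u"
    by (auto simp: eigenvalue_def eigenvector_def)
  define w where "w = (\<lambda>i. vec_index u i)"
  have w: "(\<Sum>j<n. A i j * w j) = \<mu> * w i" if "i < n" for i
  proof -
    have "vec_index (?M *\<^sub>v u) i = vec_index (\<mu> \<cdot>\<^sub>v u) i" using u(3) by simp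
    then show ?thesis using that u(1)
      by (simp add: w_def scalar_prod_def atLeast0LessThan)
  qed
  obtain i0 where i0: "i0 < n" "w i0 \<noteq> 0"
  proof -
    have "\<exists>i<n. w i \<noteq> 0"
    proof (rule ccontr)
      assume "\<not> ?thesis"
      then have "u = 0\<^sub>v n" using u(1) by (intro eq_vecI) (auto simp: w_def)
      then show False using u(2) by simp
    qed
    then show ?thesis using that by blast
  qed
  define N where "N = (\<Sum>i<n. (cmod (w i))\<^sup>2)"
  have "N > 0" unfolding N_def using i0 by (intro sum_pos2[of _ i0]) auto
  define v where "v = (\<lambda>i. w i / complex_of_real (sqrt N))"
  have "(\<Sum>i<n. (cmod (v i))\<^sup>2) = (\<Sum>i<n. (cmod (w i))\<^sup>2 / N)"
    using \<open>N > 0\<close> by (simp add: v_def norm_divide power_divide)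
  also have "\<dots> = (\<Sum>i<n. (cmod (w i))\<^sup>2) / N" by (rule sum_divide_distrib[symmetric])
  finally have "(\<Sum>i<n. (cmod (v i))\<^sup>2) = 1" using \<open>N > 0\<close> by (simp flip: N_def)
  moreover have "(\<Sum>j<n. A i j * v j) = \<mu> * v i" if "i < n" for i
    using w[OF that] by (simp add: v_def sum_divide_distrib[symmetric])
  ultimately show ?thesis using that by blast
qed

text \<open>A Householder reflection, scaled by a phase so that its first column is the given vector.\<close>

lemma ex_unitary_first_column:
  assumes v: "(\<Sum>i<Suc n. (cmod (v i))\<^sup>2) = 1"
  obtains H where "in_mat (Suc n) H" "mmul (Suc n) (madj H) H = mone (Suc n)"
    "\<And>i. i < Suc n \<Longrightarrow> H i 0 = v i"
proof -
  \<comment> \<open>The phase of \<open>v 0\<close>, with default 1 at \<open>v 0 = 0\<close>,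
    aligns the two summands of \<open>w 0\<close>: then \<open>w 0 = N * \<alpha>\<close> with
    \<open>N \<ge> 1\<close>, so division by \<open>N\<close> is safe.\<close>
  define \<alpha> where "\<alpha> = (if v 0 = 0 then 1 else sgn (v 0))"
  have \<alpha>: "cmod \<alpha> = 1" "v 0 = cmod (v 0) * \<alpha>"
    by (simp add: \<alpha>_def norm_sgn, simp add: \<alpha>_def sgn_eq)
  have \<alpha>': "\<alpha> * cnj \<alpha> = 1" using \<alpha>(1) by (simp add: complex_norm_square[symmetric])
  define w where "w = (\<lambda>i. v i + (if i = 0 then \<alpha> else 0))"
  define N where "N = 1 + cmod (v 0)"
  have N0: "N > 0" by (simp add: N_def add_pos_nonneg)
  have w0: "w 0 = N * \<alpha>" using \<alpha>(2) by (simp add: w_def N_def algebra_simps)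
  have "(\<Sum>i<Suc n. w i * cnj (w i)) = w 0 * cnj (w 0) + (\<Sum>i<n. v (Suc i) * cnj (v (Suc i)))"
    by (simp add: sum.lessThan_Suc_shift w_def del: sum.lessThan_Suc)
  also have "(\<Sum>i<n. v (Suc i) * cnj (v (Suc i))) = complex_of_real (1 - (cmod (v 0))\<^sup>2)"
  proof -
    have "(\<Sum>i<n. v (Suc i) * cnj (v (Suc i))) = complex_of_real (\<Sum>i<n. (cmod (v (Suc i)))\<^sup>2)"
      by (simp add: complex_norm_square del: of_real_power)
    also have "(\<Sum>i<n. (cmod (v (Suc i)))\<^sup>2) = 1 - (cmod (v 0))\<^sup>2"
      using v by (simp add: sum.lessThan_Suc_shift del: sum.lessThan_Suc)
    finally show ?thesis .
  qed
  also have "w 0 * cnj (w 0) = complex_of_real (N * N) * (\<alpha> * cnj \<alpha>)"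
    by (simp add: w0)
  finally have "(\<Sum>i<Suc n. w i * cnj (w i)) = complex_of_real (N * N + (1 - (cmod (v 0))\<^sup>2))"
    unfolding \<alpha>' by simp
  also have "N * N + (1 - (cmod (v 0))\<^sup>2) = 2 * N"
    by (simp add: N_def power2_eq_square algebra_simps)
  finally have ww: "(\<Sum>i<Suc n. w i * cnj (w i)) = complex_of_real (2 * N)" .
  \<comment> \<open>\<open>2 * N\<close> is the squared length of \<open>w\<close>, so the bracket
    is the reflection along \<open>w\<close>. It sends the first basis vector to
    \<open>- v / \<alpha>\<close>, which the factor \<open>- \<alpha>\<close> corrects.\<close>
  define H where "H = mtrunc (Suc n) (\<lambda>i j. - \<alpha> * ((if i = j then 1 else 0) - w i * cnj (w j) / N))"
  have H: "in_mat (Suc n) H" by (simp add: H_def in_mat_mtrunc)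
  have "mmul (Suc n) (madj H) H i j = mone (Suc n) i j" for i j
  proof (cases "i < Suc n \<and> j < Suc n")
    case True
    let ?\<delta> = "\<lambda>i j :: nat. if i = j then 1 else 0 :: complex"
    have "mmul (Suc n) (madj H) H i j =
      (\<Sum>k<Suc n. (\<alpha> * cnj \<alpha>) * ((?\<delta> k i - cnj (w k) * w i / N) * (?\<delta> k j - w k * cnj (w j) / N)))"
      unfolding mmul_def madj_def H_def mtrunc_def using True
      by (intro sum.cong) (auto simp: algebra_simps)
    also have "\<dots> = (\<Sum>k<Suc n. ?\<delta> k i * ?\<delta> k j - ?\<delta> k i * (w k * cnj (w j) / N)
        - ?\<delta> k j * (cnj (w k) * w i / N) + (w k * cnj (w k)) * (w i * cnj (w j) / (N * N)))"
      unfolding \<alpha>' by (intro sum.cong refl) (simp add: algebra_simps)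
    also have "\<dots> = (\<Sum>k<Suc n. ?\<delta> k i * ?\<delta> k j) - (\<Sum>k<Suc n. ?\<delta> k i * (w k * cnj (w j) / N))
        - (\<Sum>k<Suc n. ?\<delta> k j * (cnj (w k) * w i / N))
        + (\<Sum>k<Suc n. w k * cnj (w k)) * (w i * cnj (w j) / (N * N))"
      by (simp only: sum.distrib sum_subtractf sum_distrib_right)
    also have "(\<Sum>k<Suc n. ?\<delta> k i * ?\<delta> k j) = ?\<delta> i j"
    proof -
      have "(\<Sum>k<Suc n. ?\<delta> k i * ?\<delta> k j) = (\<Sum>k<Suc n. if k = i then ?\<delta> i j else 0)"
        by (intro sum.cong) auto
      then show ?thesis using True by (simp del: sum.lessThan_Suc)
    qed
    also have "(\<Sum>k<Suc n. ?\<delta> k i * (w k * cnj (w j) / N)) = w i * cnj (w j) / N"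
    proof -
      have "(\<Sum>k<Suc n. ?\<delta> k i * (w k * cnj (w j) / N)) = (\<Sum>k<Suc n. if k = i then w i * cnj (w j) / N else 0)"
        by (intro sum.cong) auto
      then show ?thesis using True by (simp del: sum.lessThan_Suc)
    qed
    also have "(\<Sum>k<Suc n. ?\<delta> k j * (cnj (w k) * w i / N)) = w i * cnj (w j) / N"
    proof -
      have "(\<Sum>k<Suc n. ?\<delta> k j * (cnj (w k) * w i / N)) = (\<Sum>k<Suc n. if k = j then w i * cnj (w j) / N else 0)"
        by (intro sum.cong) auto
      then show ?thesis using True by (simp del: sum.lessThan_Suc)
    qed
    also have "(\<Sum>k<Suc n. w k * cnj (w k)) * (w i * cnj (w j) / (N * N)) = 2 * (w i * cnj (w j) / N)"
      unfolding ww using N0 by (simp add: field_simps)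
    finally show ?thesis using True by (simp add: mone_def)
  next
    case False
    then show ?thesis using in_mat_mmul[OF in_mat_madj[OF H] H] in_mat_mone[of "Suc n"]
      by (auto simp: in_mat_def)
  qed
  then have unit: "mmul (Suc n) (madj H) H = mone (Suc n)" by blast
  have "H i 0 = v i" if "i < Suc n" for i
  proof -
    have "H i 0 = - \<alpha> * ((if i = 0 then 1 else 0) - w i * cnj (w 0) / N)"
      using that by (simp add: H_def mtrunc_def)
    also have "w i * cnj (w 0) / N = w i * cnj \<alpha>" using N0 by (simp add: w0)
    also have "- \<alpha> * ((if i = 0 then 1 else 0) - w i * cnj \<alpha>)
        = - \<alpha> * (if i = 0 then 1 else 0) + w i * (\<alpha> * cnj \<alpha>)"
      by (simp add: algebra_simps)
    finally show ?thesis unfolding \<alpha>' by (simp add: w_def)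
  qed
  with H unit that show ?thesis by blast
qed

text \<open>Deflation: in a basis starting with a unit eigenvector the first column is
  \<open>\<mu>\<close> times a basis vector; being Hermitian, the matrix has the matching first row
  and real \<open>\<mu>\<close>, and the induction continues on the remaining block
  \<open>C\<close>.\<close>

theorem hermitian_spectral_theorem:
  assumes "in_mat n A" "madj A = A"
  shows "\<exists>U d. in_mat n U \<and> mmul n (madj U) U = mone n \<and> A = mmul n U (mmul n (mdiag n d) (madj U))"
  using assms
proof (induction n arbitrary: A)
  case 0
  then have "A = (\<lambda>_ _. 0)" by (auto simp: in_mat_def)
  then show ?case by (intro exI[of _ "\<lambda>_ _. 0"]) (auto simp: in_mat_def mmul_def mone_def)
next
  case (Suc n)
  let ?N = "Suc n"
  obtain v \<mu> where v: "(\<Sum>i<?N. (cmod (v i))\<^sup>2) = 1"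
    "\<And>i. i < ?N \<Longrightarrow> (\<Sum>j<?N. A i j * v j) = \<mu> * v i"
    using ex_unit_eigenvector[of ?N A] by auto
  obtain H where H: "in_mat ?N H" "mmul ?N (madj H) H = mone ?N" "\<And>i. i < ?N \<Longrightarrow> H i 0 = v i"
    using ex_unitary_first_column[OF v(1)] by blast
  have H': "mmul ?N H (madj H) = mone ?N"
    by (rule mmul_right_inverse[OF in_mat_madj[OF H(1)] H(1) H(2)])
  define A' where "A' = mmul ?N (madj H) (mmul ?N A H)"
  have A'in: "in_mat ?N A'" unfolding A'_def by (intro in_mat_intros H Suc)
  have A'adj: "madj A' = A'"
    unfolding A'_def madj_mmul using Suc(3) by (simp add: mmul_assoc)
  have AH: "mmul ?N A H k 0 = \<mu> * H k 0" if "k < ?N" for k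
  proof -
    have "mmul ?N A H k 0 = (\<Sum>j<?N. A k j * v j)"
      unfolding mmul_def by (intro sum.cong) (auto simp: H(3))
    then show ?thesis using v(2)[OF that] H(3)[OF that] by simp
  qed
  have col: "A' i 0 = \<mu> * mone ?N i 0" for i
  proof -
    have "A' i 0 = (\<Sum>k<?N. madj H i k * (\<mu> * H k 0))"
      unfolding A'_def mmul_def[of _ "madj H"] by (intro sum.cong) (auto simp: AH)
    also have "\<dots> = \<mu> * mmul ?N (madj H) H i 0"
      by (simp add: mmul_def sum_distrib_left mult_ac del: sum.lessThan_Suc)
    finally show ?thesis by (simp add: H(2))
  qed
  have adj: "A' i j = cnj (A' j i)" for i j using A'adj by (metis madj_def)
  have "\<mu> = cnj \<mu>" using col[of 0] adj[of 0 0] by (simp add: mone_def)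
  then have \<mu>: "\<mu> = complex_of_real (Re \<mu>)" by (simp add: complex_eq_iff)
  define C where "C = (\<lambda>i j. A' (Suc i) (Suc j))"
  have A'C: "A' = mblock \<mu> C"
  proof (intro ext)
    fix i j
    show "A' i j = mblock \<mu> C i j"
    proof (cases i; cases j)
      fix j' assume "i = 0" "j = Suc j'"
      then show ?thesis using adj[of 0 j] col[of j] by (simp add: mblock_def mone_def)
    qed (use col in \<open>simp_all add: mblock_def C_def mone_def\<close>)
  qed
  have "in_mat n C" using A'in by (auto simp: in_mat_def C_def)
  moreover have "madj C = C" by (simp add: madj_def C_def adj[symmetric])
  ultimately obtain U d where U: "in_mat n U" "mmul n (madj U) U = mone n"
    "C = mmul n U (mmul n (mdiag n d) (madj U))" using Suc.IH by blast
  define V where "V = mmul ?N H (mblock 1 U)"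
  have "in_mat ?N V" unfolding V_def by (intro in_mat_mmul H in_mat_mblock U)
  moreover have "mmul ?N (madj V) V = mone ?N"
  proof -
    have "mmul ?N (madj V) V = mmul ?N (mblock 1 (madj U)) (mmul ?N (mmul ?N (madj H) H) (mblock 1 U))"
      by (simp add: V_def madj_mmul mmul_assoc madj_mblock)
    also have "\<dots> = mone ?N"
      unfolding H(2) by (simp add: mmul_mone in_mat_mblock U mmul_mblock mone_mblock)
    finally show ?thesis .
  qed
  moreover have "A = mmul ?N V (mmul ?N (mdiag ?N (case_nat (Re \<mu>) d)) (madj V))"
  proof -
    have "A' = mmul ?N (mblock 1 U) (mmul ?N (mdiag ?N (case_nat (Re \<mu>) d)) (mblock 1 (madj U)))"
      unfolding A'C mdiag_mblock mmul_mblock U(3) using \<mu> by simp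
    then have "mmul ?N V (mmul ?N (mdiag ?N (case_nat (Re \<mu>) d)) (madj V)) = mmul ?N H (mmul ?N A' (madj H))"
      by (simp add: V_def madj_mmul madj_mblock mmul_assoc)
    also have "\<dots> = mmul ?N (mmul ?N H (madj H)) (mmul ?N A (mmul ?N H (madj H)))"
      by (simp add: A'_def mmul_assoc)
    also have "\<dots> = A" unfolding H' by (simp add: mmul_mone Suc)
    finally show ?thesis by simp
  qed
  ultimately show ?case by blast
qed

text \<open>The product of \<open>U\<close>, a real diagonal and the adjoint of \<open>U\<close>, in
  the entrywise form in which \<open>mat_fun\<close> describes both its argument and its
  value.\<close>

definition mspec :: "nat \<Rightarrow> cmat \<Rightarrow> (nat \<Rightarrow> real) \<Rightarrow> cmat" where
  "mspec n U d = (\<lambda>i j. if i < n \<and> j < n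
     then (\<Sum>k<n. U i k * complex_of_real (d k) * cnj (U j k)) else 0)"

lemma mspec_altdef: "mspec n U d = mmul n (mtrunc n U) (mmul n (mdiag n d) (madj (mtrunc n U)))"
proof (intro ext)
  fix i j
  have "mmul n (mdiag n d) (madj (mtrunc n U)) k j = complex_of_real (d k) * cnj (mtrunc n U j k)"
    if "k < n" for k
  proof -
    have "mmul n (mdiag n d) (madj (mtrunc n U)) k j
      = (\<Sum>l<n. if l = k then complex_of_real (d k) * cnj (mtrunc n U j k) else 0)"
      unfolding mmul_def mdiag_def madj_def by (intro sum.cong) (use that in auto)
    then show ?thesis using that by simp
  qed
  then have "mmul n (mtrunc n U) (mmul n (mdiag n d) (madj (mtrunc n U))) i j
    = (\<Sum>k<n. mtrunc n U i k * (complex_of_real (d k) * cnj (mtrunc n U j k)))"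
    unfolding mmul_def[of n "mtrunc n U"] by (intro sum.cong) auto
  also have "\<dots> = mspec n U d i j"
    by (auto simp: mspec_def mtrunc_def mult.assoc intro!: sum.cong sum.neutral)
  finally show "mspec n U d i j = mmul n (mtrunc n U) (mmul n (mdiag n d) (madj (mtrunc n U))) i j" ..
qed

lemma mat_unitary_mtrunc:
  "mat_unitary n U \<longleftrightarrow> mmul n (madj (mtrunc n U)) (mtrunc n U) = mone n"
proof
  assume U: "mat_unitary n U"
  have "mmul n (madj (mtrunc n U)) (mtrunc n U) i j = mone n i j" for i j
  proof (cases "i < n \<and> j < n")
    case True
    then have "mmul n (madj (mtrunc n U)) (mtrunc n U) i j = (\<Sum>k<n. cnj (U k i) * U k j)"
      unfolding mmul_def madj_def mtrunc_def by (intro sum.cong) auto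
    then show ?thesis using U True by (simp add: mat_unitary_def mone_def)
  next
    case False
    then show ?thesis using in_mat_mmul[OF in_mat_madj[OF in_mat_mtrunc] in_mat_mtrunc, of n U U] in_mat_mone[of n]
      by (auto simp: in_mat_def)
  qed
  then show "mmul n (madj (mtrunc n U)) (mtrunc n U) = mone n" by blast
next
  assume e: "mmul n (madj (mtrunc n U)) (mtrunc n U) = mone n"
  show "mat_unitary n U"
    unfolding mat_unitary_def
  proof (intro allI impI)
    fix i j assume ij: "i < n" "j < n"
    then have "mmul n (madj (mtrunc n U)) (mtrunc n U) i j = (\<Sum>k<n. cnj (U k i) * U k j)"
      unfolding mmul_def madj_def mtrunc_def by (intro sum.cong) auto
    then show "(\<Sum>k<n. cnj (U k i) * U k j) = (if i = j then 1 else 0)"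
      using e ij by (simp add: mone_def)
  qed
qed

text \<open>With \<open>W\<close> the adjoint of \<open>U\<close> times \<open>V\<close>, equality
  of the matrices says that \<open>W k l = 0\<close> or \<open>d k = e l\<close> for all entries.
  Hence \<open>W\<close> also intertwines the diagonals after applying \<open>f\<close>, so the
  value of \<open>mat_fun\<close> does not depend on the diagonalization.\<close>

lemma mspec_fun_cong:
  assumes U: "mat_unitary n U" and V: "mat_unitary n V" and eq: "mspec n U d = mspec n V e"
  shows "mspec n U (\<lambda>k. f (d k)) = mspec n V (\<lambda>k. f (e k))"
proof -
  define U' where "U' = mtrunc n U"
  define V' where "V' = mtrunc n V"
  have inU: "in_mat n U'" and inV: "in_mat n V'" by (simp_all add: U'_def V'_def in_mat_mtrunc)
  have UU: "mmul n (madj U') U' = mone n" and VV: "mmul n (madj V') V' = mone n"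
    using U V by (simp_all add: U'_def V'_def mat_unitary_mtrunc)
  have UU': "mmul n U' (madj U') = mone n" and VV': "mmul n V' (madj V') = mone n"
    using mmul_right_inverse[OF in_mat_madj[OF inU] inU UU]
      mmul_right_inverse[OF in_mat_madj[OF inV] inV VV] by auto
  define W where "W = mmul n (madj U') V'"
  have diagl: "mmul n (mdiag n d) W k l = (if k < n then d k * W k l else 0)" for d k l
  proof -
    have "mmul n (mdiag n d) W k l = (\<Sum>j<n. if j = k then complex_of_real (d k) * W k l else 0)"
      unfolding mmul_def mdiag_def by (intro sum.cong) auto
    then show ?thesis by simp
  qed
  have diagr: "mmul n W (mdiag n d) k l = (if l < n then W k l * d l else 0)" for d k l
  proof -
    have "mmul n W (mdiag n d) k l = (\<Sum>j<n. if j = l then W k l * complex_of_real (d l) else 0)"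
      unfolding mmul_def mdiag_def by (intro sum.cong) auto
    then show ?thesis by simp
  qed
  have inW: "in_mat n W" unfolding W_def by (intro in_mat_intros inU inV)
  have "mmul n (mmul n (madj U') U') (mmul n (mdiag n d) (mmul n (madj U') V'))
    = mmul n (madj U') (mmul n (mspec n U d) V')"
    unfolding mspec_altdef U'_def[symmetric] by (simp add: mmul_assoc)
  also have "\<dots> = mmul n (mmul n (madj U') V') (mmul n (mdiag n e) (mmul n (madj V') V'))"
    unfolding eq unfolding mspec_altdef V'_def[symmetric] by (simp add: mmul_assoc)
  finally have "mmul n (mdiag n d) W = mmul n W (mdiag n e)"
    unfolding UU VV W_def[symmetric] using inW by (simp add: mmul_mone in_mat_intros)
  then have dW: "mmul n (mdiag n d) W k l = mmul n W (mdiag n e) k l" for k l by simp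
  have WW: "W k l = 0 \<or> d k = e l" if "k < n" "l < n" for k l
    using dW[of k l] that by (simp add: diagl diagr mult.commute)
  have "mmul n (mdiag n (\<lambda>k. f (d k))) W k l = mmul n W (mdiag n (\<lambda>k. f (e k))) k l" for k l
    unfolding diagl diagr using inW WW[of k l] by (auto simp: in_mat_def)
  then have fW: "mmul n (mdiag n (\<lambda>k. f (d k))) W = mmul n W (mdiag n (\<lambda>k. f (e k)))" by blast
  have "mspec n U (\<lambda>k. f (d k)) = mmul n U' (mmul n (mdiag n (\<lambda>k. f (d k))) (mmul n (madj U') (mmul n V' (madj V'))))"
    unfolding mspec_altdef U'_def[symmetric] VV' using inU by (simp add: mmul_mone in_mat_intros)
  also have "\<dots> = mmul n U' (mmul n (mmul n (mdiag n (\<lambda>k. f (d k))) W) (madj V'))"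
    by (simp add: W_def mmul_assoc)
  also have "\<dots> = mmul n (mmul n U' (madj U')) (mmul n V' (mmul n (mdiag n (\<lambda>k. f (e k))) (madj V')))"
    unfolding fW by (simp add: W_def mmul_assoc)
  also have "\<dots> = mspec n V (\<lambda>k. f (e k))"
    unfolding UU' mspec_altdef V'_def[symmetric] using inV by (simp add: mmul_mone in_mat_intros)
  finally show ?thesis .
qed

lemma mat_fun_eq:
  assumes U: "mat_unitary n U"
    and A: "\<And>i j. i < n \<Longrightarrow> j < n \<Longrightarrow> A i j = mspec n U d i j"
  shows "mat_fun n f A = mspec n U (\<lambda>k. f (d k))"
  unfolding mat_fun_def
proof (rule the_equality)
  show "\<exists>U' d'. mat_unitary n U' \<and>
      (\<forall>i<n. \<forall>j<n. A i j = (\<Sum>k<n. U' i k * complex_of_real (d' k) * cnj (U' j k))) \<and>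
      (\<forall>i j. mspec n U (\<lambda>k. f (d k)) i j = (if i < n \<and> j < n
          then (\<Sum>k<n. U' i k * complex_of_real (f (d' k)) * cnj (U' j k)) else 0))"
    using U A by (intro exI[of _ U] exI[of _ d]) (auto simp: mspec_def)
next
  fix B
  assume "\<exists>U d. mat_unitary n U \<and>
      (\<forall>i<n. \<forall>j<n. A i j = (\<Sum>k<n. U i k * complex_of_real (d k) * cnj (U j k))) \<and>
      (\<forall>i j. B i j = (if i < n \<and> j < n
          then (\<Sum>k<n. U i k * complex_of_real (f (d k)) * cnj (U j k)) else 0))"
  then obtain V e where V: "mat_unitary n V"
    and AV: "\<And>i j. i < n \<Longrightarrow> j < n \<Longrightarrow> A i j = (\<Sum>k<n. V i k * complex_of_real (e k) * cnj (V j k))"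
    and B: "B = mspec n V (\<lambda>k. f (e k))"
    unfolding mspec_def by blast
  have "mspec n U d i j = mspec n V e i j" for i j
    using A AV by (cases "i < n \<and> j < n") (auto simp: mspec_def)
  then have "mspec n U d = mspec n V e" by blast
  then show "B = mspec n U (\<lambda>k. f (d k))" unfolding B by (rule mspec_fun_cong[OF U V, symmetric])
qed

lemma mat_fun_mspec: "mat_unitary n U \<Longrightarrow> mat_fun n f (mspec n U d) = mspec n U (\<lambda>k. f (d k))"
  by (rule mat_fun_eq) auto

lemma hermitian_ex_mspec:
  assumes "mat_hermitian n A"
  obtains U d where "mat_unitary n U" "\<And>i j. i < n \<Longrightarrow> j < n \<Longrightarrow> A i j = mspec n U d i j"
proof -
  have herm: "A i j = cnj (A j i)" if "i < n" "j < n" for i j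
    using assms that unfolding mat_hermitian_def by blast
  have "madj (mtrunc n A) i j = mtrunc n A i j" for i j
    using herm[of i j] by (simp add: madj_def mtrunc_def)
  then have "madj (mtrunc n A) = mtrunc n A" by blast
  then obtain U d where U: "in_mat n U" "mmul n (madj U) U = mone n"
    "mtrunc n A = mmul n U (mmul n (mdiag n d) (madj U))"
    using hermitian_spectral_theorem[OF in_mat_mtrunc] by blast
  have "mtrunc n U = U" using U(1) by (intro ext) (auto simp: mtrunc_def in_mat_def)
  then have "mat_unitary n U" "mtrunc n A = mspec n U d"
    using U by (simp_all add: mat_unitary_mtrunc mspec_altdef)
  moreover have "A i j = mtrunc n A i j" if "i < n" "j < n" for i j using that by (simp add: mtrunc_def)
  ultimately show ?thesis using that by metis
qed

section \<open>Quadratic forms, inversion and the order of Hermitian matrices\<close>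

lemma mat_hermitian_mspec: "mat_hermitian n (mspec n U d)"
  by (auto simp: mat_hermitian_def mspec_def mult_ac intro!: sum.cong)

text \<open>For unitary \<open>U\<close>, the coordinates of \<open>v\<close> in the orthonormal
  basis of columns of \<open>U\<close>.\<close>

definition mcoord :: "nat \<Rightarrow> cmat \<Rightarrow> (nat \<Rightarrow> complex) \<Rightarrow> nat \<Rightarrow> complex" where
  "mcoord n U v k = (\<Sum>i<n. cnj (U i k) * v i)"

lemma quad_form_mspec:
  "quad_form n (mspec n U d) v = complex_of_real (\<Sum>k<n. d k * (cmod (mcoord n U v k))\<^sup>2)"
proof -
  have "quad_form n (mspec n U d) v
    = (\<Sum>i<n. \<Sum>j<n. \<Sum>k<n. cnj (v i) * (U i k * complex_of_real (d k) * cnj (U j k)) * v j)"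
    unfolding quad_form_def mspec_def
    by (intro sum.cong refl) (simp add: sum_distrib_left sum_distrib_right)
  also have "\<dots> = (\<Sum>i<n. \<Sum>k<n. \<Sum>j<n. cnj (v i) * (U i k * complex_of_real (d k) * cnj (U j k)) * v j)"
    by (intro sum.cong refl sum.swap)
  also have "\<dots> = (\<Sum>k<n. \<Sum>i<n. \<Sum>j<n. cnj (v i) * (U i k * complex_of_real (d k) * cnj (U j k)) * v j)"
    by (rule sum.swap)
  also have "\<dots> = (\<Sum>k<n. complex_of_real (d k) * (cnj (mcoord n U v k) * mcoord n U v k))"
    unfolding mcoord_def
    by (intro sum.cong refl) (simp add: sum_product sum_distrib_left mult_ac)
  also have "\<dots> = complex_of_real (\<Sum>k<n. d k * (cmod (mcoord n U v k))\<^sup>2)"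
    by (simp add: complex_norm_square mult.commute del: of_real_power)
  finally show ?thesis .
qed

lemma unitary_rows:
  assumes "mat_unitary n U" "i < n" "j < n"
  shows "(\<Sum>k<n. U i k * cnj (U j k)) = (if i = j then 1 else 0)"
proof -
  have "mmul n (mtrunc n U) (madj (mtrunc n U)) = mone n"
    using mmul_right_inverse[OF in_mat_madj[OF in_mat_mtrunc] in_mat_mtrunc] assms(1)
    by (simp add: mat_unitary_mtrunc)
  then have "mmul n (mtrunc n U) (madj (mtrunc n U)) i j = mone n i j" by simp
  moreover have "mmul n (mtrunc n U) (madj (mtrunc n U)) i j = (\<Sum>k<n. U i k * cnj (U j k))"
    unfolding mmul_def madj_def mtrunc_def using assms by (intro sum.cong) auto
  ultimately show ?thesis using assms by (simp add: mone_def)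
qed

lemma parseval:
  assumes U: "mat_unitary n U"
  shows "(\<Sum>k<n. cnj (mcoord n U u k) * mcoord n U v k) = (\<Sum>i<n. cnj (u i) * v i)"
proof -
  have "cnj (mcoord n U u k) * mcoord n U v k
      = (\<Sum>i<n. \<Sum>j<n. (U i k * cnj (u i)) * (cnj (U j k) * v j))" for k
    unfolding mcoord_def by (simp add: sum_product)
  then have "(\<Sum>k<n. cnj (mcoord n U u k) * mcoord n U v k)
    = (\<Sum>k<n. \<Sum>i<n. \<Sum>j<n. cnj (u i) * v j * (U i k * cnj (U j k)))"
    by (simp add: mult_ac)
  also have "\<dots> = (\<Sum>i<n. \<Sum>k<n. \<Sum>j<n. cnj (u i) * v j * (U i k * cnj (U j k)))"
    by (rule sum.swap)
  also have "\<dots> = (\<Sum>i<n. \<Sum>j<n. \<Sum>k<n. cnj (u i) * v j * (U i k * cnj (U j k)))"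
    by (intro sum.cong refl sum.swap)
  also have "\<dots> = (\<Sum>i<n. \<Sum>j<n. if j = i then cnj (u i) * v i else 0)"
    by (intro sum.cong refl) (auto simp: sum_distrib_left[symmetric] unitary_rows[OF U])
  finally show ?thesis by simp
qed

lemma mcoord_combination:
  assumes U: "mat_unitary n U" and k: "k < n"
  shows "mcoord n U (\<lambda>i. \<Sum>l<n. U i l * c l) k = c k"
proof -
  have "mcoord n U (\<lambda>i. \<Sum>l<n. U i l * c l) k = (\<Sum>i<n. \<Sum>l<n. c l * (cnj (U i k) * U i l))"
    unfolding mcoord_def by (intro sum.cong refl) (simp add: sum_distrib_left mult_ac)
  also have "\<dots> = (\<Sum>l<n. \<Sum>i<n. c l * (cnj (U i k) * U i l))" by (rule sum.swap)
  also have "\<dots> = (\<Sum>l<n. if l = k then c k else 0)"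
    using U k by (intro sum.cong refl) (auto simp: sum_distrib_left[symmetric] mat_unitary_def)
  finally show ?thesis using k by simp
qed

lemma mat_pd_mspec:
  assumes U: "mat_unitary n U"
  shows "mat_pd n (mspec n U d) \<longleftrightarrow> (\<forall>k<n. d k > 0)"
proof
  assume pd: "mat_pd n (mspec n U d)"
  show "\<forall>k<n. d k > 0"
  proof (intro allI impI)
    fix k assume k: "k < n"
    \<comment> \<open>The \<open>k\<close>-th column of \<open>U\<close>, written as a combination
      of columns so that \<open>mcoord_combination\<close> gives its coordinates.\<close>
    define v where "v = (\<lambda>i. \<Sum>l<n. U i l * (if l = k then 1 else 0))"
    have co: "mcoord n U v l = (if l = k then 1 else 0)" if "l < n" for l
      unfolding v_def using mcoord_combination[OF U that] by simp
    have "\<exists>i<n. v i \<noteq> 0"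
    proof (rule ccontr)
      assume "\<not> ?thesis"
      then have "mcoord n U v k = 0" by (simp add: mcoord_def)
      then show False using co[OF k] by simp
    qed
    then have "Re (quad_form n (mspec n U d) v) > 0" using pd by (simp add: mat_pd_def)
    also have "Re (quad_form n (mspec n U d) v) = (\<Sum>l<n. if l = k then d k else 0)"
      unfolding quad_form_mspec Re_complex_of_real by (intro sum.cong) (auto simp: co)
    finally show "d k > 0" using k by simp
  qed
next
  assume d: "\<forall>k<n. d k > 0"
  have "Re (quad_form n (mspec n U d) v) > 0" if v: "\<exists>i<n. v i \<noteq> 0" for v
  proof -
    have "\<exists>k<n. mcoord n U v k \<noteq> 0"
    proof (rule ccontr)
      assume "\<not> ?thesis"
      then have "(\<Sum>i<n. cnj (v i) * v i) = 0" using parseval[OF U, of v v] by simp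
      then have "complex_of_real (\<Sum>i<n. (cmod (v i))\<^sup>2) = 0"
        by (simp add: complex_norm_square mult.commute del: of_real_power)
      then have "(\<Sum>i<n. (cmod (v i))\<^sup>2) = 0" by (simp only: of_real_eq_0_iff)
      then show False using v by (auto simp: sum_nonneg_eq_0_iff)
    qed
    then obtain k where "k < n" "mcoord n U v k \<noteq> 0" by blast
    then show ?thesis unfolding quad_form_mspec Re_complex_of_real using d
      by (intro sum_pos2[of _ k]) (auto simp: less_imp_le)
  qed
  then show "mat_pd n (mspec n U d)" by (simp add: mat_pd_def mat_hermitian_mspec)
qed

text \<open>Legendre duality: the quadratic form of the inverse at \<open>v\<close> is the maximum over \<open>u\<close> of
  \<open>2 Re \<langle>u, v\<rangle> - \<langle>u, A u\<rangle>\<close>, which is antitone in \<open>A\<close>.\<close>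

lemma inverse_quad_form_dual:
  assumes U: "mat_unitary n U" and d: "\<forall>k<n. d k > 0"
  shows "2 * Re (\<Sum>i<n. cnj (u i) * v i) - Re (quad_form n (mspec n U d) u)
      \<le> Re (quad_form n (mspec n U (\<lambda>k. inverse (d k))) v)"
    and "\<exists>u. 2 * Re (\<Sum>i<n. cnj (u i) * v i) - Re (quad_form n (mspec n U d) u)
      = Re (quad_form n (mspec n U (\<lambda>k. inverse (d k))) v)"
proof -
  have expand: "2 * Re (\<Sum>i<n. cnj (u i) * v i) - Re (quad_form n (mspec n U d) u)
    = (\<Sum>k<n. 2 * Re (cnj (mcoord n U u k) * mcoord n U v k) - d k * (cmod (mcoord n U u k))\<^sup>2)" for u
    unfolding parseval[OF U, of u v, symmetric] quad_form_mspec Re_complex_of_real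
    by (simp add: sum_subtractf sum_distrib_left Re_sum)
  \<comment> \<open>Completing the square in one coordinate, with \<open>r\<close> as the
    eigenvalue.\<close>
  have term_le: "2 * Re (cnj x * y) - r * (cmod x)\<^sup>2 \<le> inverse r * (cmod y)\<^sup>2" if "r > 0" for x y r
  proof -
    have "0 \<le> inverse r * (cmod (complex_of_real r * x - y))\<^sup>2" using that by simp
    also have "\<dots> = inverse r * (r\<^sup>2 * (cmod x)\<^sup>2 - 2 * r * Re (cnj x * y) + (cmod y)\<^sup>2)"
      by (simp add: cmod_power2) (simp add: power2_eq_square algebra_simps)
    also have "\<dots> = r * (cmod x)\<^sup>2 - 2 * Re (cnj x * y) + inverse r * (cmod y)\<^sup>2"
      using that by (simp add: field_simps power2_eq_square)
    finally show ?thesis by simp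
  qed
  show "2 * Re (\<Sum>i<n. cnj (u i) * v i) - Re (quad_form n (mspec n U d) u)
      \<le> Re (quad_form n (mspec n U (\<lambda>k. inverse (d k))) v)"
    unfolding expand unfolding quad_form_mspec Re_complex_of_real
    using d by (intro sum_mono term_le) auto
  \<comment> \<open>The maximizer is the inverse matrix applied to \<open>v\<close>, with
    coordinates divided by the eigenvalues.\<close>
  define u where "u = (\<lambda>i. \<Sum>l<n. U i l * (complex_of_real (inverse (d l)) * mcoord n U v l))"
  have co: "mcoord n U u k = complex_of_real (inverse (d k)) * mcoord n U v k" if "k < n" for k
    unfolding u_def by (rule mcoord_combination[OF U that])
  have "2 * Re (\<Sum>i<n. cnj (u i) * v i) - Re (quad_form n (mspec n U d) u)
      = Re (quad_form n (mspec n U (\<lambda>k. inverse (d k))) v)"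
    unfolding expand unfolding quad_form_mspec Re_complex_of_real
  proof (intro sum.cong refl)
    fix k assume k: "k \<in> {..<n}"
    then have dk: "d k > 0" using d by auto
    let ?y = "mcoord n U v k"
    have "Re (cnj (complex_of_real (inverse (d k)) * ?y) * ?y) = inverse (d k) * (cmod ?y)\<^sup>2"
      using dk by (simp add: cmod_power2) (simp add: power2_eq_square field_simps)
    moreover have "d k * (cmod (complex_of_real (inverse (d k)) * ?y))\<^sup>2 = inverse (d k) * (cmod ?y)\<^sup>2"
      using dk by (simp add: norm_mult power_mult_distrib power2_eq_square norm_inverse)
    ultimately show "2 * Re (cnj (mcoord n U u k) * ?y) - d k * (cmod (mcoord n U u k))\<^sup>2
        = inverse (d k) * (cmod ?y)\<^sup>2"
      using co[of k] k by simp
  qed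
  then show "\<exists>u. 2 * Re (\<Sum>i<n. cnj (u i) * v i) - Re (quad_form n (mspec n U d) u)
      = Re (quad_form n (mspec n U (\<lambda>k. inverse (d k))) v)" by blast
qed

lemma quad_form_diff: "quad_form n (\<lambda>i j. B i j - A i j) v = quad_form n B v - quad_form n A v"
  by (simp add: quad_form_def sum_subtractf algebra_simps)

lemma mat_hermitian_diff:
  "mat_hermitian n A \<Longrightarrow> mat_hermitian n B \<Longrightarrow> mat_hermitian n (\<lambda>i j. B i j - A i j)"
  unfolding mat_hermitian_def complex_cnj_diff by metis

lemma mat_le_iff:
  assumes "mat_hermitian n A" "mat_hermitian n B"
  shows "mat_le n A B \<longleftrightarrow> (\<forall>v. Re (quad_form n A v) \<le> Re (quad_form n B v))"
  using mat_hermitian_diff[OF assms] by (simp add: mat_le_def mat_psd_def quad_form_diff)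

text \<open>The maximizer \<open>u\<close> for the larger matrix is used as a test vector in the
  dual formula for the smaller one.\<close>

lemma mat_le_inverse:
  assumes U: "mat_unitary n U" "\<forall>k<n. d k > 0" and V: "mat_unitary n V" "\<forall>k<n. e k > 0"
    and le: "mat_le n (mspec n U d) (mspec n V e)"
  shows "mat_le n (mspec n V (\<lambda>k. inverse (e k))) (mspec n U (\<lambda>k. inverse (d k)))"
  unfolding mat_le_iff[OF mat_hermitian_mspec mat_hermitian_mspec]
proof
  fix v
  obtain u where u: "2 * Re (\<Sum>i<n. cnj (u i) * v i) - Re (quad_form n (mspec n V e) u)
      = Re (quad_form n (mspec n V (\<lambda>k. inverse (e k))) v)"
    using inverse_quad_form_dual(2)[OF V] by blast
  have "Re (quad_form n (mspec n U d) u) \<le> Re (quad_form n (mspec n V e) u)"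
    using le by (simp add: mat_le_iff mat_hermitian_mspec)
  then show "Re (quad_form n (mspec n V (\<lambda>k. inverse (e k))) v)
      \<le> Re (quad_form n (mspec n U (\<lambda>k. inverse (d k))) v)"
    using inverse_quad_form_dual(1)[OF U, of u v] u by linarith
qed

lemma mat_pd_ex_mspec:
  assumes "mat_pd n A"
  obtains U d where "mat_unitary n U" "\<forall>k<n. d k > 0"
    "\<And>i j. i < n \<Longrightarrow> j < n \<Longrightarrow> A i j = mspec n U d i j"
proof -
  obtain U d where U: "mat_unitary n U" "\<And>i j. i < n \<Longrightarrow> j < n \<Longrightarrow> A i j = mspec n U d i j"
    using hermitian_ex_mspec[of n A] assms by (auto simp: mat_pd_def)
  have "quad_form n A v = quad_form n (mspec n U d) v" for v
    unfolding quad_form_def by (intro sum.cong refl) (auto simp: U(2))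
  then have "mat_pd n (mspec n U d)" using assms by (simp add: mat_pd_def mat_hermitian_mspec)
  then show ?thesis using that U mat_pd_mspec[OF U(1)] by blast
qed

text \<open>Inversion reverses the order once before and once after \<open>f\<close>, and the two
  reversals cancel.\<close>

lemma operator_monotone_adjoint:
  assumes f: "operator_monotone_pos f" and pos: "\<And>t. t > 0 \<Longrightarrow> f t > 0"
  shows "operator_monotone_pos (\<lambda>t. inverse (f (inverse t)))"
  unfolding operator_monotone_pos_def
proof (intro allI impI)
  fix n A B assume AB: "mat_pd n A \<and> mat_pd n B \<and> mat_le n A B"
  obtain U d where U: "mat_unitary n U" "\<forall>k<n. d k > 0"
    "\<And>i j. i < n \<Longrightarrow> j < n \<Longrightarrow> A i j = mspec n U d i j" using AB mat_pd_ex_mspec by metis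
  obtain V e where V: "mat_unitary n V" "\<forall>k<n. e k > 0"
    "\<And>i j. i < n \<Longrightarrow> j < n \<Longrightarrow> B i j = mspec n V e i j" using AB mat_pd_ex_mspec by metis
  have qA: "quad_form n A v = quad_form n (mspec n U d) v"
    and qB: "quad_form n B v = quad_form n (mspec n V e) v" for v
    unfolding quad_form_def by (intro sum.cong refl; auto simp: U(3) V(3))+
  have "mat_le n (mspec n U d) (mspec n V e)"
    using AB mat_le_iff[of n A B] by (simp add: mat_le_iff mat_hermitian_mspec mat_pd_def qA qB)
  then have "mat_le n (mspec n V (\<lambda>k. inverse (e k))) (mspec n U (\<lambda>k. inverse (d k)))"
    by (rule mat_le_inverse[OF U(1,2) V(1,2)])
  moreover have "mat_pd n (mspec n V (\<lambda>k. inverse (e k)))" "mat_pd n (mspec n U (\<lambda>k. inverse (d k)))"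
    using U V by (simp_all add: mat_pd_mspec)
  ultimately have "mat_le n (mat_fun n f (mspec n V (\<lambda>k. inverse (e k))))
      (mat_fun n f (mspec n U (\<lambda>k. inverse (d k))))"
    using f by (simp add: operator_monotone_pos_def)
  then have "mat_le n (mspec n V (\<lambda>k. f (inverse (e k)))) (mspec n U (\<lambda>k. f (inverse (d k))))"
    by (simp add: mat_fun_mspec U V)
  then have "mat_le n (mspec n U (\<lambda>k. inverse (f (inverse (d k)))))
      (mspec n V (\<lambda>k. inverse (f (inverse (e k)))))"
    by (intro mat_le_inverse) (use U V pos in auto)
  then show "mat_le n (mat_fun n (\<lambda>t. inverse (f (inverse t))) A)
      (mat_fun n (\<lambda>t. inverse (f (inverse t))) B)"
    using mat_fun_eq[OF U(1,3)] mat_fun_eq[OF V(1,3)] by simp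
qed

text \<open>Operator monotonicity on matrices of size 1, diagonalized by the unitary 1.\<close>

lemma operator_monotone_mono:
  assumes f: "operator_monotone_pos f" and xy: "0 < x" "x \<le> y"
  shows "f x \<le> f y"
proof -
  have U: "mat_unitary 1 (\<lambda>_ _. 1)" by (simp add: mat_unitary_def)
  have q: "Re (quad_form 1 (mspec 1 (\<lambda>_ _. 1) (\<lambda>_. z)) v) = z * (cmod (v 0))\<^sup>2" for z v
    by (simp add: quad_form_mspec mcoord_def)
  have "mat_le 1 (mspec 1 (\<lambda>_ _. 1) (\<lambda>_. x)) (mspec 1 (\<lambda>_ _. 1) (\<lambda>_. y))"
    unfolding mat_le_iff[OF mat_hermitian_mspec mat_hermitian_mspec] q
    using xy by (auto intro: mult_right_mono)
  moreover have "mat_pd 1 (mspec 1 (\<lambda>_ _. 1) (\<lambda>_. z))" if "z > 0" for z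
    unfolding mat_pd_mspec[OF U] using that by simp
  ultimately have "mat_le 1 (mat_fun 1 f (mspec 1 (\<lambda>_ _. 1) (\<lambda>_. x)))
      (mat_fun 1 f (mspec 1 (\<lambda>_ _. 1) (\<lambda>_. y)))"
    using f[unfolded operator_monotone_pos_def, rule_format] xy by simp
  then have "mat_le 1 (mspec 1 (\<lambda>_ _. 1) (\<lambda>_. f x)) (mspec 1 (\<lambda>_ _. 1) (\<lambda>_. f y))"
    unfolding mat_fun_mspec[OF U] .
  then have "\<forall>v :: nat \<Rightarrow> complex. f x * (cmod (v 0))\<^sup>2 \<le> f y * (cmod (v 0))\<^sup>2"
    unfolding mat_le_iff[OF mat_hermitian_mspec mat_hermitian_mspec] q .
  from spec[OF this, of "\<lambda>_. 1"] show ?thesis by simp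
qed

section \<open>The characterization of the geometric mean\<close>

text \<open>Supplies the continuity that the rules for \<open>cfc\<close> require and
  \<open>ka_rep\<close> does not state: \<open>f t\<close> is squeezed between \<open>f x\<close>
  and \<open>f x * (t / x)\<close>, which both tend to \<open>f x\<close>.\<close>

lemma continuous_on_symmetric_mono:
  fixes f :: "real \<Rightarrow> real"
  assumes mono: "\<And>x y. 0 < x \<Longrightarrow> x \<le> y \<Longrightarrow> f x \<le> f y" and sym: "ka_symmetric f"
  shows "continuous_on {0<..} f"
  unfolding continuous_on_def
proof
  fix x :: real assume "x \<in> {0<..}"
  then have x: "x > 0" by simp
  \<comment> \<open>by symmetry, \<open>f t / t = f (1 / t)\<close> is antitone\<close>
  have growth: "f t \<le> f s * (t / s)" if "0 < s" "s \<le> t" for s t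
  proof -
    have "f (1 / t) \<le> f (1 / s)" using that by (intro mono) (auto simp: frac_le)
    moreover have "f t = t * f (1 / t)" "f s = s * f (1 / s)"
      using sym that by (auto simp: ka_symmetric_def)
    ultimately show ?thesis using that by (simp add: mult_left_mono)
  qed
  have ev: "\<forall>\<^sub>F t in at x within {0<..}. t > 0" by (simp add: eventually_at_filter)
  show "(f \<longlongrightarrow> f x) (at x within {0<..})"
  proof (rule tendsto_sandwich)
    show "\<forall>\<^sub>F t in at x within {0<..}. min (f x) (f x * (t / x)) \<le> f t"
      using ev
    proof eventually_elim
      case (elim t)
      show ?case
      proof (cases "t \<le> x")
        case True
        from growth[OF elim True] have "f x * (t / x) \<le> f t" using elim x by (simp add: field_simps)
        then show ?thesis by simp
      next
        case False
        then show ?thesis using mono[of x t] x by simp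
      qed
    qed
    show "\<forall>\<^sub>F t in at x within {0<..}. f t \<le> max (f x) (f x * (t / x))"
      using ev
    proof eventually_elim
      case (elim t)
      show ?case
      proof (cases "t \<le> x")
        case True
        then show ?thesis using mono[OF elim True] by simp
      next
        case False
        then show ?thesis using growth[of x t] x by simp
      qed
    qed
    have lin: "((\<lambda>t. f x * (t / x)) \<longlongrightarrow> f x * (x / x)) (at x within {0<..})"
      using x by (intro tendsto_intros) auto
    show "((\<lambda>t. min (f x) (f x * (t / x))) \<longlongrightarrow> f x) (at x within {0<..})"
      using tendsto_min[OF tendsto_const lin, of "f x"] x by simp
    show "((\<lambda>t. max (f x) (f x * (t / x))) \<longlongrightarrow> f x) (at x within {0<..})"
      using tendsto_max[OF tendsto_const lin, of "f x"] x by simp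
  qed
qed

lemma strict_mono_or_antimono_imp_inj_on:
  fixes \<phi> :: "real \<Rightarrow> real"
  assumes "strict_mono_on S \<phi> \<or> strict_antimono_on S \<phi>"
  shows "inj_on \<phi> S"
  using assms
proof
  assume "strict_mono_on S \<phi>"
  then show ?thesis by (rule strict_mono_on_imp_inj_on)
next
  assume anti: "strict_antimono_on S \<phi>"
  show ?thesis
  proof (rule inj_onI)
    fix x y assume "x \<in> S" "y \<in> S" "\<phi> x = \<phi> y"
    then show "x = y"
      using anti by (metis linorder_neqE_linordered_idom monotone_onD order_less_irrefl)
  qed
qed

theorem theorem4:
  fixes f :: "real \<Rightarrow> real"
  assumes sigma: "ka_rep f"
    and sym: "ka_symmetric f"
    and noncomm: "\<exists>x y :: 'a::cstar_algebra. x * y \<noteq> y * x"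
  shows "(\<forall>t>0. f t = sqrt t) \<longleftrightarrow>
    \<not> (\<exists>g \<phi>. ka_rep g \<and> (\<exists>t>0. g t \<noteq> f t) \<and>
          continuous_on {0<..} \<phi> \<and> \<phi> ` {0<..} \<subseteq> {0<..} \<and>
          (strict_mono_on {0<..} \<phi> \<or> strict_antimono_on {0<..} \<phi>) \<and>
          (\<forall>a \<in> (pos_def_cone :: 'a set). \<forall>b \<in> (pos_def_cone :: 'a set).
             ka_mean g a b = cfc (inv_into {0<..} \<phi>) (ka_mean f (cfc \<phi> a) (cfc \<phi> b))))"
    (is "?geo \<longleftrightarrow> \<not> ?other")
proof (intro iffI notI)
  assume geo: ?geo and ?other
  then obtain g \<phi> t where g: "ka_rep g" and t: "t > 0" "g t \<noteq> f t"
    and \<phi>: "continuous_on {0<..} \<phi>" "\<phi> ` {0<..} \<subseteq> {0<..}"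
      "strict_mono_on {0<..} \<phi> \<or> strict_antimono_on {0<..} \<phi>"
    and quasi: "\<And>a b :: 'a. a \<in> pos_def_cone \<Longrightarrow> b \<in> pos_def_cone \<Longrightarrow>
      ka_mean g a b = cfc (inv_into {0<..} \<phi>) (ka_mean f (cfc \<phi> a) (cfc \<phi> b))"
    by blast
  have pd: "cfc \<phi> a \<in> pos_def_cone" if "a \<in> pos_def_cone" for a :: 'a
    using that \<phi> by (intro cfc_pos_def_cone) auto
  have "g t = sqrt t"
  proof (rule quasi_geometric_mean_is_geometric[OF noncomm _ \<phi>(1) _ \<phi>(2) _ t(1)])
    show "g t > 0" if "t > 0" for t using g that by (simp add: ka_rep_def)
    show "inj_on \<phi> {0<..}" by (rule strict_mono_or_antimono_imp_inj_on[OF \<phi>(3)])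
    fix a b :: 'a assume ab: "a \<in> pos_def_cone" "b \<in> pos_def_cone"
    have "ka_mean f (cfc \<phi> a) (cfc \<phi> b) = ka_mean sqrt (cfc \<phi> a) (cfc \<phi> b)"
      using geo by (intro ka_mean_cong pd ab) simp
    then show "ka_mean g a b = cfc (inv_into {0<..} \<phi>) (ka_mean sqrt (cfc \<phi> a) (cfc \<phi> b))"
      using quasi[OF ab] by simp
  qed
  then show False using t geo by simp
next
  assume no_other: "\<not> ?other"
  have mono: "f x \<le> f y" if "0 < x" "x \<le> y" for x y
    using operator_monotone_mono that sigma by (auto simp: ka_rep_def)
  have pos: "f t > 0" if "t > 0" for t using sigma that by (simp add: ka_rep_def)
  have cont: "continuous_on {0<..} f" by (rule continuous_on_symmetric_mono[OF mono sym])
  let ?\<phi> = "inverse :: real \<Rightarrow> real"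
  define g where "g = (\<lambda>t. inverse (f (inverse t)))"
  have g: "ka_rep g"
    using operator_monotone_adjoint[of f] sigma pos by (auto simp: ka_rep_def g_def)
  have inv: "continuous_on {0<..} ?\<phi>" by (intro continuous_intros) auto
  have anti: "strict_antimono_on {0<..} ?\<phi>" by (auto simp: monotone_on_def)
  \<comment> \<open>This holds only at positive arguments, so the mean is placed in the cone before
    \<open>cfc_cong_pos\<close> exchanges the two functions.\<close>
  have inv_into: "inv_into {0<..} ?\<phi> y = inverse y" if "y > 0" for y :: real
    using that by (intro inv_into_f_eq) (auto simp: inj_on_def)
  have quasi: "ka_mean g a b = cfc (inv_into {0<..} ?\<phi>) (ka_mean f (cfc ?\<phi> a) (cfc ?\<phi> b))"
    if ab: "a \<in> pos_def_cone" "b \<in> pos_def_cone" for a b :: 'a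
  proof -
    have "ka_mean f (cfc ?\<phi> a) (cfc ?\<phi> b) \<in> pos_def_cone"
      by (intro ka_mean_pos cfc_inverse_pos ab cont pos)
    then have "cfc (inv_into {0<..} ?\<phi>) (ka_mean f (cfc ?\<phi> a) (cfc ?\<phi> b))
        = cfc inverse (ka_mean f (cfc ?\<phi> a) (cfc ?\<phi> b))"
      by (rule cfc_cong_pos) (rule inv_into)
    then show ?thesis using ka_mean_adjoint[OF ab cont pos] by (simp add: g_def)
  qed
  \<comment> \<open>The adjoint mean is a competitor of the required form, so the absence of a
    different one makes it coincide with the given mean.\<close>
  have same: "g t = f t" if "t > 0" for t
  proof (rule ccontr)
    assume "g t \<noteq> f t"
    then have ?other
      using g inv anti quasi that by (intro exI[of _ g] exI[of _ ?\<phi>]) auto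
    then show False using no_other by contradiction
  qed
  show ?geo
  proof (intro allI impI)
    fix t :: real assume t: "t > 0"
    \<comment> \<open>Self-adjointness of the mean, combined with symmetry, gives
      \<open>f t * f t = t * (f t * f (inverse t)) = t\<close>.\<close>
    have "f t * f (inverse t) = 1" using same[OF t] pos[of t] pos[of "inverse t"] t
      by (simp add: g_def field_simps)
    moreover have "t * f (inverse t) = f t" using sym t by (simp add: ka_symmetric_def inverse_eq_divide)
    ultimately have "f t * f t = t" by (metis mult.assoc mult.commute mult.right_neutral)
    then have "sqrt t = sqrt (f t * f t)" by simp
    then show "f t = sqrt t" using pos[OF t] by simp
  qed
qed

end
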